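(* Let $S$ be the set of all (unlabelled, isomorphism classes of) tree graphs on $n$ vertices. Define the relation $T'\le T$ on $S$ if $T'$ can be obtained by applying any number (possibly zero) of tree shifts to $T$. Then $\le$ defines a partial order on $S$ with the following properties. \begin{itemize} \item $\mathrm{Path}_n$ is the unique $\le$-minimum element. \item $K_{1,n-1}$ is the unique $\le$-maximum element. \item $T'\le T$ implies $\gamma(\mathcal{B}(T'))\le\gamma(\mathcal{B}(T))$. \end{itemize}
   Context: Graphs are finite, with no loops or multiple edges. A leaf of a graph is a vertex of degree one. $\mathrm{Path}_n$ denotes the path graph with $n$ vertices, and $K_{1,n-1}$ the star graph with $n$ vertices (one vertex of degree $n-1$ and $n-1$ vertices of degree $1$). Graphical building set: for a graph $G$ with vertices labelled distinctly by $[n]=\{1,\dots,n\}$, $\mathcal{B}(G)$ is the set of all non-empty subsets $I\subseteq[n]$ such that the induced subgraph of $G$ on $I$ is connected. Graph-associahedron: let $e_1,\dots,e_n$ be the endpoints of the coordinate vectors in $\mathbb{R}^n$, and for $I\subseteq[n]$ let $\Delta_I=\mathrm{ConvexHull}(e_i \mid i\in I)$. The graph-associahedron of $G$ is the Minkowski sum $P_{\mathcal{B}(G)}=\sum_{I\in\mathcal{B}(G)}\Delta_I$. It is a simple polytope of dimension $n$ minus the number of connected components of $G$. $\gamma$-polynomial: for a simple $d$-dimensional polytope $P$, let $f(P)(t)=f_0+f_1t+\cdots+f_dt^d$, where $f_i$ is the number of $i$-dimensional faces of $P$. Define $h(P)(t)=\sum_{i=0}^d h_it^i$ by $h(P)(t+1)=f(P)(t)$.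 This polynomial is symmetric, so it can be written uniquely as $\sum_{i=0}^{d}h_it^i=\sum_{i=0}^{\lfloor d/2\rfloor}\gamma_i t^i(1+t)^{d-2i}$ with $\gamma_i\in\mathbb{Z}$. Set $\gamma(P)(t)=\gamma_0+\gamma_1t+\cdots+\gamma_{\lfloor d/2\rfloor}t^{\lfloor d/2\rfloor}$ and $\gamma(\mathcal{B}(G))=\gamma(P_{\mathcal{B}(G)})$; this does not depend on the labelling of the vertices of $G$. The notation $\gamma(\mathcal{B})\le\gamma(\mathcal{B}')$ means that for all $i$ the coefficient of $t^i$ in $\gamma(\mathcal{B})$ is at most the coefficient of $t^i$ in $\gamma(\mathcal{B}')$. Tree shift: let $G$ be a connected graph with the following properties and data. (1) $G$ has a leaf $l$; the nearest vertex to $l$ of degree greater than $2$ is called $c$, and the vertices in the path from $c$ to $l$ are, in order, $c,c_1,c_2,\dots,c_k,l$ (with $k\ge 0$). (2) There is a set $F$ of vertices of $G-\{c,c_1,\dots,c_k,l\}$ such that the subgraph of $G$ on $F\cup\{c\}$ is a tree, and such that no vertex of $G-(\{c\}\cup F)$ is adjacent to a vertex in $F$. (3) The set $E=G-(F\cup\{c,c_1,\dots,c_k,l\})$ of remaining vertices is non-empty. The tree shift of $G$ (with respect to these data) is the graph obtained from $G$ by removing every edge $(v,c)$ with $v\in F$ and replacing it with the edge $(v,l)$. *)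

theory Defs
  imports "HOL-Analysis.Analysis" "HOL-Computational_Algebra.Polynomial"
begin

section \<open>Finite simple graphs\<close>

type_synonym 'v ugraph = "'v set \<times> 'v set set"

abbreviation verts :: "'v ugraph \<Rightarrow> 'v set" where "verts \<equiv> fst"
abbreviation edges :: "'v ugraph \<Rightarrow> 'v set set" where "edges \<equiv> snd"

definition simple_graph :: "'v ugraph \<Rightarrow> bool" where
  "simple_graph G \<longleftrightarrow> finite (verts G) \<and> (\<forall>e\<in>edges G. e \<subseteq> verts G \<and> card e = 2)"

definition adj :: "'v ugraph \<Rightarrow> 'v \<Rightarrow> 'v \<Rightarrow> bool" where
  "adj G u v \<longleftrightarrow> {u, v} \<in> edges G"

definition deg :: "'v ugraph \<Rightarrow> 'v \<Rightarrow> nat" where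
  "deg G v = card {u \<in> verts G. adj G v u}"

definition leaf :: "'v ugraph \<Rightarrow> 'v \<Rightarrow> bool" where
  "leaf G v \<longleftrightarrow> v \<in> verts G \<and> deg G v = 1"

definition induced :: "'v ugraph \<Rightarrow> 'v set \<Rightarrow> 'v ugraph" where
  "induced G I = (I, {e \<in> edges G. e \<subseteq> I})"

text \<open>A path is given by the list of its (pairwise distinct) vertices.\<close>

definition graph_path :: "'v ugraph \<Rightarrow> 'v list \<Rightarrow> bool" where
  "graph_path G p \<longleftrightarrow>
     p \<noteq> [] \<and> set p \<subseteq> verts G \<and> distinct p \<and> successively (adj G) p"

definition graph_connected :: "'v ugraph \<Rightarrow> bool" where
  "graph_connected G \<longleftrightarrow>
     (\<forall>u\<in>verts G. \<forall>v\<in>verts G. \<exists>p. graph_path G p \<and> hd p = u \<and> last p = v)"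

text \<open>The distance is only meaningful for two vertices that are joined by a path.\<close>

definition graph_dist :: "'v ugraph \<Rightarrow> 'v \<Rightarrow> 'v \<Rightarrow> nat" where
  "graph_dist G u v =
     (LEAST k. \<exists>p. graph_path G p \<and> hd p = u \<and> last p = v \<and> length p = Suc k)"

definition graph_acyclic :: "'v ugraph \<Rightarrow> bool" where
  "graph_acyclic G \<longleftrightarrow>
     \<not> (\<exists>p. graph_path G p \<and> length p \<ge> 3 \<and> adj G (last p) (hd p))"

definition tree_graph :: "'v ugraph \<Rightarrow> bool" where
  "tree_graph G \<longleftrightarrow>
     simple_graph G \<and> verts G \<noteq> {} \<and> graph_connected G \<and> graph_acyclic G"

definition graph_iso :: "'v ugraph \<Rightarrow> 'w ugraph \<Rightarrow> bool" where
  "graph_iso G H \<longleftrightarrow>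
     (\<exists>f. bij_betw f (verts G) (verts H) \<and>
          (\<forall>u\<in>verts G. \<forall>v\<in>verts G. adj G u v \<longleftrightarrow> adj H (f u) (f v)))"

definition path_graph :: "nat \<Rightarrow> nat ugraph" where
  "path_graph n = ({1..n}, {{i, Suc i} | i. 1 \<le> i \<and> i < n})"

definition star_graph :: "nat \<Rightarrow> nat ugraph" where
  "star_graph n = ({1..n}, {{1, i} | i. 2 \<le> i \<and> i \<le> n})"

section \<open>Tree shifts\<close>

text \<open>
  The data of a tree shift are a leaf \<open>l\<close>, the nearest vertex \<open>c\<close> of degree greater than two,
  the list \<open>cs\<close> of the vertices \<open>c\<^sub>1, \<dots>, c\<^sub>k\<close> strictly between \<open>c\<close> and \<open>l\<close> (possibly
  empty), and the set \<open>F\<close>.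
\<close>

definition tree_shift_data :: "'v ugraph \<Rightarrow> 'v \<Rightarrow> 'v list \<Rightarrow> 'v \<Rightarrow> 'v set \<Rightarrow> bool" where
  "tree_shift_data G c cs l F \<longleftrightarrow>
     simple_graph G \<and> graph_connected G \<and>
     leaf G l \<and>
     c \<in> verts G \<and> deg G c > 2 \<and>
     (\<forall>v\<in>verts G. deg G v > 2 \<longrightarrow> graph_dist G l c \<le> graph_dist G l v) \<and>
     graph_path G (c # cs @ [l]) \<and>
     F \<subseteq> verts G - set (c # cs @ [l]) \<and>
     tree_graph (induced G (insert c F)) \<and>
     (\<forall>u \<in> verts G - insert c F. \<forall>v\<in>F. \<not> adj G u v) \<and>
     verts G - (F \<union> set (c # cs @ [l])) \<noteq> {}"

definition shift_graph :: "'v ugraph \<Rightarrow> 'v \<Rightarrow> 'v \<Rightarrow> 'v set \<Rightarrow> 'v ugraph" where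
  "shift_graph G c l F =
     (verts G, (edges G - {{v, c} | v. v \<in> F}) \<union> {{v, l} | v. v \<in> F \<and> adj G v c})"

definition tree_shift :: "'v ugraph \<Rightarrow> 'v ugraph \<Rightarrow> bool" where
  "tree_shift G G' \<longleftrightarrow> (\<exists>c cs l F. tree_shift_data G c cs l F \<and> G' = shift_graph G c l F)"

section \<open>Isomorphism classes\<close>

text \<open>
  The finite type \<open>'v\<close> plays the role of the label set \<open>[n]\<close>, where \<open>n = CARD('v)\<close>. An unlabelled
  graph on \<open>n\<close> vertices is the set of all its labellings by \<open>'v\<close>, so the vertex set
  of every member of a class is all of \<open>'v\<close>. The argument of \<open>iso_class\<close> may have vertices
  of another type, as for \<open>path_graph n\<close>.
\<close>

definition iso_class :: "'a ugraph \<Rightarrow> 'v::finite ugraph set" where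
  "iso_class H = {G. simple_graph G \<and> verts G = UNIV \<and> graph_iso H G}"

definition tree_classes :: "'v::finite ugraph set set" where
  "tree_classes = {iso_class G | G :: 'v ugraph. tree_graph G \<and> verts G = UNIV}"

text \<open>A pair \<open>(T', T)\<close> in this relation means \<open>T' \<le> T\<close>.\<close>

definition tree_shift_order :: "('v::finite ugraph set \<times> 'v ugraph set) set" where
  "tree_shift_order =
     {(T', T). T' \<in> tree_classes \<and> T \<in> tree_classes \<and>
               (\<exists>G\<in>T. \<exists>G'\<in>T'. tree_shift\<^sup>*\<^sup>* G G')}"

section \<open>Graph-associahedra and their gamma-polynomials\<close>

definition building_set :: "'v ugraph \<Rightarrow> 'v set set" where
  "building_set G = {I. I \<subseteq> verts G \<and> I \<noteq> {} \<and> graph_connected (induced G I)}"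

definition simplex_on :: "'v::finite set \<Rightarrow> (real^'v) set" where
  "simplex_on I = convex hull ((\<lambda>i. axis i 1) ` I)"

text \<open>The sum is the Minkowski sum, by the additive structure on sets of \<open>HOL-Library.Set_Algebras\<close>.\<close>

definition nestohedron :: "'v::finite set set \<Rightarrow> (real^'v) set" where
  "nestohedron B = (\<Sum>I\<in>B. simplex_on I)"

definition polytope_dim :: "'a::euclidean_space set \<Rightarrow> nat" where
  "polytope_dim P = nat (aff_dim P)"

definition face_number :: "'a::euclidean_space set \<Rightarrow> nat \<Rightarrow> nat" where
  "face_number P i = card {A. A face_of P \<and> aff_dim A = int i}"

definition f_poly :: "'a::euclidean_space set \<Rightarrow> int poly" where
  "f_poly P = (\<Sum>i\<le>polytope_dim P. monom (int (face_number P i)) i)"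

definition h_poly :: "'a::euclidean_space set \<Rightarrow> int poly" where
  "h_poly P = pcompose (f_poly P) [:-1, 1:]"

lemma h_poly_shift: "pcompose (h_poly P) [:1, 1:] = f_poly P"
  by (simp add: h_poly_def pcompose_assoc[symmetric] pcompose_pCons)

text \<open>
  The defining expansion exists only when \<open>h_poly P\<close> is symmetric, as it is for a simple
  polytope \<open>P\<close>; otherwise \<open>gamma_poly P\<close> is unspecified.
\<close>

definition gamma_poly :: "'a::euclidean_space set \<Rightarrow> int poly" where
  "gamma_poly P =
     (THE g. degree g \<le> polytope_dim P div 2 \<and>
        h_poly P = (\<Sum>i\<le>polytope_dim P div 2.
                      monom (coeff g i) i * [:1, 1:] ^ (polytope_dim P - 2 * i)))"

definition gamma_building :: "'v::finite set set \<Rightarrow> int poly" where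
  "gamma_building B = gamma_poly (nestohedron B)"

end

theory Submission
  imports Defs
begin

text \<open>
  \<^bold>\<open>The order.\<close> Everything about the order comes from counting leaves. A shift that moves a
  non-empty set \<open>F\<close> turns the leaf \<open>l\<close> into an inner vertex and creates no leaf, because \<open>c\<close>
  keeps a neighbour on the path and one outside it; a shift with empty \<open>F\<close> does nothing. Hence a
  cycle of shifts is trivial (\<open>tree_shift_order_antisym\<close>). A tree with a vertex of degree greater
  than two admits a proper shift (\<open>exists_proper_shift\<close>), so shifting ends at a path. In the
  other direction, if both ends \<open>c\<close>, \<open>l\<close> of an edge have degree at least two, then the tree
  is a shift, along that single edge, of a tree with one more leaf (\<open>exists_unshift\<close>); a tree
  without such an edge is a star.

  \<^bold>\<open>The faces.\<close> A linear functional \<open>w\<close> exposes the face on which it is maximal, and that face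
  is determined by the relation \<open>vis\<close>: a vertex \<open>u\<close> sees \<open>v\<close> if some connected set
  containing both has maximal weight at \<open>u\<close>. So faces correspond to these relations, and the
  dimension is the number of vertices minus the number of classes of mutually visible vertices.
  The face numbers of a graph glued from two pieces at a vertex \<open>c\<close> are not determined by the face
  numbers of the pieces, but they are once each face is also recorded with its \<open>depth\<close>, the number
  of classes that see \<open>c\<close> strictly from above: these classes form a chain, and a face of the glued
  graph is a pair of faces of the pieces together with a way of merging their two chains.

  \<^bold>\<open>The polynomials.\<close> With \<open>s = 1 + \<tau>\<close>, where \<open>\<tau>\<close> is the variable of the \<open>h\<close>-polynomial, put
  \<open>P(z) = \<Sum> (s - 2) ^ dim * (1 + s z) ^ depth\<close>, the sum over all faces of a tree with root \<open>c\<close> and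
  \<open>n\<close> vertices. Then \<open>P = s ^ (n - 1) * \<alpha>(x, z)\<close> with \<open>x = \<tau> / (1 + \<tau>)\<^sup>2\<close> and a polynomial \<open>\<alpha>\<close> with
  natural coefficients (\<open>gamma_spec\<close>), and \<open>\<alpha>(x, 0)\<close> is the \<open>\<gamma>\<close>-polynomial
  (\<open>gamma_building_eq\<close>). Gluing at the root corresponds to the bilinear product \<open>\<star>\<close> (\<open>merge_product\<close>), where
  \<open>z ^ i \<star> z ^ k\<close> counts lattice paths from \<open>(0, 0)\<close> to \<open>(i, k)\<close> with unit steps of weight \<open>z\<close> and
  diagonal steps of weight \<open>x + z\<close> (\<open>gamma_spec_wedge\<close>). Attaching a new root by an edge corresponds
  to the linear operator \<open>X f = z f + f + x (f - f(0)) / z\<close>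
  (\<open>attach_root\<close>, \<open>gamma_spec_pendant\<close>). These rules
  produce \<open>\<alpha>\<close> for every tree and show that its coefficients are natural numbers.

  \<^bold>\<open>The inequality.\<close> Let \<open>\<epsilon>\<close> belong to the part of the tree other than \<open>F\<close> and the path, rooted at
  \<open>c\<close>, let \<open>\<zeta>\<close> belong to \<open>F\<close> with its root, and let the path have \<open>m\<close> edges. Before the shift the
  tree has \<open>(\<epsilon> \<star> X ^ m 1) \<star> \<zeta>\<close>, afterwards \<open>(X ^ m \<epsilon>) \<star> \<zeta>\<close>. Now \<open>X\<close> is multiplication by \<open>z + 1\<close>
  for the Chebyshev-type product \<open>z ^ i \<circ> z ^ k = \<Sum>d \<le> min i k. x ^ d * z ^ (i + k - 2 d)\<close>, so
  \<open>X ^ m \<epsilon> = \<epsilon> \<circ> X ^ m 1\<close>; and \<open>\<circ>\<close> is coefficientwise at most \<open>\<star>\<close>, because its terms are the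
  weights of some of the lattice paths (\<open>merge_product_path_ge\<close>). Since \<open>\<star>\<close> has natural
  coefficients, multiplying by \<open>\<zeta>\<close> preserves the inequality.
\<close>

section \<open>Lattice path products\<close>

text \<open>
  Weighted count of the lattice paths from \<open>(0, 0)\<close> to \<open>(i, k)\<close> with
  unit steps of weight \<open>z\<close> and diagonal steps of weight \<open>x + z\<close>,
  where \<open>z\<close> is the variable of the polynomial. Along an axis there is only one
  path.
\<close>

fun lattice_poly :: "'a::comm_semiring_1 \<Rightarrow> nat \<Rightarrow> nat \<Rightarrow> 'a poly" where
  "lattice_poly x 0 k = monom 1 k"
| "lattice_poly x (Suc i) 0 = monom 1 (Suc i)"
| "lattice_poly x (Suc i) (Suc k) = pCons 0 (lattice_poly x i (Suc k) + lattice_poly x (Suc i) k) + [:x, 1:] * lattice_poly x i k"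

text \<open>
  The sum of \<open>x ^ d * z ^ (i + k - 2 * d)\<close> over \<open>d \<le> min i k\<close>:
  the linearisation of a product of two Chebyshev polynomials of the second kind.
\<close>

fun chebyshev_poly :: "'a::comm_semiring_1 \<Rightarrow> nat \<Rightarrow> nat \<Rightarrow> 'a poly" where
  "chebyshev_poly x 0 k = monom 1 k"
| "chebyshev_poly x (Suc i) 0 = monom 1 (Suc i)"
| "chebyshev_poly x (Suc i) (Suc k) = monom 1 (Suc (Suc (i + k))) + smult x (chebyshev_poly x i k)"

definition bilin :: "(nat \<Rightarrow> nat \<Rightarrow> 'a poly) \<Rightarrow> 'a::comm_semiring_1 poly \<Rightarrow> 'a poly \<Rightarrow> 'a poly" where
  "bilin K f g = (\<Sum>i\<le>degree f. \<Sum>k\<le>degree g. smult (coeff f i * coeff g k) (K i k))"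

lemma bilin_bound:
  assumes "degree f \<le> m" "degree g \<le> n"
  shows "bilin K f g = (\<Sum>i\<le>m. \<Sum>k\<le>n. smult (coeff f i * coeff g k) (K i k))"
proof -
  have in_eq: "(\<Sum>k\<le>degree g. smult (coeff f i * coeff g k) (K i k)) =
      (\<Sum>k\<le>n. smult (coeff f i * coeff g k) (K i k))" for i
    by (rule sum.mono_neutral_left) (use assms in \<open>auto simp: coeff_eq_0\<close>)
  show ?thesis unfolding bilin_def in_eq
    by (rule sum.mono_neutral_left) (use assms in \<open>auto simp: coeff_eq_0\<close>)
qed

lemma smult_sum_distrib: "smult a (\<Sum>i\<in>A. f i) = (\<Sum>i\<in>A. smult a (f i))"
  by (induction A rule: infinite_finite_induct) (auto simp: smult_add_right)

lemma bilin_add_left: "bilin K (f + f') g = bilin K f g + bilin K f' g"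
proof -
  let ?m = "max (degree f) (degree f')"
  have "degree (f + f') \<le> ?m" by (rule degree_add_le) auto
  then show ?thesis
    by (simp add: bilin_bound[of _ ?m _ "degree g"] sum.distrib[symmetric] smult_add_left algebra_simps)
qed

lemma bilin_add_right: "bilin K f (g + g') = bilin K f g + bilin K f g'"
proof -
  let ?m = "max (degree g) (degree g')"
  have "degree (g + g') \<le> ?m" by (rule degree_add_le) auto
  then show ?thesis
    by (simp add: bilin_bound[of _ "degree f" _ ?m] sum.distrib[symmetric] smult_add_left algebra_simps)
qed

lemma bilin_smult_left: "bilin K (smult a f) g = smult a (bilin K f g)"
  by (subst bilin_bound[of _ "degree f" _ "degree g"])
     (auto simp: degree_smult_le bilin_def smult_sum_distrib ac_simps)

lemma bilin_smult_right: "bilin K f (smult a g) = smult a (bilin K f g)"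
  by (subst bilin_bound[of _ "degree f" _ "degree g"])
     (auto simp: degree_smult_le bilin_def smult_sum_distrib ac_simps)

lemma bilin_0 [simp]: "bilin K 0 g = 0" "bilin K f 0 = 0"
  by (simp_all add: bilin_def)

lemma bilin_sum_left: "bilin K (\<Sum>i\<in>A. f i) g = (\<Sum>i\<in>A. bilin K (f i) g)"
  by (induction A rule: infinite_finite_induct) (auto simp: bilin_add_left)

lemma bilin_sum_right: "bilin K f (\<Sum>i\<in>A. g i) = (\<Sum>i\<in>A. bilin K f (g i))"
  by (induction A rule: infinite_finite_induct) (auto simp: bilin_add_right)

lemma bilin_monom: "bilin K (monom 1 i) (monom 1 k) = K i k"
proof -
  have "bilin K (monom 1 i) (monom 1 k) = (\<Sum>i'\<le>i. \<Sum>k'\<le>k. smult (coeff (monom 1 i) i' * coeff (monom 1 k) k') (K i' k'))"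
    by (rule bilin_bound) (auto simp: degree_monom_le)
  also have "\<dots> = (\<Sum>i'\<le>i. if i' = i then K i k else 0)"
    by (rule sum.cong) (auto simp: if_distrib[of "\<lambda>c. smult c _"] cong: if_cong)
  finally show ?thesis by simp
qed

lemma poly_monom_induct [case_names add monom]:
  assumes "\<And>f g. Q f \<Longrightarrow> Q g \<Longrightarrow> Q (f + g)" "\<And>a i. Q (smult a (monom 1 i))"
  shows "Q (f :: 'a::comm_semiring_1 poly)"
proof -
  have "Q (\<Sum>i\<in>A. smult (coeff f i) (monom 1 i))" if "finite A" for A
    using that
  proof (induction A rule: finite_induct)
    case empty show ?case using assms(2)[of 0 0] by simp
  next
    case (insert a A) then show ?case using assms by simp
  qed
  from this[of "{..degree f}"] show ?thesis
    by (simp add: smult_monom poly_as_sum_of_monoms)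
qed

abbreviation merge_product :: "'a::comm_semiring_1 \<Rightarrow> 'a poly \<Rightarrow> 'a poly \<Rightarrow> 'a poly" where
  "merge_product x \<equiv> bilin (lattice_poly x)"

lemma lattice_poly_0_right [simp]: "lattice_poly x i 0 = monom 1 i" by (cases i) auto
lemma chebyshev_poly_0_right [simp]: "chebyshev_poly x i 0 = monom 1 i" by (cases i) auto

lemma merge_product_1_left: "merge_product x 1 g = g"
proof (induction g rule: poly_monom_induct)
  case (add f g) then show ?case by (simp add: bilin_add_right)
next
  case (monom a i) then show ?case
    using bilin_monom[of "lattice_poly x" 0 i] by (simp add: bilin_smult_right monom_0 flip: one_pCons)
qed

lemma merge_product_1_right: "merge_product x f 1 = f"
proof (induction f rule: poly_monom_induct)
  case (add f g) then show ?case by (simp add: bilin_add_left)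
next
  case (monom a i) then show ?case
    using bilin_monom[of "lattice_poly x" i 0] by (simp add: bilin_smult_left monom_0 flip: one_pCons)
qed

lemma pCons0_add: "pCons 0 (f + g) = pCons 0 f + pCons (0::'a::comm_semiring_1) g" by simp
lemma pCons0_smult: "pCons 0 (smult a f) = smult a (pCons (0::'a::comm_semiring_1) f)" by simp

lemma pCons0_monom: "pCons 0 (monom a i) = monom a (Suc i)" by (simp add: monom_Suc)

text \<open>
  The recursion of the lattice path polynomials, extended bilinearly. Together with the two
  unit laws it determines the product.
\<close>

lemma merge_product_step:
  "merge_product x (pCons 0 f) (pCons 0 g) =
     pCons 0 (merge_product x f (pCons 0 g) + merge_product x (pCons 0 f) g) + [:x, 1:] * merge_product x f g"
proof (induction f rule: poly_monom_induct)
  case (add f f')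
  then show ?case unfolding pCons0_add bilin_add_left distrib_left by (simp only: ac_simps)
next
  case (monom a i)
  show ?case
  proof (induction g rule: poly_monom_induct)
    case (add g g')
    then show ?case unfolding pCons0_add bilin_add_right distrib_left by (simp only: ac_simps)
  next
    case (monom b k)
    show ?case
      unfolding pCons0_smult bilin_smult_left bilin_smult_right pCons0_monom bilin_monom lattice_poly.simps
      by (simp only: smult_add_right pCons0_smult mult_smult_right pCons0_add)
  qed
qed

text \<open>
  A step up has weight \<open>z\<close>, a level step weight 1 and a step down weight
  \<open>x\<close>; nothing goes down from level 0, which is why the constant term is
  discarded by \<open>poly_shift\<close>.
\<close>

definition attach_root :: "'a::comm_semiring_1 \<Rightarrow> 'a poly \<Rightarrow> 'a poly" where
  "attach_root x f = pCons 0 f + f + smult x (poly_shift 1 f)"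

lemma poly_shift_add: "poly_shift n (f + g) = poly_shift n f + poly_shift n g"
  by (rule poly_eqI) (simp add: coeff_poly_shift)
lemma poly_shift_smult: "poly_shift n (smult a g) = smult a (poly_shift n g)"
  by (rule poly_eqI) (simp add: coeff_poly_shift)
lemma poly_shift_pCons0: "poly_shift 1 (pCons 0 g) = g"
  by (rule poly_eqI) (simp add: coeff_poly_shift)

lemma attach_root_add: "attach_root x (f + g) = attach_root x f + attach_root x g"
  unfolding attach_root_def poly_shift_add smult_add_right pCons0_add by (simp only: ac_simps)
lemma attach_root_smult: "attach_root x (smult a f) = smult a (attach_root x f)"
  unfolding attach_root_def poly_shift_smult smult_add_right pCons0_smult
  by (simp only: smult_smult mult.commute[of x a])
lemma attach_root_0 [simp]: "attach_root x 0 = 0" by (simp add: attach_root_def)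
lemma attach_root_sum: "attach_root x (\<Sum>i\<in>A. f i) = (\<Sum>i\<in>A. attach_root x (f i))"
  by (induction A rule: infinite_finite_induct) (auto simp: attach_root_add)

lemma attach_root_monom_Suc: "attach_root x (monom 1 (Suc i)) = monom 1 (Suc (Suc i)) + monom 1 (Suc i) + smult x (monom 1 i)"
  unfolding attach_root_def by (simp only: pCons0_monom poly_shift_pCons0[of "monom 1 i", unfolded pCons0_monom])
lemma attach_root_monom_0: "attach_root x (monom 1 0) = monom 1 (Suc 0) + monom 1 0"
  by (auto simp: attach_root_def pCons0_monom poly_eq_iff coeff_poly_shift coeff_pCons split: nat.split)

lemma attach_root_1: "attach_root x 1 = monom 1 (Suc 0) + 1"
  using attach_root_monom_0[of x] by (simp add: monom_0 flip: one_pCons)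

text \<open>
  Apart from the level step, \<open>attach_root x\<close> is Chebyshev multiplication by
  \<open>z\<close>: this is the three-term recurrence of the Chebyshev polynomials.
\<close>

lemma attach_root_chebyshev_poly:
  "attach_root x (chebyshev_poly x i k) = chebyshev_poly x i (Suc k) + chebyshev_poly x i k + (case k of 0 \<Rightarrow> 0 | Suc k' \<Rightarrow> smult x (chebyshev_poly x i k'))"
proof (induction x i k rule: chebyshev_poly.induct)
  case (1 x k)
  then show ?case by (cases k) (simp_all add: attach_root_1 attach_root_monom_Suc)
next
  case (2 x i)
  then show ?case by (simp add: attach_root_monom_Suc ac_simps)
next
  case (3 x i k)
  have "smult x (chebyshev_poly x (Suc i) k) = smult x (monom 1 (i + Suc k)) + (case k of 0 \<Rightarrow> 0 | Suc k' \<Rightarrow> smult x (smult x (chebyshev_poly x i k')))"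
    by (cases k) (simp_all add: smult_add_right)
  then show ?case using 3
    by (simp add: attach_root_add attach_root_monom_Suc attach_root_smult smult_add_right ac_simps split: nat.splits)
qed

text \<open>
  Since the operator is a multiplication in a commutative and associative product, it can be
  moved to either factor.
\<close>

lemma attach_root_cheb: "attach_root x (bilin (chebyshev_poly x) f g) = bilin (chebyshev_poly x) f (attach_root x g)"
proof (induction f rule: poly_monom_induct)
  case (add f f') then show ?case by (simp add: bilin_add_left attach_root_add)
next
  case (monom a i)
  show ?case
  proof (induction g rule: poly_monom_induct)
    case (add g g') then show ?case by (simp add: bilin_add_right attach_root_add)
  next
    case (monom b k)
    show ?case
      unfolding attach_root_smult bilin_smult_left bilin_smult_right bilin_monom attach_root_chebyshev_poly
      by (cases k)
        (simp_all add: attach_root_monom_0 attach_root_monom_Suc bilin_add_right bilin_smult_right bilin_monom ac_simps del: chebyshev_poly.simps monom_eq_1)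
  qed
qed

lemma cheb_1: "bilin (chebyshev_poly x) f 1 = f"
proof (induction f rule: poly_monom_induct)
  case (add f g) then show ?case by (simp add: bilin_add_left)
next
  case (monom a i) then show ?case
    using bilin_monom[of "chebyshev_poly x" i 0] by (simp add: bilin_smult_left monom_0 flip: one_pCons)
qed

lemma attach_root_pow_cheb: "(attach_root x ^^ m) f = bilin (chebyshev_poly x) f ((attach_root x ^^ m) 1)"
  by (induction m) (simp_all add: cheb_1 attach_root_cheb)

lemma lattice_poly_ge_monom: "\<exists>d. lattice_poly (x::'a::comm_semiring_1) i k = monom 1 (i + k) + d"
proof (induction x i k rule: lattice_poly.induct)
  case (1 x k) show ?case by (intro exI[of _ 0]) simp
next
  case (2 x i) show ?case by (intro exI[of _ 0]) simp
next
  case (3 x i k)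
  then obtain d where "lattice_poly x i (Suc k) = monom 1 (i + Suc k) + d" by blast
  then have "lattice_poly x (Suc i) (Suc k) = monom 1 (Suc i + Suc k) +
      (pCons 0 d + pCons 0 (lattice_poly x (Suc i) k) + [:x, 1:] * lattice_poly x i k)"
    by (simp add: ac_simps monom_Suc)
  then show ?case by blast
qed

text \<open>
  Peel off one diagonal step of weight \<open>x\<close>. The remaining term \<open>z ^ (i +
  k)\<close> is the weight of a path without diagonal steps. As the coefficients may be
  natural numbers, inequality is expressed by the existence of a difference.
\<close>

lemma lattice_poly_ge_chebyshev_poly: "\<exists>d. lattice_poly (x::'a::comm_semiring_1) i k = chebyshev_poly x i k + d"
proof (induction x i k rule: chebyshev_poly.induct)
  case (1 x k) show ?case by (intro exI[of _ 0]) simp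
next
  case (2 x i) show ?case by (intro exI[of _ 0]) simp
next
  case (3 x i k)
  then obtain d where d: "lattice_poly x i k = chebyshev_poly x i k + d" by blast
  obtain e where e: "lattice_poly x i (Suc k) = monom 1 (i + Suc k) + e" using lattice_poly_ge_monom by blast
  have "lattice_poly x (Suc i) (Suc k) = chebyshev_poly x (Suc i) (Suc k) +
      (pCons 0 e + pCons 0 (lattice_poly x (Suc i) k) + smult x d + pCons 0 (lattice_poly x i k))"
    by (simp add: d e ac_simps monom_Suc smult_add_right del: lattice_poly.simps(1,2))
  then show ?case by blast
qed

lemma merge_product_ge_cheb: "\<exists>d. merge_product (x::'a::comm_semiring_1) f g = bilin (chebyshev_poly x) f g + d"
proof (induction f rule: poly_monom_induct)
  case (add f f')
  then obtain d d' where "merge_product x f g = bilin (chebyshev_poly x) f g + d" "merge_product x f' g = bilin (chebyshev_poly x) f' g + d'" by blast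
  then show ?case by (intro exI[of _ "d + d'"]) (simp add: bilin_add_left ac_simps)
next
  case (monom a i)
  show ?case
  proof (induction g rule: poly_monom_induct)
    case (add g g')
    then obtain d d' where "merge_product x (smult a (monom 1 i)) g = bilin (chebyshev_poly x) (smult a (monom 1 i)) g + d"
      "merge_product x (smult a (monom 1 i)) g' = bilin (chebyshev_poly x) (smult a (monom 1 i)) g' + d'" by blast
    then show ?case by (intro exI[of _ "d + d'"]) (simp add: bilin_add_right ac_simps)
  next
    case (monom b k)
    obtain d where "lattice_poly x i k = chebyshev_poly x i k + d" using lattice_poly_ge_chebyshev_poly by blast
    then show ?case unfolding bilin_smult_left bilin_smult_right bilin_monom
      by (intro exI[of _ "smult a (smult b d)"]) (simp add: smult_add_right ac_simps)
  qed
qed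

text \<open>
  The comparison behind the shift inequality: gluing a path with \<open>m\<close> edges to the
  root gives at least as much as moving the root away along that path.
\<close>

lemma merge_product_path_ge: "\<exists>d. merge_product x f ((attach_root x ^^ m) 1) = (attach_root x ^^ m) f + d"
  unfolding attach_root_pow_cheb[of m x f] by (rule merge_product_ge_cheb)

lemma linear_power_Suc: "[:1, s:] ^ Suc n = [:1, s:] ^ n + smult s (pCons 0 ([:1, s:] ^ n))"
  for s :: "'a::comm_semiring_1"
  by simp

text \<open>
  For \<open>x = (s - 1) / s\<^sup>2\<close> the powers of \<open>1 + s z\<close> multiply by
  the recursion for merging two chains: the last level comes from the first chain, from the
  second, or, with weight \<open>s - 2\<close>, from both.
\<close>

lemma merge_product_power_Suc:
  fixes s x :: real
  assumes "s \<noteq> 0" "x = (s - 1) / s^2"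
  shows "merge_product x ([:1, s:] ^ Suc p) ([:1, s:] ^ Suc q) =
    [:1, s:] * (merge_product x ([:1, s:] ^ p) ([:1, s:] ^ Suc q) + merge_product x ([:1, s:] ^ Suc p) ([:1, s:] ^ q)
      + smult (s - 2) (merge_product x ([:1, s:] ^ p) ([:1, s:] ^ q)))"
proof -
  define f where "f = [:1, s:] ^ p"
  define g where "g = [:1, s:] ^ q"
  have x: "s * (s * (x * y)) = s * y - y" for y
  proof -
    have "s * (s * (x * y)) = (s * (s * x)) * y" by (simp only: ac_simps)
    also have "s * (s * x) = s - 1" using assms by (simp add: power2_eq_square)
    finally show ?thesis by (simp add: algebra_simps)
  qed
  have "[:1, s:] * (merge_product x f g + smult s (merge_product x f (pCons 0 g)) + (merge_product x f g + smult s (merge_product x (pCons 0 f) g))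
      + smult (s - 2) (merge_product x f g)) = merge_product x f g + smult s (merge_product x f (pCons 0 g)) + smult s (merge_product x (pCons 0 f) g)
      + smult (s * s) (pCons 0 (merge_product x f (pCons 0 g) + merge_product x (pCons 0 f) g) + [:x, 1:] * merge_product x f g)"
    by (rule poly_ext) (simp add: algebra_simps x)
  moreover have "merge_product x ([:1, s:] ^ Suc p) ([:1, s:] ^ Suc q) =
      merge_product x f g + smult s (merge_product x f (pCons 0 g)) + smult s (merge_product x (pCons 0 f) g)
      + smult (s * s) (pCons 0 (merge_product x f (pCons 0 g) + merge_product x (pCons 0 f) g) + [:x, 1:] * merge_product x f g)"
    unfolding linear_power_Suc f_def[symmetric] g_def[symmetric] bilin_add_left bilin_add_right
      bilin_smult_left bilin_smult_right merge_product_step smult_smult[symmetric]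
    by (simp only: smult_add_right add.assoc)
  moreover have "merge_product x ([:1, s:] ^ p) ([:1, s:] ^ Suc q) = merge_product x f g + smult s (merge_product x f (pCons 0 g))"
    and "merge_product x ([:1, s:] ^ Suc p) ([:1, s:] ^ q) = merge_product x f g + smult s (merge_product x (pCons 0 f) g)"
    unfolding linear_power_Suc f_def[symmetric] g_def[symmetric] bilin_add_left bilin_add_right
      bilin_smult_left bilin_smult_right by (rule refl)+
  ultimately show ?thesis by (simp only: f_def g_def)
qed

section \<open>Merging two chains\<close>

text \<open>
  A merging of two chains of lengths \<open>p\<close> and \<open>q\<close> is encoded by the
  sets of levels that the two chains occupy. Together they fill an initial segment, and the
  common levels are those where elements of both chains are identified.
\<close>

definition merges :: "nat \<Rightarrow> nat \<Rightarrow> (nat set \<times> nat set) set" where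
  "merges p q = {(S, T). finite S \<and> finite T \<and> card S = p \<and> card T = q \<and> (\<exists>r. S \<union> T = {..<r})}"

lemma mergesE:
  assumes "(S, T) \<in> merges p q"
  obtains r where "finite S" "finite T" "card S = p" "card T = q" "S \<union> T = {..<r}" "card (S \<union> T) = r"
    "r \<notin> S" "r \<notin> T" "r \<le> p + q"
proof -
  obtain r where *: "finite S" "finite T" "card S = p" "card T = q" and U: "S \<union> T = {..<r}"
    using assms by (auto simp: merges_def)
  have "card (S \<union> T) = r" by (simp add: U)
  moreover have "r \<notin> S \<union> T" by (simp add: U)
  moreover have "card (S \<union> T) \<le> p + q" using * card_Un_le[of S T] by simp
  ultimately show thesis using that[of r] * U by auto
qed

lemma merges_card_le: "(S, T) \<in> merges p q \<Longrightarrow> card (S \<union> T) \<le> p + q"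
  by (auto elim: mergesE)

lemma merges_finite: "finite (merges p q)"
proof (rule finite_subset)
  show "merges p q \<subseteq> Pow {..<p + q} \<times> Pow {..<p + q}"
  proof clarify
    fix S T assume "(S, T) \<in> merges p q"
    then obtain r where "S \<union> T = {..<r}" "r \<le> p + q" by (rule mergesE)
    then have "S \<union> T \<subseteq> {..<p + q}" by auto
    then show "S \<in> Pow {..<p + q} \<and> T \<in> Pow {..<p + q}" by blast
  qed
qed auto

lemma merges_0_left: "merges 0 q = {({}, {..<q})}"
proof -
  have "(S, T) = ({}, {..<q})" if m: "(S, T) \<in> merges 0 q" for S T
  proof -
    obtain r where "finite S" "card S = 0" "card T = q" "S \<union> T = {..<r}" by (rule mergesE[OF m])
    then have "S = {}" "T = {..<r}" "card T = q" by simp_all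
    then show ?thesis by (metis card_lessThan)
  qed
  moreover have "({}, {..<q}) \<in> merges 0 q" by (simp add: merges_def)
  ultimately show ?thesis by (intro set_eqI) (metis insert_iff empty_iff surj_pair)
qed

lemma merges_0_right: "merges p 0 = {({..<p}, {})}"
proof -
  have "(S, T) = ({..<p}, {})" if m: "(S, T) \<in> merges p 0" for S T
  proof -
    obtain r where "finite T" "card T = 0" "card S = p" "S \<union> T = {..<r}" by (rule mergesE[OF m])
    then have "T = {}" "S = {..<r}" "card S = p" by simp_all
    then show ?thesis by (metis card_lessThan)
  qed
  moreover have "({..<p}, {}) \<in> merges p 0" by (simp add: merges_def)
  ultimately show ?thesis by (intro set_eqI) (metis insert_iff empty_iff surj_pair)
qed

text \<open>
  Classify a merging by which of the two chains occupy its last level.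
\<close>

lemma merges_Suc_sum:
  fixes w :: "nat \<Rightarrow> 'a::comm_monoid_add"
  shows "(\<Sum>(S, T)\<in>merges (Suc p) (Suc q). w (card (S \<union> T))) =
    (\<Sum>(S, T)\<in>merges p (Suc q). w (Suc (card (S \<union> T)))) +
    (\<Sum>(S, T)\<in>merges (Suc p) q. w (Suc (card (S \<union> T)))) +
    (\<Sum>(S, T)\<in>merges p q. w (Suc (card (S \<union> T))))"
proof -
  define r :: "nat set \<times> nat set \<Rightarrow> nat" where "r = (\<lambda>(S, T). card (S \<union> T))"
  define f1 where "f1 = (\<lambda>(S, T). (insert (card (S \<union> T)) S, T :: nat set))"
  define f2 where "f2 = (\<lambda>(S, T). (S :: nat set, insert (card (S \<union> T)) T))"
  define f3 where "f3 = (\<lambda>(S, T). (insert (card (S \<union> T)) S, insert (card (S \<union> T)) T))"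
  have r1: "f1 a \<in> merges (Suc p) (Suc q) \<and> r (f1 a) = Suc (r a) \<and> r a \<in> fst (f1 a) \<and> r a \<notin> snd (f1 a)
      \<and> a = (fst (f1 a) - {r (f1 a) - 1}, snd (f1 a))"
    if a_in: "a \<in> merges p (Suc q)" for a
  proof -
    obtain S T where a: "a = (S, T)" by force
    obtain r0 where c: "card S = p" "card T = Suc q" and m: "finite S" "finite T" "S \<union> T = {..<r0}" "card (S \<union> T) = r0" "r0 \<notin> S" "r0 \<notin> T"
      using a_in unfolding a by (rule mergesE)
    have "insert (r0) S \<union> T = insert r0 (S \<union> T)" by blast
    then have U: "insert (r0) S \<union> T = {..<Suc r0}" unfolding m(3) lessThan_Suc .
    then have "card (insert (r0) S \<union> T) = Suc r0" by (metis card_lessThan)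
    moreover have "\<exists>r. insert (r0) S \<union> T = {..<r}" using U by blast
    ultimately show ?thesis using m(1,2,4-6) c by (simp add: a f1_def r_def merges_def)
  qed
  have r2: "f2 a \<in> merges (Suc p) (Suc q) \<and> r (f2 a) = Suc (r a) \<and> r a \<notin> fst (f2 a) \<and> r a \<in> snd (f2 a)
      \<and> a = (fst (f2 a), snd (f2 a) - {r (f2 a) - 1})"
    if a_in: "a \<in> merges (Suc p) q" for a
  proof -
    obtain S T where a: "a = (S, T)" by force
    obtain r0 where c: "card S = Suc p" "card T = q" and m: "finite S" "finite T" "S \<union> T = {..<r0}" "card (S \<union> T) = r0" "r0 \<notin> S" "r0 \<notin> T"
      using a_in unfolding a by (rule mergesE)
    have "S \<union> insert (r0) T = insert r0 (S \<union> T)" by blast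
    then have U: "S \<union> insert (r0) T = {..<Suc r0}" unfolding m(3) lessThan_Suc .
    then have "card (S \<union> insert (r0) T) = Suc r0" by (metis card_lessThan)
    moreover have "\<exists>r. S \<union> insert (r0) T = {..<r}" using U by blast
    ultimately show ?thesis using m(1,2,4-6) c by (simp add: a f2_def r_def merges_def)
  qed
  have r3: "f3 a \<in> merges (Suc p) (Suc q) \<and> r (f3 a) = Suc (r a) \<and> r a \<in> fst (f3 a) \<and> r a \<in> snd (f3 a)
      \<and> a = (fst (f3 a) - {r (f3 a) - 1}, snd (f3 a) - {r (f3 a) - 1})"
    if a_in: "a \<in> merges p q" for a
  proof -
    obtain S T where a: "a = (S, T)" by force
    obtain r0 where c: "card S = p" "card T = q" and m: "finite S" "finite T" "S \<union> T = {..<r0}" "card (S \<union> T) = r0" "r0 \<notin> S" "r0 \<notin> T"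
      using a_in unfolding a by (rule mergesE)
    have "insert (r0) S \<union> insert (r0) T = insert r0 (S \<union> T)" by blast
    then have U: "insert (r0) S \<union> insert (r0) T = {..<Suc r0}" unfolding m(3) lessThan_Suc .
    then have "card (insert (r0) S \<union> insert (r0) T) = Suc r0" by (metis card_lessThan)
    moreover have "\<exists>r. insert (r0) S \<union> insert (r0) T = {..<r}" using U by blast
    ultimately show ?thesis using m(1,2,4-6) c by (simp add: a f3_def r_def merges_def)
  qed
  have inj1: "inj_on f1 (merges p (Suc q))" by (metis inj_onI r1)
  have inj2: "inj_on f2 (merges (Suc p) q)" by (metis inj_onI r2)
  have inj3: "inj_on f3 (merges p q)" by (metis inj_onI r3)
  let ?A = "f1 ` merges p (Suc q)" and ?B = "f2 ` merges (Suc p) q" and ?C = "f3 ` merges p q"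
  have "\<forall>e\<in>?A. r e - 1 \<in> fst e \<and> r e - 1 \<notin> snd e" "\<forall>e\<in>?B. r e - 1 \<notin> fst e \<and> r e - 1 \<in> snd e"
    "\<forall>e\<in>?C. r e - 1 \<in> fst e \<and> r e - 1 \<in> snd e"
    using r1 r2 r3 by simp_all
  then have AB: "?A \<inter> ?B = {}" and ABC: "(?A \<union> ?B) \<inter> ?C = {}" by blast+
  have cover: "merges (Suc p) (Suc q) \<subseteq> ?A \<union> ?B \<union> ?C"
  proof clarify
    fix S T assume ST: "(S, T) \<in> merges (Suc p) (Suc q)" and nB: "(S, T) \<notin> ?B" and nC: "(S, T) \<notin> ?C"
    obtain r0 where m: "finite S" "finite T" "card S = Suc p" "card T = Suc q" "S \<union> T = {..<r0}"
      using ST by (rule mergesE)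
    have "S \<noteq> {}" using m(3) by auto
    then have "r0 \<noteq> 0" using m(5) by (metis lessThan_0 sup_eq_bot_iff)
    then obtain k where k: "r0 = Suc k" by (cases r0) auto
    define S' where "S' = S - {k}"
    define T' where "T' = T - {k}"
    have kU: "k \<in> S \<union> T" unfolding m(5) k by simp
    have "S' \<union> T' = S \<union> T - {k}" by (auto simp: S'_def T'_def)
    then have U: "S' \<union> T' = {..<k}" unfolding m(5) k by (simp add: lessThan_Suc)
    then have U': "\<exists>r. S' \<union> T' = {..<r}" by blast
    have c: "card (S' \<union> T') = k" using U by (metis card_lessThan)
    have fin: "finite S'" "finite T'" using m by (auto simp: S'_def T'_def)
    show "(S, T) \<in> ?A"
    proof (cases "k \<in> S")
      case True
      then have cS: "card S' = p" "insert k S' = S" using m(1,3) by (auto simp: S'_def)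
      show ?thesis
      proof (cases "k \<in> T")
        case True
        then have "card T' = q" "insert k T' = T" using m(2,4) by (auto simp: T'_def)
        then have "(S', T') \<in> merges p q" "f3 (S', T') = (S, T)"
          using cS c U' fin by (simp_all add: merges_def f3_def)
        then show ?thesis using nC by (metis imageI)
      next
        case False
        then have "T' = T" by (auto simp: T'_def)
        then have "(S', T) \<in> merges p (Suc q)" "f1 (S', T) = (S, T)"
          using cS c U' fin m(4) by (simp_all add: merges_def f1_def)
        then show ?thesis by (metis imageI)
      qed
    next
      case False
      then have "k \<in> T" "S' = S" using kU by (auto simp: S'_def)
      then have "card T' = q" "insert k T' = T" using m(2,4) by (auto simp: T'_def)
      then have "(S, T') \<in> merges (Suc p) q" "f2 (S, T') = (S, T)"
        using c U' fin m(3) \<open>S' = S\<close> by (simp_all add: merges_def f2_def)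
      then show ?thesis using nB by (metis imageI)
    qed
  qed
  have eq: "merges (Suc p) (Suc q) = ?A \<union> ?B \<union> ?C"
    using cover r1 r2 r3 by blast
  have "(\<Sum>a\<in>merges (Suc p) (Suc q). w (r a)) =
      (\<Sum>a\<in>?A. w (r a)) + (\<Sum>a\<in>?B. w (r a)) + (\<Sum>a\<in>?C. w (r a))"
    unfolding eq using AB ABC by (simp add: sum.union_disjoint merges_finite)
  also have "\<dots> = (\<Sum>a\<in>merges p (Suc q). w (Suc (r a))) + (\<Sum>a\<in>merges (Suc p) q. w (Suc (r a)))
      + (\<Sum>a\<in>merges p q. w (Suc (r a)))"
    using r1 r2 r3 by (simp add: sum.reindex inj1 inj2 inj3)
  finally show ?thesis by (simp add: r_def case_prod_unfold)
qed

text \<open>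
  Each identification of levels costs \<open>s - 2\<close>, the weight of one dimension of a
  face. The sum over all mergings then is the product of the powers that belong to the two
  chains.
\<close>

lemma sum_merges:
  fixes x s :: real
  assumes "s \<noteq> 0" "x = (s - 1) / s^2"
  shows "(\<Sum>(S, T)\<in>merges p q. smult ((s - 2) ^ (p + q - card (S \<union> T))) ([:1, s:] ^ card (S \<union> T))) =
    merge_product x ([:1, s:] ^ p) ([:1, s:] ^ q)"
  using assms(2)
proof (induction x p q rule: lattice_poly.induct)
  case (1 x k)
  then show ?case by (simp add: merges_0_left merge_product_1_left)
next
  case (2 x i)
  then show ?case by (simp add: merges_0_right merge_product_1_right del: power_Suc)
next
  case (3 x p q)
  let ?P = "[:1, s:]"
  have fac: "(\<Sum>(S, T)\<in>merges a b. smult ((s - 2) ^ (Suc p + Suc q - Suc (card (S \<union> T)))) (?P ^ Suc (card (S \<union> T))))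
      = ?P * smult ((s - 2) ^ e) (\<Sum>(S, T)\<in>merges a b. smult ((s - 2) ^ (a + b - card (S \<union> T))) (?P ^ card (S \<union> T)))"
    if "a + b + e = Suc (p + q)" for a b e
    unfolding smult_sum_distrib sum_distrib_left
  proof (rule sum.cong[OF refl], clarify)
    fix S T assume "(S, T) \<in> merges a b"
    note m = merges_card_le[OF this]
    have "Suc p + Suc q - Suc (card (S \<union> T)) = e + (a + b - card (S \<union> T))" using that m by simp
    then show "smult ((s - 2) ^ (Suc p + Suc q - Suc (card (S \<union> T)))) (?P ^ Suc (card (S \<union> T))) =
      ?P * smult ((s - 2) ^ e) (smult ((s - 2) ^ (a + b - card (S \<union> T))) (?P ^ card (S \<union> T)))"
      by (simp only: power_Suc power_add smult_smult mult_smult_right)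
  qed
  have f0: "p + Suc q + 0 = Suc (p + q)" "Suc p + q + 0 = Suc (p + q)" "p + q + 1 = Suc (p + q)" by auto
  show ?case
    unfolding merges_Suc_sum[where w = "\<lambda>r. smult ((s - 2) ^ (Suc p + Suc q - r)) (?P ^ r)"]
    unfolding fac[of p "Suc q" 0, OF f0(1)] fac[of "Suc p" q 0, OF f0(2)] fac[of p q 1, OF f0(3)]
    unfolding merge_product_power_Suc[OF assms(1) 3(4)]
    using 3 by (simp only: power_0 power_one_right smult_1_left distrib_left)
qed

text \<open>
  The right-hand side counts the positions of a new element in a chain with \<open>n +
  1\<close> elements, recording how many elements stay above it; the second sum, with weight
  \<open>s - 2\<close>, is for the positions level with an element of the chain.
\<close>

lemma attach_root_power:
  fixes x s :: real
  assumes "s \<noteq> 0" "x = (s - 1) / s^2"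
  shows "smult s (attach_root x ([:1, s:] ^ n)) = (\<Sum>i\<le>Suc n. [:1, s:] ^ i) + smult (s - 2) (\<Sum>i\<le>n. [:1, s:] ^ i)"
proof (induction n)
  case 0
  show ?case by (simp add: attach_root_1) (simp add: monom_altdef one_pCons)
next
  case (Suc n)
  have x: "s * (s * (x * y)) = s * y - y" for y
  proof -
    have "s * (s * (x * y)) = (s * (s * x)) * y" by (simp only: ac_simps)
    also have "s * (s * x) = s - 1" using assms by (simp add: power2_eq_square)
    finally show ?thesis by (simp add: algebra_simps)
  qed
  let ?f = "[:1, s:] ^ n"
  have "smult s (attach_root x ([:1, s:] ^ Suc n)) = smult s (attach_root x ?f) + smult (s * s) (pCons 0 (pCons 0 ?f) + pCons 0 ?f + smult x ?f)"
    unfolding linear_power_Suc attach_root_add attach_root_smult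
    by (simp only: attach_root_def[of x "pCons 0 ?f"] poly_shift_pCons0 smult_add_right smult_smult mult.assoc)
  also have "smult (s * s) (pCons 0 (pCons 0 ?f) + pCons 0 ?f + smult x ?f) =
      [:1, s:] ^ Suc (Suc n) + smult (s - 2) ([:1, s:] ^ Suc n)"
    by (rule poly_ext) (simp add: algebra_simps x)
  finally show ?case by (simp add: Suc.IH smult_add_right del: power_Suc)
qed

section \<open>Evaluating coefficients\<close>

lemma map_poly_hom_add:
  assumes "\<phi> 0 = 0" "\<And>a b. \<phi> (a + b) = \<phi> a + \<phi> b"
  shows "map_poly \<phi> (f + g) = map_poly \<phi> f + map_poly \<phi> g"
  by (rule poly_eqI) (simp add: coeff_map_poly assms)

lemma map_poly_hom_sum:
  assumes "\<phi> 0 = 0" "\<And>a b. \<phi> (a + b) = \<phi> a + \<phi> b"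
  shows "map_poly \<phi> (sum f A) = (\<Sum>i\<in>A. map_poly \<phi> (f i))"
  by (induction A rule: infinite_finite_induct) (auto simp: map_poly_hom_add[of \<phi>, OF assms])

lemma map_poly_hom_smult:
  assumes "\<phi> 0 = 0" "\<And>a b. \<phi> (a * b) = \<phi> a * \<phi> b"
  shows "map_poly \<phi> (smult a f) = smult (\<phi> a) (map_poly \<phi> f)"
  by (rule poly_eqI) (simp add: coeff_map_poly assms)

lemma map_poly_hom_mult:
  assumes "\<phi> 0 = 0" "\<And>a b. \<phi> (a + b) = \<phi> a + \<phi> b" "\<And>a b. \<phi> (a * b) = \<phi> a * \<phi> b"
  shows "map_poly \<phi> (f * g) = map_poly \<phi> f * map_poly \<phi> g"
proof (rule poly_eqI)
  fix n
  have "\<phi> (\<Sum>i\<in>A. u i) = (\<Sum>i\<in>A. \<phi> (u i))" for u and A :: "nat set"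
    by (induction A rule: infinite_finite_induct) (auto simp: assms)
  then show "coeff (map_poly \<phi> (f * g)) n = coeff (map_poly \<phi> f * map_poly \<phi> g) n"
    by (simp add: coeff_map_poly assms coeff_mult)
qed

lemma map_poly_merge_product:
  assumes h: "\<phi> 0 = 0" "\<phi> 1 = 1" "\<And>a b. \<phi> (a + b) = \<phi> a + \<phi> b" "\<And>a b. \<phi> (a * b) = \<phi> a * \<phi> b"
  shows "map_poly \<phi> (merge_product x f g) = merge_product (\<phi> x) (map_poly \<phi> f) (map_poly \<phi> g)"
proof -
  have L: "map_poly \<phi> (lattice_poly x i k) = lattice_poly (\<phi> x) i k" for i k
  proof (induction x i k rule: lattice_poly.induct)
    case (1 x k) show ?case by (simp add: map_poly_monom h)
  next
    case (2 x k) show ?case by (simp add: map_poly_monom h)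
  next
    case (3 x i k)
    then show ?case
      by (simp add: map_poly_hom_add[OF h(1,3)] map_poly_hom_smult[OF h(1,4)] map_poly_pCons h)
  qed
  have "merge_product (\<phi> x) (map_poly \<phi> f) (map_poly \<phi> g) = (\<Sum>i\<le>degree f. \<Sum>k\<le>degree g.
     smult (coeff (map_poly \<phi> f) i * coeff (map_poly \<phi> g) k) (lattice_poly (\<phi> x) i k))"
    by (rule bilin_bound) (auto intro!: degree_le simp: coeff_map_poly h coeff_eq_0)
  then show ?thesis
    by (simp add: bilin_def map_poly_hom_sum[OF h(1,3)] map_poly_hom_smult[OF h(1,4)] L coeff_map_poly h)
qed

lemma map_poly_attach_root:
  assumes h: "\<phi> 0 = 0" "\<And>a b. \<phi> (a + b) = \<phi> a + \<phi> b" "\<And>a b. \<phi> (a * b) = \<phi> a * \<phi> b"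
  shows "map_poly \<phi> (attach_root x f) = attach_root (\<phi> x) (map_poly \<phi> f)"
proof -
  have "map_poly \<phi> (poly_shift 1 f) = poly_shift 1 (map_poly \<phi> f)"
    by (rule poly_eqI) (simp add: coeff_map_poly h coeff_poly_shift)
  then show ?thesis
    by (simp only: attach_root_def map_poly_hom_add[OF h(1,2)] map_poly_hom_smult[OF h(1,3)] map_poly_pCons[where f = \<phi>, OF h(1)] h(1))
qed

definition eval_nat :: "real \<Rightarrow> nat poly \<Rightarrow> real" where
  "eval_nat x p = poly (map_poly real p) x"

lemma eval_nat_hom: "eval_nat x 0 = 0" "eval_nat x 1 = 1" "eval_nat x (a + b) = eval_nat x a + eval_nat x b"
  "eval_nat x (a * b) = eval_nat x a * eval_nat x b" "eval_nat x [:0, 1:] = x"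
  by (simp_all add: eval_nat_def map_poly_hom_add map_poly_hom_mult map_poly_pCons)

lemmas map_eval_nat_merge_product = map_poly_merge_product[of "eval_nat x" for x, OF eval_nat_hom(1-4)]
lemmas map_eval_nat_attach_root = map_poly_attach_root[of "eval_nat x" for x, OF eval_nat_hom(1,3,4)]

section \<open>Visibility relations of a building set\<close>

text \<open>
  The pair \<open>(u, v)\<close> means that \<open>u\<close> sees \<open>v\<close>. For a
  graph this says that \<open>v\<close> lies in the component of \<open>u\<close> when all
  vertices heavier than \<open>u\<close> are deleted.
\<close>

definition vis :: "'a set set \<Rightarrow> ('a \<Rightarrow> real) \<Rightarrow> ('a \<times> 'a) set" where
  "vis B w = {(u, v). \<exists>I\<in>B. u \<in> I \<and> v \<in> I \<and> (\<forall>x\<in>I. w x \<le> w u)}"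

definition Vis :: "'a set set \<Rightarrow> ('a \<times> 'a) set set" where
  "Vis B = range (vis B)"

definition tie_class :: "('a \<times> 'a) set \<Rightarrow> 'a \<Rightarrow> 'a set" where
  "tie_class R u = {v. (u, v) \<in> R \<and> (v, u) \<in> R}"

text \<open>
  The vertices that see \<open>c\<close> strictly from above. Their classes correspond to the
  proper tubes around \<open>c\<close> in the nested set of the face.
\<close>

definition dominators :: "('a \<times> 'a) set \<Rightarrow> 'a \<Rightarrow> 'a set" where
  "dominators R c = {u. (u, c) \<in> R \<and> (c, u) \<notin> R}"

definition depth :: "('a \<times> 'a) set \<Rightarrow> 'a \<Rightarrow> nat" where
  "depth R c = card (tie_class R ` dominators R c)"

definition face_dim :: "'a set \<Rightarrow> ('a \<times> 'a) set \<Rightarrow> nat" where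
  "face_dim U R = card U - card (tie_class R ` U)"

text \<open>
  The classes that do not see \<open>c\<close>. When two pieces are glued at \<open>c\<close>
  these stay untouched, so their numbers simply add.
\<close>

definition off_chain :: "'a set \<Rightarrow> ('a \<times> 'a) set \<Rightarrow> 'a \<Rightarrow> nat" where
  "off_chain U R c = card (tie_class R ` {u \<in> U. (u, c) \<notin> R})"

lemma card_image_cong_ker:
  assumes "\<And>x y. x \<in> A \<Longrightarrow> y \<in> A \<Longrightarrow> f x = f y \<longleftrightarrow> g x = g y"
  shows "card (f ` A) = card (g ` A)"
proof -
  have "bij_betw (\<lambda>y. g (SOME x. x \<in> A \<and> f x = y)) (f ` A) (g ` A)"
  proof -
    have s: "(SOME x'. x' \<in> A \<and> f x' = f x) \<in> A \<and> f (SOME x'. x' \<in> A \<and> f x' = f x) = f x" if "x \<in> A" for x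
      by (rule someI[of "\<lambda>x'. x' \<in> A \<and> f x' = f x" x]) (use that in auto)
    have gs: "g (SOME x'. x' \<in> A \<and> f x' = f x) = g x" if "x \<in> A" for x
      using s[OF that] assms that by blast
    show ?thesis
    proof (rule bij_betwI')
      fix a b assume "a \<in> f ` A" "b \<in> f ` A"
      then obtain x y where "a = f x" "b = f y" "x \<in> A" "y \<in> A" by auto
      then show "(g (SOME x. x \<in> A \<and> f x = a) = g (SOME x. x \<in> A \<and> f x = b)) = (a = b)"
        by (simp add: gs assms)
    next
      fix a assume "a \<in> f ` A" then show "g (SOME x. x \<in> A \<and> f x = a) \<in> g ` A" by (auto simp: gs)
    next
      fix b assume "b \<in> g ` A" then show "\<exists>a\<in>f ` A. b = g (SOME x. x \<in> A \<and> f x = a)" by (auto simp: gs)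
    qed
  qed
  then show ?thesis by (rule bij_betw_same_card)
qed

text \<open>
  Interpolate linearly above the largest old point.
\<close>

lemma strict_mono_real_extension:
  fixes X Y :: "real set"
  assumes "finite X" "finite Y" "card X = card Y"
  shows "\<exists>g :: real \<Rightarrow> real. strict_mono g \<and> g ` X = Y"
  using assms
proof (induction X arbitrary: Y rule: finite_linorder_max_induct)
  case empty
  then show ?case by (intro exI[of _ id]) (auto simp: strict_mono_def)
next
  case (insert M X)
  then have "Y \<noteq> {}" by auto
  define N where "N = Max Y"
  have N: "N \<in> Y" "\<And>y. y \<in> Y \<Longrightarrow> y \<le> N" using insert.prems \<open>Y \<noteq> {}\<close> by (auto simp: N_def)
  have nM: "M \<notin> X" using insert.hyps(2) by blast
  have "card X = card (Y - {N})" using insert N nM by simp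
  then obtain g where g: "strict_mono g" "g ` X = Y - {N}" using insert.IH[of "Y - {N}"] insert.prems by auto
  show ?case
  proof (cases "X = {}")
    case True
    then have "Y = {N}" using g N by auto
    then show ?thesis using True by (intro exI[of _ "\<lambda>y. y - M + N"]) (auto simp: strict_mono_def)
  next
    case False
    define a where "a = Max X"
    have a: "a \<in> X" "\<And>x. x \<in> X \<Longrightarrow> x \<le> a" using insert.hyps(1) False by (auto simp: a_def)
    have aM: "a < M" using a insert.hyps(2) by blast
    have "g a \<in> Y - {N}" using a g by blast
    then have gN: "g a < N" using N(2)[of "g a"] by auto
    define k where "k = (N - g a) / (M - a)"
    have k: "k > 0" "k * (M - a) = N - g a" using aM gN by (auto simp: k_def)
    define h where "h = (\<lambda>y. if y \<le> a then g y else g a + k * (y - a))"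
    have "strict_mono h"
    proof (rule strict_monoI)
      fix x y :: real assume xy: "x < y"
      show "h x < h y"
      proof (cases "y \<le> a")
        case True
        then show ?thesis using xy g(1) by (simp add: h_def strict_mono_less)
      next
        case y: False
        show ?thesis
        proof (cases "x \<le> a")
          case True
          then have "g x \<le> g a" using g(1) by (simp add: strict_mono_less_eq)
          moreover have "0 < k * (y - a)" using k(1) y by simp
          ultimately show ?thesis using True y by (simp add: h_def)
        next
          case False
          then show ?thesis using xy y k(1) by (simp add: h_def)
        qed
      qed
    qed
    moreover have "h ` X = Y - {N}" using g(2) a by (auto simp: h_def image_def)
    moreover have "h M = N" using aM k by (simp add: h_def)
    ultimately show ?thesis using N by (intro exI[of _ h]) auto
  qed
qed

locale building =
  fixes B :: "'a set set" and U :: "'a set"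
  assumes fin: "finite U"
    and sub: "I \<in> B \<Longrightarrow> I \<subseteq> U"
    and sing: "u \<in> U \<Longrightarrow> {u} \<in> B"
    and un: "I \<in> B \<Longrightarrow> J \<in> B \<Longrightarrow> I \<inter> J \<noteq> {} \<Longrightarrow> I \<union> J \<in> B"
    and ne: "{} \<notin> B"
begin

lemma visI: "I \<in> B \<Longrightarrow> u \<in> I \<Longrightarrow> v \<in> I \<Longrightarrow> (\<And>x. x \<in> I \<Longrightarrow> w x \<le> w u) \<Longrightarrow> (u, v) \<in> vis B w"
  by (auto simp: vis_def)

lemma visE:
  assumes "(u, v) \<in> vis B w"
  obtains I where "I \<in> B" "u \<in> I" "v \<in> I" "\<forall>x\<in>I. w x \<le> w u"
  using assms by (auto simp: vis_def)

lemma vis_dom: "(u, v) \<in> vis B w \<Longrightarrow> u \<in> U \<and> v \<in> U"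
  by (auto simp: vis_def dest: sub)

lemma vis_refl: "u \<in> U \<Longrightarrow> (u, u) \<in> vis B w"
  by (rule visI[of "{u}"]) (auto simp: sing)

lemma vis_le: "(u, v) \<in> vis B w \<Longrightarrow> w v \<le> w u"
  by (auto simp: vis_def)

lemma vis_trans:
  assumes "(u, v) \<in> vis B w" "(v, x) \<in> vis B w"
  shows "(u, x) \<in> vis B w"
proof -
  obtain I where I: "I \<in> B" "u \<in> I" "v \<in> I" "\<forall>x\<in>I. w x \<le> w u" using assms(1) by (rule visE)
  obtain J where J: "J \<in> B" "v \<in> J" "x \<in> J" "\<forall>x\<in>J. w x \<le> w v" using assms(2) by (rule visE)
  have "w v \<le> w u" using I by blast
  then show ?thesis using un[OF I(1) J(1)] I J by (intro visI[of "I \<union> J"]) (auto intro: order_trans)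
qed

text \<open>
  The two connected sets meet in \<open>c\<close>, so their union is connected. This is why
  the vertices that see \<open>c\<close> are linearly preordered.
\<close>

lemma vis_chain:
  assumes "(u, c) \<in> vis B w" "(u', c) \<in> vis B w" "w u' \<le> w u"
  shows "(u, u') \<in> vis B w"
proof -
  obtain I where I: "I \<in> B" "u \<in> I" "c \<in> I" "\<forall>x\<in>I. w x \<le> w u" using assms(1) by (rule visE)
  obtain J where J: "J \<in> B" "u' \<in> J" "c \<in> J" "\<forall>x\<in>J. w x \<le> w u'" using assms(2) by (rule visE)
  show ?thesis using un[OF I(1) J(1)] I J assms(3) by (intro visI[of "I \<union> J"]) (auto intro: order_trans)
qed

lemma vis_chain_iff:
  assumes "(u, c) \<in> vis B w" "(u', c) \<in> vis B w"
  shows "(u, u') \<in> vis B w \<longleftrightarrow> w u' \<le> w u"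
  using vis_chain[OF assms] vis_le by blast

lemma tie_class_eq_iff:
  assumes "u \<in> U" "u' \<in> U"
  shows "tie_class (vis B w) u = tie_class (vis B w) u' \<longleftrightarrow> (u, u') \<in> vis B w \<and> (u', u) \<in> vis B w"
proof
  assume "tie_class (vis B w) u = tie_class (vis B w) u'"
  moreover have "u' \<in> tie_class (vis B w) u'" using vis_refl[OF assms(2)] by (simp add: tie_class_def)
  ultimately have "u' \<in> tie_class (vis B w) u" by simp
  then show "(u, u') \<in> vis B w \<and> (u', u) \<in> vis B w" by (simp add: tie_class_def)
next
  assume "(u, u') \<in> vis B w \<and> (u', u) \<in> vis B w"
  then show "tie_class (vis B w) u = tie_class (vis B w) u'"
    unfolding tie_class_def by (blast intro: vis_trans)
qed

lemma tie_class_chain_eq_iff: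
  assumes "(u, c) \<in> vis B w" "(u', c) \<in> vis B w"
  shows "tie_class (vis B w) u = tie_class (vis B w) u' \<longleftrightarrow> w u = w u'"
  using tie_class_eq_iff[of u u' w] vis_dom[OF assms(1)] vis_dom[OF assms(2)] vis_chain_iff[OF assms] vis_chain_iff[OF assms(2,1)]
  by auto

lemma dominators_iff: "c \<in> U \<Longrightarrow> u \<in> dominators (vis B w) c \<longleftrightarrow> (u, c) \<in> vis B w \<and> w c < w u"
  unfolding dominators_def using vis_chain_iff[of c c w u] vis_refl[of c w] by (auto simp: not_le)

lemma finite_Vis: "finite (Vis B)"
proof (rule finite_subset)
  show "Vis B \<subseteq> Pow (U \<times> U)" using vis_dom by (auto simp: Vis_def)
qed (simp add: fin)

lemma dominators_subset: "dominators (vis B w) c \<subseteq> U" using vis_dom by (auto simp: dominators_def)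

lemma finite_dominators: "finite (dominators (vis B w) c)" using dominators_subset fin by (rule finite_subset)

lemma depth_eq: "depth (vis B w) c = card (w ` dominators (vis B w) c)"
  unfolding depth_def by (rule card_image_cong_ker, rule tie_class_chain_eq_iff[of _ c]) (simp_all add: dominators_def)

lemma classes_split:
  assumes "c \<in> U"
  shows "card (tie_class (vis B w) ` U) = off_chain U (vis B w) c + depth (vis B w) c + 1"
proof -
  let ?R = "vis B w"
  let ?N = "{u \<in> U. (u, c) \<notin> ?R}" and ?A = "dominators ?R c" and ?C = "{u \<in> U. (u, c) \<in> ?R \<and> (c, u) \<in> ?R}"
  have U: "U = ?N \<union> ?A \<union> ?C" using vis_dom by (auto simp: dominators_def)
  have "tie_class ?R u = tie_class ?R c" if "u \<in> ?C" for u using that assms by (subst tie_class_eq_iff) auto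
  moreover have "c \<in> ?C" using assms vis_refl[of c w] by simp
  ultimately have c: "tie_class ?R ` ?C = {tie_class ?R c}" by blast
  have d1: "tie_class ?R ` ?N \<inter> tie_class ?R ` ?A = {}"
  proof -
    have "tie_class ?R u \<noteq> tie_class ?R v" if "u \<in> ?N" "v \<in> ?A" for u v
      using that tie_class_eq_iff[of u v w] vis_trans[of u v w c] vis_dom by (auto simp: dominators_def)
    then show ?thesis by blast
  qed
  have d2: "(tie_class ?R ` ?N \<union> tie_class ?R ` ?A) \<inter> tie_class ?R ` ?C = {}"
  proof -
    have "tie_class ?R u \<noteq> tie_class ?R c" if "u \<in> ?N \<union> ?A" for u
      using that tie_class_eq_iff[of u c w] assms vis_dom by (auto simp: dominators_def)
    then show ?thesis unfolding c by blast
  qed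
  have "card (tie_class ?R ` U) = card (tie_class ?R ` ?N \<union> tie_class ?R ` ?A \<union> tie_class ?R ` ?C)"
    by (subst U) (simp add: image_Un)
  also have "\<dots> = card (tie_class ?R ` ?N) + card (tie_class ?R ` ?A) + card (tie_class ?R ` ?C)"
    using d1 d2 fin finite_dominators by (simp add: card_Un_disjoint)
  finally show ?thesis by (simp add: c off_chain_def depth_def)
qed

lemma face_dim_eq:
  assumes "c \<in> U"
  shows "face_dim U (vis B w) + off_chain U (vis B w) c + depth (vis B w) c + 1 = card U"
proof -
  have "card (tie_class (vis B w) ` U) \<le> card U" by (rule card_image_le[OF fin])
  then show ?thesis using classes_split[OF assms, of w] by (simp add: face_dim_def)
qed

lemma vis_strict_mono: "strict_mono g \<Longrightarrow> vis B (g \<circ> w) = vis B w"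
  by (simp add: vis_def strict_mono_less_eq)

text \<open>
  A strictly monotone change of the weights does not alter the visibility relation, so the
  weights of the chain above \<open>c\<close> can be prescribed: \<open>c\<close> gets weight
  0 and the classes above it get any given positive weights.
\<close>

lemma normalising_map:
  assumes "c \<in> U" "finite S" "\<And>s. s \<in> S \<Longrightarrow> (0::real) < s" "card S = depth (vis B w) c"
  obtains g :: "real \<Rightarrow> real" where "strict_mono g" "g (w c) = 0" "(g \<circ> w) ` dominators (vis B w) c = S"
proof -
  let ?X = "w ` dominators (vis B w) c"
  have X: "finite ?X" "card ?X = card S" using finite_dominators assms(4) by (simp_all add: depth_eq)
  have gt: "w c < x" if "x \<in> ?X" for x using that assms(1) by (auto simp: dominators_iff)
  have "w c \<notin> ?X" "0 \<notin> S" using gt assms(3) by auto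
  then have "card (insert (w c) ?X) = card (insert 0 S)" using X assms(2) by simp
  then obtain g :: "real \<Rightarrow> real" where g: "strict_mono g" "g ` insert (w c) ?X = insert 0 S"
    using strict_mono_real_extension[of "insert (w c) ?X" "insert 0 S"] X assms(2) by auto
  have g0: "g (w c) = 0"
  proof (rule ccontr)
    assume "g (w c) \<noteq> 0"
    then have pos: "0 < g (w c)" using g(2) assms(3) by auto
    obtain x where "x \<in> insert (w c) ?X" "g x = 0" using g(2) by (metis imageE insertI1)
    moreover have "g (w c) \<le> g x" if "x \<in> insert (w c) ?X" for x
      using that gt[of x] g(1) by (auto simp: strict_mono_less_eq less_imp_le)
    ultimately show False using pos by fastforce
  qed
  have "0 \<notin> g ` ?X"
  proof
    assume "0 \<in> g ` ?X"
    then obtain x where "x \<in> ?X" "g x = g (w c)" using g0 by force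
    then show False using gt[of x] g(1) by (simp add: strict_mono_eq)
  qed
  then have "g ` ?X = S" using g(2) g0 \<open>0 \<notin> S\<close> insert_ident[of 0 "g ` ?X" S] by simp
  then show thesis using that[of g] g0 g(1) by (simp add: image_comp)
qed

lemma vis_normal_form:
  assumes "c \<in> U" "R \<in> Vis B" "finite S" "\<And>s. s \<in> S \<Longrightarrow> (0::real) < s" "card S = depth R c"
  obtains w where "vis B w = R" "w c = 0" "w ` dominators R c = S"
proof -
  obtain w0 where R: "R = vis B w0" using assms(2) by (auto simp: Vis_def)
  obtain g where "strict_mono g" "g (w0 c) = 0" "(g \<circ> w0) ` dominators (vis B w0) c = S"
    using normalising_map[of c S w0] assms unfolding R by blast
  then show thesis using that[of "g \<circ> w0"] by (simp add: R vis_strict_mono)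
qed

lemma vis_cong: "(\<And>u. u \<in> U \<Longrightarrow> w u = w' u) \<Longrightarrow> vis B w = vis B w'"
  unfolding vis_def using sub by (auto simp: subset_iff)

text \<open>
  The rank of a vertex in the chain above \<open>c\<close> can be read off from the relation.
  So the relation together with the set of weights used by the chain determines all weights in
  the chain.
\<close>

lemma level_unique:
  assumes "c \<in> U" "vis B w = vis B w'" "w ` dominators (vis B w) c = w' ` dominators (vis B w) c" "w c = w' c"
    and "(u, c) \<in> vis B w"
  shows "w u = w' u"
proof (cases "u \<in> dominators (vis B w) c")
  case False
  then have "(c, u) \<in> vis B w" using assms(5) by (auto simp: dominators_def)
  then have "w u = w c" "w' u = w' c"
    using assms(5) vis_le[of u c w] vis_le[of c u w] vis_le[of u c w'] vis_le[of c u w'] unfolding assms(2) by auto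
  then show ?thesis using assms(4) by simp
next
  case True
  let ?A = "dominators (vis B w) c" and ?Y = "w ` dominators (vis B w) c"
  let ?L = "{v \<in> ?A. (v, u) \<notin> vis B w}"
  have lt: "(v, u) \<notin> vis B w \<longleftrightarrow> w v < w u" "(v, u) \<notin> vis B w \<longleftrightarrow> w' v < w' u" if "v \<in> ?A" for v
  proof -
    have vc: "(v, c) \<in> vis B w" using that by (simp add: dominators_def)
    show "(v, u) \<notin> vis B w \<longleftrightarrow> w v < w u" using vis_chain_iff[OF vc assms(5)] by (simp add: not_le)
    show "(v, u) \<notin> vis B w \<longleftrightarrow> w' v < w' u"
      using vis_chain_iff[of v c w' u] vc assms(5) unfolding assms(2) by (simp add: not_le)
  qed
  have L1: "w ` ?L = {y \<in> ?Y. y < w u}"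
    using lt(1) by blast
  have L2: "w' ` ?L = {y \<in> ?Y. y < w' u}"
    using lt(2) unfolding assms(3) by blast
  have "w x = w y \<longleftrightarrow> w' x = w' y" if "x \<in> ?L" "y \<in> ?L" for x y
  proof -
    have xy: "(x, c) \<in> vis B w" "(y, c) \<in> vis B w" using that by (auto simp: dominators_def)
    show ?thesis using tie_class_chain_eq_iff[OF xy] tie_class_chain_eq_iff[OF xy[unfolded assms(2)]] by (metis assms(2))
  qed
  then have "card (w ` ?L) = card (w' ` ?L)" by (rule card_image_cong_ker)
  then have eq: "card {y \<in> ?Y. y < w u} = card {y \<in> ?Y. y < w' u}" unfolding L1 L2 .
  have fY: "finite ?Y" using finite_dominators by simp
  have mono: "card {y \<in> ?Y. y < a} < card {y \<in> ?Y. y < b}" if "a < b" "a \<in> ?Y" for a b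
    by (rule psubset_card_mono) (use that fY in auto)
  have Y: "w u \<in> ?Y" "w' u \<in> ?Y" using True assms(3) by auto
  show ?thesis
    using eq mono[OF _ Y(1), of "w' u"] mono[OF _ Y(2), of "w u"] by (cases "w u" "w' u" rule: linorder_cases) simp_all
qed

end

definition depth_poly :: "'a set \<Rightarrow> 'a set set \<Rightarrow> 'a \<Rightarrow> real \<Rightarrow> real poly" where
  "depth_poly U B c s = (\<Sum>R\<in>Vis B. smult ((s - 2) ^ face_dim U R) ([:1, s:] ^ depth R c))"

text \<open>
  The depth-refined face polynomial, divided by the appropriate power of \<open>s\<close>, is
  a polynomial in \<open>x = (s - 1) / s\<^sup>2\<close> and \<open>z\<close>. In
  \<open>\<alpha>\<close> the outer variable is \<open>z\<close> and the inner one is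
  \<open>x\<close>.
\<close>

definition gamma_spec :: "'a set \<Rightarrow> 'a set set \<Rightarrow> 'a \<Rightarrow> nat poly poly \<Rightarrow> bool" where
  "gamma_spec U B c \<alpha> \<longleftrightarrow>
     (\<forall>s>1. depth_poly U B c s = smult (s ^ (card U - 1)) (map_poly (eval_nat ((s - 1) / s\<^sup>2)) \<alpha>))"

lemma gamma_spec_point: "gamma_spec {c} {{c}} c 1"
proof -
  have v: "vis {{c}} w = {(c, c)}" for w :: "'a \<Rightarrow> real" by (auto simp: vis_def)
  have "Vis {{c}} = {{(c, c)}}" by (simp add: Vis_def v)
  then show ?thesis
    by (auto simp: gamma_spec_def depth_poly_def face_dim_def depth_def dominators_def tie_class_def eval_nat_hom)
qed

lemma gamma_spec_relabel:
  assumes "building B U" "inj_on f U" "c \<in> U" "gamma_spec U B c \<alpha>"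
  shows "gamma_spec (f ` U) ((`) f ` B) (f c) \<alpha>"
proof -
  interpret building B U by fact
  let ?g = "map_prod f f"
  have R: "vis ((`) f ` B) w = ?g ` vis B (w \<circ> f)" for w
    by (auto simp: vis_def image_iff)
  have "Vis ((`) f ` B) = (`) ?g ` Vis B"
  proof -
    have "\<exists>w'. vis B w = vis B (w' \<circ> f)" for w
    proof -
      have "w u = (w \<circ> the_inv_into U f \<circ> f) u" if "u \<in> U" for u
        using assms(2) that by (simp add: the_inv_into_f_f)
      then have "vis B w = vis B (w \<circ> the_inv_into U f \<circ> f)"
        unfolding vis_def using sub by (auto simp: subset_iff)
      then show ?thesis by blast
    qed
    then show ?thesis by (auto simp: Vis_def R image_iff) metis+
  qed
  moreover have inj: "inj_on ((`) ?g) (Vis B)"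
  proof -
    have "inj_on ?g (U \<times> U)" using assms(2) by (simp add: map_prod_inj_on)
    moreover have "Vis B \<subseteq> Pow (U \<times> U)" using vis_dom by (auto simp: Vis_def)
    ultimately show ?thesis by (meson inj_on_image_Pow inj_on_subset)
  qed
  moreover have "face_dim (f ` U) (?g ` R) = face_dim U R \<and> depth (?g ` R) (f c) = depth R c" if R_in: "R \<in> Vis B" for R
  proof -
    obtain w where Rw: "R = vis B w" using R_in by (auto simp: Vis_def)
    have dom: "u \<in> U \<and> v \<in> U" if "(u, v) \<in> R" for u v using that vis_dom by (simp add: Rw)
    have mem: "(f u, f v) \<in> ?g ` R \<longleftrightarrow> (u, v) \<in> R" if "u \<in> U" "v \<in> U" for u v
    proof
      assume "(f u, f v) \<in> ?g ` R"
      then obtain a b where ab: "(a, b) \<in> R" "f u = f a" "f v = f b" by auto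
      then have "u = a" "v = b" using that assms(2) dom[OF ab(1)] by (auto dest: inj_onD)
      then show "(u, v) \<in> R" using ab by simp
    qed auto
    have im_dom: "x \<in> f ` U \<and> y \<in> f ` U" if "(x, y) \<in> ?g ` R" for x y
      using that dom by auto
    define R' where "R' = ?g ` R"
    have memR: "(f u, f v) \<in> R' \<longleftrightarrow> (u, v) \<in> R" if "u \<in> U" "v \<in> U" for u v
      using mem[OF that] by (simp add: R'_def)
    have domR: "(x, y) \<in> R' \<Longrightarrow> x \<in> f ` U \<and> y \<in> f ` U" for x y
      using im_dom by (simp add: R'_def)
    have class_image: "tie_class R' (f u) = f ` tie_class R u" if "u \<in> U" for u
    proof (intro set_eqI iffI)
      fix y assume "y \<in> tie_class R' (f u)"
      then have y: "(f u, y) \<in> R'" "(y, f u) \<in> R'" by (simp_all add: tie_class_def)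
      then obtain v where v: "v \<in> U" "y = f v" using domR[OF y(1)] by blast
      then have "v \<in> tie_class R u" using y memR that by (simp add: tie_class_def)
      then show "y \<in> f ` tie_class R u" using v by simp
    next
      fix y assume "y \<in> f ` tie_class R u"
      then obtain v where v: "y = f v" "(u, v) \<in> R" "(v, u) \<in> R" by (auto simp: tie_class_def)
      then show "y \<in> tie_class R' (f u)" using memR dom[OF v(2)] by (simp add: tie_class_def)
    qed
    have dom_image: "dominators R' (f c) = f ` dominators R c"
    proof (intro set_eqI iffI)
      fix y assume "y \<in> dominators R' (f c)"
      then have y: "(y, f c) \<in> R'" "(f c, y) \<notin> R'" by (simp_all add: dominators_def)
      then obtain v where v: "v \<in> U" "y = f v" using domR[OF y(1)] by blast
      then have "v \<in> dominators R c" using y memR assms(3) by (simp add: dominators_def)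
      then show "y \<in> f ` dominators R c" using v by simp
    next
      fix y assume "y \<in> f ` dominators R c"
      then obtain v where v: "y = f v" "(v, c) \<in> R" "(c, v) \<notin> R" by (auto simp: dominators_def)
      then show "y \<in> dominators R' (f c)" using memR dom[OF v(2)] by (simp add: dominators_def)
    qed
    have ancU: "dominators R c \<subseteq> U" using dom by (auto simp: dominators_def)
    have clU: "tie_class R u \<subseteq> U" for u using dom by (auto simp: tie_class_def)
    have injP: "inj_on ((`) f) (Pow U)" using assms(2) by (rule inj_on_image_Pow)
    have im: "card (tie_class R' ` f ` A) = card (tie_class R ` A)" if "A \<subseteq> U" for A
    proof -
      have "tie_class R' ` f ` A = (`) f ` tie_class R ` A"
        unfolding image_image by (rule image_cong) (use that class_image in auto)
      moreover have "inj_on ((`) f) (tie_class R ` A)" by (rule inj_on_subset[OF injP]) (use clU in auto)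
      ultimately show ?thesis by (simp add: card_image)
    qed
    show ?thesis using im[OF order_refl] im[OF ancU] dom_image assms(2)
      by (simp add: face_dim_def depth_def card_image flip: R'_def)
  qed
  ultimately have "depth_poly (f ` U) ((`) f ` B) (f c) s = depth_poly U B c s" for s
    by (simp add: depth_poly_def sum.reindex)
  then show ?thesis using assms(2,4) by (simp add: gamma_spec_def card_image)
qed

section \<open>Gluing two building sets at a vertex\<close>

text \<open>
  Levels are shifted by one so that they are positive; weight 0 is reserved for the root.
\<close>

definition levels :: "nat set \<Rightarrow> real set" where
  "levels S = (\<lambda>k. real (Suc k)) ` S"

lemma inj_level: "inj (\<lambda>k. real (Suc k))"
  by (rule injI) simp

lemma card_levels [simp]: "card (levels S) = card S"
  unfolding levels_def by (rule card_image) (rule inj_on_subset[OF inj_level], simp)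

lemma levels_Un: "levels S \<union> levels T = levels (S \<union> T)"
  by (simp add: levels_def image_Un)

lemma levels_inj: "levels S = levels T \<Longrightarrow> S = T"
  unfolding levels_def by (rule inj_image_eq_iff[OF inj_level, THEN iffD1])

lemma levels_pos: "s \<in> levels S \<Longrightarrow> 0 < s"
  by (auto simp: levels_def)

lemma levels_subset: "X \<subseteq> levels T \<Longrightarrow> \<exists>S\<subseteq>T. X = levels S"
  unfolding levels_def by (simp add: subset_image_iff)

context building
begin

text \<open>
  Normalised weights for the relation \<open>R\<close>: the root has weight 0 and the chain
  above it occupies the levels \<open>S\<close>.
\<close>

definition rep :: "'a \<Rightarrow> ('a \<times> 'a) set \<Rightarrow> nat set \<Rightarrow> 'a \<Rightarrow> real" where
  "rep c R S = (SOME w. vis B w = R \<and> w c = 0 \<and> w ` dominators R c = levels S)"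

lemma rep:
  assumes "c \<in> U" "R \<in> Vis B" "finite S" "card S = depth R c"
  shows "vis B (rep c R S) = R" "rep c R S c = 0" "rep c R S ` dominators R c = levels S"
proof -
  have "finite (levels S)" using assms(3) by (simp add: levels_def)
  then obtain w where "vis B w = R" "w c = 0" "w ` dominators R c = levels S"
    using vis_normal_form[of c R "levels S"] assms levels_pos by auto
  then have "\<exists>w. vis B w = R \<and> w c = 0 \<and> w ` dominators R c = levels S" by blast
  from someI_ex[OF this] show "vis B (rep c R S) = R" "rep c R S c = 0" "rep c R S ` dominators R c = levels S"
    unfolding rep_def by auto
qed

end

text \<open>
  The building set \<open>B\<close> arises from \<open>BA\<close> and \<open>BZ\<close> by
  gluing at \<open>c\<close>: a member that meets both sides contains \<open>c\<close> and
  restricts to members on both sides.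
\<close>

locale wedge = A: building BA UA + Z: building BZ UZ + G: building B "UA \<union> UZ"
  for BA :: "'a set set" and UA and BZ :: "'a set set" and UZ and B +
  fixes c :: 'a
  assumes inter: "UA \<inter> UZ = {c}"
    and subA: "BA \<subseteq> B" and subZ: "BZ \<subseteq> B"
    and restrA: "I \<in> B \<Longrightarrow> I \<inter> UA \<noteq> {} \<Longrightarrow> I \<inter> UA \<in> BA"
    and restrZ: "I \<in> B \<Longrightarrow> I \<inter> UZ \<noteq> {} \<Longrightarrow> I \<inter> UZ \<in> BZ"
    and cross: "I \<in> B \<Longrightarrow> I \<inter> UA \<noteq> {} \<Longrightarrow> I \<inter> UZ \<noteq> {} \<Longrightarrow> c \<in> I"
    and join: "I \<in> BA \<Longrightarrow> J \<in> BZ \<Longrightarrow> c \<in> I \<Longrightarrow> c \<in> J \<Longrightarrow> I \<union> J \<in> B"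
begin

lemma c_in: "c \<in> UA" "c \<in> UZ" using inter by auto

lemma swap: "wedge BZ UZ BA UA B c"
proof -
  interpret G': building B "UZ \<union> UA" using G.building_axioms by (simp add: Un_commute)
  show ?thesis
  proof unfold_locales
    fix I J assume "I \<in> BZ" "J \<in> BA" "c \<in> I" "c \<in> J"
    then show "I \<union> J \<in> B" using join[of J I] by (simp add: Un_commute)
  qed (use inter subA subZ restrA restrZ cross in auto)
qed

lemma vis_A:
  assumes "u \<in> UA" "v \<in> UA"
  shows "(u, v) \<in> vis B w \<longleftrightarrow> (u, v) \<in> vis BA w"
proof
  assume "(u, v) \<in> vis B w"
  then obtain I where I: "I \<in> B" "u \<in> I" "v \<in> I" "\<forall>x\<in>I. w x \<le> w u" by (rule G.visE)
  then show "(u, v) \<in> vis BA w" using assms restrA[OF I(1)] by (intro A.visI[of "I \<inter> UA"]) auto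
next
  assume "(u, v) \<in> vis BA w"
  then show "(u, v) \<in> vis B w" using subA by (auto simp: vis_def)
qed

text \<open>
  To see across the gluing vertex, \<open>u\<close> has to see \<open>c\<close> and to be at
  least as heavy as the heaviest vertex \<open>x\<close> of some connected set on the other
  side that contains \<open>c\<close> and \<open>v\<close>. Such an \<open>x\<close> belongs
  to the chain above \<open>c\<close>, so only the weights of that chain matter.
\<close>

lemma vis_cross:
  assumes "u \<in> UA" "v \<in> UZ"
  shows "(u, v) \<in> vis B w \<longleftrightarrow> (u, c) \<in> vis BA w \<and> (\<exists>x. (x, c) \<in> vis BZ w \<and> (x, v) \<in> vis BZ w \<and> w x \<le> w u)"
proof
  assume "(u, v) \<in> vis B w"
  then obtain I where I: "I \<in> B" "u \<in> I" "v \<in> I" "\<forall>x\<in>I. w x \<le> w u" by (rule G.visE)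
  have IA: "I \<inter> UA \<in> BA" and IZ: "I \<inter> UZ \<in> BZ" and cI: "c \<in> I"
    using I assms restrA[OF I(1)] restrZ[OF I(1)] cross[OF I(1)] by blast+
  have 1: "(u, c) \<in> vis BA w" using IA I assms cI c_in by (intro A.visI[of "I \<inter> UA"]) auto
  have fI: "finite (w ` (I \<inter> UZ))" "w ` (I \<inter> UZ) \<noteq> {}" using Z.fin cI c_in by auto
  then have "Max (w ` (I \<inter> UZ)) \<in> w ` (I \<inter> UZ)" by (rule Max_in)
  then obtain x where x: "x \<in> I" "x \<in> UZ" "w x = Max (w ` (I \<inter> UZ))" by auto
  have max: "w y \<le> w x" if "y \<in> I \<inter> UZ" for y using that fI x(3) by simp
  have "(x, c) \<in> vis BZ w" "(x, v) \<in> vis BZ w"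
    by (rule Z.visI[OF IZ]; use x I assms cI c_in max in auto)+
  then show "(u, c) \<in> vis BA w \<and> (\<exists>x. (x, c) \<in> vis BZ w \<and> (x, v) \<in> vis BZ w \<and> w x \<le> w u)"
    using 1 I x by blast
next
  assume "(u, c) \<in> vis BA w \<and> (\<exists>x. (x, c) \<in> vis BZ w \<and> (x, v) \<in> vis BZ w \<and> w x \<le> w u)"
  then obtain x where u: "(u, c) \<in> vis BA w" and x: "(x, c) \<in> vis BZ w" "(x, v) \<in> vis BZ w" "w x \<le> w u" by blast
  obtain I where I: "I \<in> BA" "u \<in> I" "c \<in> I" "\<forall>x\<in>I. w x \<le> w u" using u by (rule A.visE)
  obtain J where J: "J \<in> BZ" "x \<in> J" "c \<in> J" "\<forall>y\<in>J. w y \<le> w x" using x(1) by (rule Z.visE)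
  obtain K where K: "K \<in> BZ" "x \<in> K" "v \<in> K" "\<forall>y\<in>K. w y \<le> w x" using x(2) by (rule Z.visE)
  have "J \<union> K \<in> BZ" using Z.un[OF J(1) K(1)] J K by blast
  then have "I \<union> (J \<union> K) \<in> B" using join[OF I(1)] I J by blast
  moreover have "w y \<le> w u" if "y \<in> I \<union> (J \<union> K)" for y
  proof -
    have "w y \<le> w u \<or> w y \<le> w x" using that I(4) J(4) K(4) by blast
    then show ?thesis using x(3) by linarith
  qed
  ultimately show "(u, v) \<in> vis B w" using I K by (intro G.visI[of "I \<union> (J \<union> K)"]) auto
qed

lemma vis_c: "u \<in> UA \<Longrightarrow> (u, c) \<in> vis B w \<longleftrightarrow> (u, c) \<in> vis BA w"
  using vis_A[of u c w] c_in by simp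

lemma restrict_A: "vis B w \<inter> UA \<times> UA = vis BA w"
proof (rule set_eqI, clarify)
  fix u v
  show "(u, v) \<in> vis B w \<inter> UA \<times> UA \<longleftrightarrow> (u, v) \<in> vis BA w"
    using vis_A[of u v w] A.vis_dom[of u v w] by blast
qed

lemma tie_class_off: 
  assumes "u \<in> UA" "(u, c) \<notin> vis BA w"
  shows "tie_class (vis B w) u = tie_class (vis BA w) u"
proof (rule set_eqI)
  fix v
  show "v \<in> tie_class (vis B w) u \<longleftrightarrow> v \<in> tie_class (vis BA w) u"
  proof (cases "v \<in> UA")
    case True
    then show ?thesis using assms vis_A by (simp add: tie_class_def)
  next
    case False
    have "(u, v) \<notin> vis B w"
    proof
      assume uv: "(u, v) \<in> vis B w"
      then have "v \<in> UZ" using False G.vis_dom by blast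
      then show False using vis_cross[OF assms(1)] uv assms(2) by blast
    qed
    moreover have "(u, v) \<notin> vis BA w" using False A.vis_dom by blast
    ultimately show ?thesis by (simp add: tie_class_def)
  qed
qed

lemma dominators_A: "dominators (vis B w) c \<inter> UA = dominators (vis BA w) c"
proof (rule set_eqI)
  fix u
  show "u \<in> dominators (vis B w) c \<inter> UA \<longleftrightarrow> u \<in> dominators (vis BA w) c"
  proof (cases "u \<in> UA")
    case True
    then show ?thesis using vis_A[of u c w] vis_A[of c u w] c_in by (simp add: dominators_def)
  next
    case False
    then show ?thesis using A.dominators_subset[of w c] by blast
  qed
qed

end

context wedge
begin

interpretation S: wedge BZ UZ BA UA B c by (rule swap)

lemma dominators_Un: "dominators (vis B w) c = dominators (vis BA w) c \<union> dominators (vis BZ w) c"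
  using dominators_A[of w] S.dominators_A[of w] G.dominators_subset[of w c] by blast

lemma off_chain_add: "off_chain (UA \<union> UZ) (vis B w) c = off_chain UA (vis BA w) c + off_chain UZ (vis BZ w) c"
proof -
  let ?NA = "{u \<in> UA. (u, c) \<notin> vis BA w}" and ?NZ = "{u \<in> UZ. (u, c) \<notin> vis BZ w}"
  have N: "{u \<in> UA \<union> UZ. (u, c) \<notin> vis B w} = ?NA \<union> ?NZ"
    using vis_c S.vis_c by blast
  have A: "tie_class (vis B w) ` ?NA = tie_class (vis BA w) ` ?NA" by (rule image_cong) (auto simp: tie_class_off)
  have Z: "tie_class (vis B w) ` ?NZ = tie_class (vis BZ w) ` ?NZ" by (rule image_cong) (auto simp: S.tie_class_off)
  have "tie_class (vis BA w) u \<noteq> tie_class (vis BZ w) v" if u: "u \<in> ?NA" and v: "v \<in> ?NZ" for u v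
  proof
    assume eq: "tie_class (vis BA w) u = tie_class (vis BZ w) v"
    have "u \<in> tie_class (vis BA w) u" using u A.vis_refl by (simp add: tie_class_def)
    then have "(u, v) \<in> vis BZ w" unfolding eq by (simp add: tie_class_def)
    then have "u \<in> UZ" using Z.vis_dom by blast
    then have "u = c" using u inter by blast
    then show False using u A.vis_refl[of c w] by simp
  qed
  then have "tie_class (vis BA w) ` ?NA \<inter> tie_class (vis BZ w) ` ?NZ = {}" by blast
  then show ?thesis
    unfolding off_chain_def N image_Un A Z using A.fin Z.fin by (simp add: card_Un_disjoint)
qed

text \<open>
  By \<open>vis_cross\<close> the relation on the glued set depends only on the relations on
  the two sides and on the weights of the two chains that see \<open>c\<close>.
\<close>

lemma vis_eq:
  assumes "vis BA w = vis BA w'" "vis BZ w = vis BZ w'"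
    and "\<And>u. (u, c) \<in> vis BA w \<Longrightarrow> w u = w' u" "\<And>u. (u, c) \<in> vis BZ w \<Longrightarrow> w u = w' u"
  shows "vis B w = vis B w'"
proof (rule set_eqI, clarify)
  fix u v
  have cA: "(u, v) \<in> vis B w \<longleftrightarrow> (u, v) \<in> vis B w'" if "u \<in> UA" "v \<in> UZ"
  proof (cases "(u, c) \<in> vis BA w")
    case False then show ?thesis using vis_cross[OF that] assms(1) by simp
  next
    case True
    then have "w u = w' u" by (rule assms(3))
    then show ?thesis using vis_cross[OF that, of w] vis_cross[OF that, of w'] assms(4)
      unfolding assms(1,2) by auto
  qed
  have cZ: "(u, v) \<in> vis B w \<longleftrightarrow> (u, v) \<in> vis B w'" if "u \<in> UZ" "v \<in> UA"
  proof (cases "(u, c) \<in> vis BZ w")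
    case False then show ?thesis using S.vis_cross[OF that] assms(2) by simp
  next
    case True
    then have "w u = w' u" by (rule assms(4))
    then show ?thesis using S.vis_cross[OF that, of w] S.vis_cross[OF that, of w'] assms(3)
      unfolding assms(1,2) by auto
  qed
  have AA: "(u, v) \<in> vis B w \<longleftrightarrow> (u, v) \<in> vis B w'" if "u \<in> UA" "v \<in> UA"
    using vis_A[OF that] assms(1) by simp
  have ZZ: "(u, v) \<in> vis B w \<longleftrightarrow> (u, v) \<in> vis B w'" if "u \<in> UZ" "v \<in> UZ"
    using S.vis_A[OF that] assms(2) by simp
  show "(u, v) \<in> vis B w \<longleftrightarrow> (u, v) \<in> vis B w'"
    using cA cZ AA ZZ G.vis_dom[of u v w] G.vis_dom[of u v w'] by blast
qed

definition glue :: "('a \<times> 'a) set \<Rightarrow> ('a \<times> 'a) set \<Rightarrow> nat set \<Rightarrow> nat set \<Rightarrow> 'a \<Rightarrow> real" where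
  "glue R1 R2 S T u = (if u \<in> UA then A.rep c R1 S u else Z.rep c R2 T u)"

lemma glue:
  assumes R: "R1 \<in> Vis BA" "R2 \<in> Vis BZ" and m: "(S, T) \<in> merges (depth R1 c) (depth R2 c)"
  shows "vis BA (glue R1 R2 S T) = R1" "vis BZ (glue R1 R2 S T) = R2" "glue R1 R2 S T c = 0"
    "glue R1 R2 S T ` dominators R1 c = levels S" "glue R1 R2 S T ` dominators R2 c = levels T"
proof -
  let ?w = "glue R1 R2 S T"
  have fS: "finite S" "card S = depth R1 c" and fT: "finite T" "card T = depth R2 c"
    using m by (auto elim: mergesE)
  note r1 = A.rep[OF c_in(1) R(1) fS] and r2 = Z.rep[OF c_in(2) R(2) fT]
  have wA: "?w u = A.rep c R1 S u" if "u \<in> UA" for u using that by (simp add: glue_def)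
  have wZ: "?w u = Z.rep c R2 T u" if "u \<in> UZ" for u
  proof (cases "u \<in> UA")
    case True then have "u = c" using that inter by blast
    then show ?thesis using r1 r2 c_in by (simp add: glue_def)
  qed (simp add: glue_def)
  show vA: "vis BA ?w = R1" using A.vis_cong[of ?w "A.rep c R1 S"] wA r1 by simp
  show vZ: "vis BZ ?w = R2" using Z.vis_cong[of ?w "Z.rep c R2 T"] wZ r2 by simp
  show "?w c = 0" using wA c_in r1 by simp
  have sA: "dominators R1 c \<subseteq> UA" using A.dominators_subset[of ?w c] by (simp add: vA)
  have sZ: "dominators R2 c \<subseteq> UZ" using Z.dominators_subset[of ?w c] by (simp add: vZ)
  show "?w ` dominators R1 c = levels S"
    unfolding r1(3)[symmetric] by (rule image_cong) (use sA wA in auto)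
  show "?w ` dominators R2 c = levels T"
    unfolding r2(3)[symmetric] by (rule image_cong) (use sZ wZ in auto)
qed

lemma glue_depth:
  assumes "R1 \<in> Vis BA" "R2 \<in> Vis BZ" "(S, T) \<in> merges (depth R1 c) (depth R2 c)"
  shows "glue R1 R2 S T ` dominators (vis B (glue R1 R2 S T)) c = levels (S \<union> T)"
    and "depth (vis B (glue R1 R2 S T)) c = card (S \<union> T)"
proof -
  note g = glue[OF assms]
  show *: "glue R1 R2 S T ` dominators (vis B (glue R1 R2 S T)) c = levels (S \<union> T)"
    unfolding dominators_Un g(1,2) image_Un g(4,5) by (rule levels_Un)
  show "depth (vis B (glue R1 R2 S T)) c = card (S \<union> T)"
    by (simp add: G.depth_eq *)
qed

lemma card_U: "card (UA \<union> UZ) + 1 = card UA + card UZ"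
  using card_Un_Int[of UA UZ] A.fin Z.fin inter by simp

lemma glue_face_dim:
  assumes "R1 \<in> Vis BA" "R2 \<in> Vis BZ" "(S, T) \<in> merges (depth R1 c) (depth R2 c)"
  shows "face_dim (UA \<union> UZ) (vis B (glue R1 R2 S T)) =
    face_dim UA R1 + face_dim UZ R2 + (depth R1 c + depth R2 c - card (S \<union> T))"
proof -
  let ?w = "glue R1 R2 S T"
  note g = glue[OF assms]
  have "face_dim (UA \<union> UZ) (vis B ?w) + off_chain (UA \<union> UZ) (vis B ?w) c + depth (vis B ?w) c + 1 = card (UA \<union> UZ)"
    by (rule G.face_dim_eq) (simp add: c_in)
  moreover have "face_dim UA R1 + off_chain UA R1 c + depth R1 c + 1 = card UA"
    using A.face_dim_eq[of c ?w] c_in by (simp add: g)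
  moreover have "face_dim UZ R2 + off_chain UZ R2 c + depth R2 c + 1 = card UZ"
    using Z.face_dim_eq[of c ?w] c_in by (simp add: g)
  moreover have "off_chain (UA \<union> UZ) (vis B ?w) c = off_chain UA R1 c + off_chain UZ R2 c"
    using off_chain_add[of ?w] by (simp add: g)
  moreover have "depth (vis B ?w) c = card (S \<union> T)" by (rule glue_depth(2)[OF assms])
  moreover have "card (S \<union> T) \<le> depth R1 c + depth R2 c" using assms(3) by (rule merges_card_le)
  ultimately show ?thesis using card_U by linarith
qed

text \<open>
  The relations that restrict to given relations on the two sides correspond to the mergings
  of the two chains above \<open>c\<close>. Injectivity and surjectivity both come from
  choosing the weights above \<open>c\<close> to be exactly \<open>1, \<dots>, r\<close>,
  which by \<open>level_unique\<close> makes them depend on the relation alone.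
\<close>

lemma glue_bij:
  assumes R: "R1 \<in> Vis BA" "R2 \<in> Vis BZ"
  shows "bij_betw (\<lambda>(S, T). vis B (glue R1 R2 S T)) (merges (depth R1 c) (depth R2 c))
    {R \<in> Vis B. (R \<inter> UA \<times> UA, R \<inter> UZ \<times> UZ) = (R1, R2)}"
  unfolding bij_betw_def
proof
  show "inj_on (\<lambda>(S, T). vis B (glue R1 R2 S T)) (merges (depth R1 c) (depth R2 c))"
  proof (rule inj_onI, clarify)
    fix S T S' T'
    assume m: "(S, T) \<in> merges (depth R1 c) (depth R2 c)" and m': "(S', T') \<in> merges (depth R1 c) (depth R2 c)"
      and eq: "vis B (glue R1 R2 S T) = vis B (glue R1 R2 S' T')"
    let ?w = "glue R1 R2 S T" and ?w' = "glue R1 R2 S' T'"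
    note g = glue[OF R m] and g' = glue[OF R m']
    have c_eq: "card (S \<union> T) = card (S' \<union> T')" using glue_depth(2)[OF R m] glue_depth(2)[OF R m'] eq by simp
    obtain r where r: "S \<union> T = {..<r}" "card (S \<union> T) = r" using m by (rule mergesE)
    obtain r' where r': "S' \<union> T' = {..<r'}" "card (S' \<union> T') = r'" using m' by (rule mergesE)
    have rr: "r = r'" using r(2) r'(2) c_eq by metis
    have U: "S \<union> T = S' \<union> T'" by (rule trans[OF r(1)[unfolded rr] r'(1)[symmetric]])
    have w: "?w u = ?w' u" if "(u, c) \<in> vis B ?w" for u
    proof (rule G.level_unique[OF _ eq _ _ that])
      show "c \<in> UA \<union> UZ" using c_in by blast
      show "?w ` dominators (vis B ?w) c = ?w' ` dominators (vis B ?w) c"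
        using glue_depth(1)[OF R m] glue_depth(1)[OF R m'] unfolding eq U by metis
      show "?w c = ?w' c" by (simp only: g(3) g'(3))
    qed
    have "?w u = ?w' u" if "u \<in> dominators R1 c \<union> dominators R2 c" for u
    proof (rule w)
      have "u \<in> dominators (vis B ?w) c" using that by (simp add: dominators_Un g)
      then show "(u, c) \<in> vis B ?w" by (simp add: dominators_def)
    qed
    then have "?w ` dominators R1 c = ?w' ` dominators R1 c" "?w ` dominators R2 c = ?w' ` dominators R2 c"
      by (auto intro!: image_cong)
    then show "S = S' \<and> T = T'" using g g' levels_inj by metis
  qed
  show "(\<lambda>(S, T). vis B (glue R1 R2 S T)) ` merges (depth R1 c) (depth R2 c) =
    {R \<in> Vis B. (R \<inter> UA \<times> UA, R \<inter> UZ \<times> UZ) = (R1, R2)}"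
  proof (intro set_eqI iffI)
    fix R assume "R \<in> (\<lambda>(S, T). vis B (glue R1 R2 S T)) ` merges (depth R1 c) (depth R2 c)"
    then obtain S T where m: "(S, T) \<in> merges (depth R1 c) (depth R2 c)" and r: "R = vis B (glue R1 R2 S T)" by auto
    show "R \<in> {R \<in> Vis B. (R \<inter> UA \<times> UA, R \<inter> UZ \<times> UZ) = (R1, R2)}"
      using glue(1,2)[OF R m] by (simp add: r restrict_A S.restrict_A Vis_def)
  next
    fix R assume "R \<in> {R \<in> Vis B. (R \<inter> UA \<times> UA, R \<inter> UZ \<times> UZ) = (R1, R2)}"
    then obtain w0 where w0: "R = vis B w0" "R \<inter> UA \<times> UA = R1" "R \<inter> UZ \<times> UZ = R2" by (auto simp: Vis_def)
    define r where "r = depth R c"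
    obtain w where w: "vis B w = R" "w c = 0" "w ` dominators R c = levels {..<r}"
    proof (rule G.vis_normal_form[of c R "levels {..<r}"])
      show "c \<in> UA \<union> UZ" by (simp add: c_in)
      show "R \<in> Vis B" by (simp add: w0 Vis_def)
      show "finite (levels {..<r})" by (simp add: levels_def)
      show "\<And>s. s \<in> levels {..<r} \<Longrightarrow> 0 < s" by (rule levels_pos)
      show "card (levels {..<r}) = depth R c" by (simp add: r_def)
    qed blast
    have vA: "vis BA w = R1" using restrict_A[of w] w0(2) w(1) by simp
    have vZ: "vis BZ w = R2" using S.restrict_A[of w] w0(3) w(1) by simp
    have an: "dominators R c = dominators R1 c \<union> dominators R2 c" using dominators_Un[of w] by (simp add: w vA vZ)
    obtain S where S: "S \<subseteq> {..<r}" "w ` dominators R1 c = levels S"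
      using levels_subset[of "w ` dominators R1 c" "{..<r}"] w(3) an by blast
    obtain T where T: "T \<subseteq> {..<r}" "w ` dominators R2 c = levels T"
      using levels_subset[of "w ` dominators R2 c" "{..<r}"] w(3) an by blast
    have "levels (S \<union> T) = levels {..<r}"
      using w(3) unfolding an image_Un S(2) T(2) levels_Un .
    then have U: "S \<union> T = {..<r}" by (rule levels_inj)
    have "depth R1 c = card S" using A.depth_eq[of w c] by (simp add: vA S)
    moreover have "depth R2 c = card T" using Z.depth_eq[of w c] by (simp add: vZ T)
    moreover have "finite S" "finite T" using S(1) T(1) finite_subset by blast+
    ultimately have m: "(S, T) \<in> merges (depth R1 c) (depth R2 c)"
      unfolding merges_def by (intro CollectI case_prodI conjI exI[of _ r] U) simp_all
    note g = glue[OF R m]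
    let ?w = "glue R1 R2 S T"
    have w0: "w c = ?w c" by (simp only: w(2) g(3))
    have "w u = ?w u" if "(u, c) \<in> vis BA w" for u
      by (rule A.level_unique[of c w ?w u, OF c_in(1) _ _ w0 that]) (simp_all only: vA g(1,4) S(2))
    moreover have "w u = ?w u" if "(u, c) \<in> vis BZ w" for u
      by (rule Z.level_unique[of c w ?w u, OF c_in(2) _ _ w0 that]) (simp_all only: vZ g(2,5) T(2))
    ultimately have "vis B w = vis B ?w"
      by (intro vis_eq) (simp_all only: vA vZ g(1,2))
    then have "R = (\<lambda>(S, T). vis B (glue R1 R2 S T)) (S, T)" using w by simp
    then show "R \<in> (\<lambda>(S, T). vis B (glue R1 R2 S T)) ` merges (depth R1 c) (depth R2 c)"
      using m by (rule image_eqI)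
  qed
qed

lemma depth_poly_wedge:
  assumes "s > 0"
  shows "depth_poly (UA \<union> UZ) B c s = merge_product ((s - 1) / s\<^sup>2) (depth_poly UA BA c s) (depth_poly UZ BZ c s)"
proof -
  let ?P = "[:1, s:]" and ?x = "(s - 1) / s\<^sup>2" and ?t = "s - 2"
  define F where "F = (\<lambda>R. smult (?t ^ face_dim (UA \<union> UZ) R) (?P ^ depth R c))"
  define g where "g = (\<lambda>R. (R \<inter> UA \<times> UA, R \<inter> UZ \<times> UZ))"
  have fiber: "(\<Sum>R\<in>{R \<in> Vis B. g R = (R1, R2)}. F R) =
      smult (?t ^ face_dim UA R1) (smult (?t ^ face_dim UZ R2) (merge_product ?x (?P ^ depth R1 c) (?P ^ depth R2 c)))"
    if R: "R1 \<in> Vis BA" "R2 \<in> Vis BZ" for R1 R2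
  proof -
    have "(\<Sum>R\<in>{R \<in> Vis B. g R = (R1, R2)}. F R) =
        (\<Sum>(S, T)\<in>merges (depth R1 c) (depth R2 c). F (vis B (glue R1 R2 S T)))"
      unfolding g_def using sum.reindex_bij_betw[OF glue_bij[OF R], of F] by (simp add: case_prod_unfold)
    also have "\<dots> = (\<Sum>(S, T)\<in>merges (depth R1 c) (depth R2 c). smult (?t ^ face_dim UA R1) (smult (?t ^ face_dim UZ R2)
        (smult (?t ^ (depth R1 c + depth R2 c - card (S \<union> T))) (?P ^ card (S \<union> T)))))"
    proof (rule sum.cong[OF refl], clarify)
      fix S T assume "(S, T) \<in> merges (depth R1 c) (depth R2 c)"
      then show "F (vis B (glue R1 R2 S T)) = smult (?t ^ face_dim UA R1) (smult (?t ^ face_dim UZ R2)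
        (smult (?t ^ (depth R1 c + depth R2 c - card (S \<union> T))) (?P ^ card (S \<union> T))))"
        unfolding F_def using glue_face_dim[OF R] glue_depth(2)[OF R] by (simp only: power_add smult_smult mult.assoc)
    qed
    also have "\<dots> = smult (?t ^ face_dim UA R1) (smult (?t ^ face_dim UZ R2)
        (\<Sum>(S, T)\<in>merges (depth R1 c) (depth R2 c).
          smult (?t ^ (depth R1 c + depth R2 c - card (S \<union> T))) (?P ^ card (S \<union> T))))"
      by (simp only: smult_sum_distrib case_prod_unfold)
    finally show ?thesis using sum_merges[of s ?x "depth R1 c" "depth R2 c"] assms by simp
  qed
  have "depth_poly (UA \<union> UZ) B c s = (\<Sum>R\<in>Vis B. F R)" by (simp add: depth_poly_def F_def)
  also have "\<dots> = (\<Sum>p\<in>Vis BA \<times> Vis BZ. \<Sum>R\<in>{R \<in> Vis B. g R = p}. F R)"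
  proof (rule sum.group[symmetric])
    show "g ` Vis B \<subseteq> Vis BA \<times> Vis BZ"
      unfolding g_def by (auto simp: Vis_def restrict_A S.restrict_A)
  qed (simp_all add: A.finite_Vis Z.finite_Vis G.finite_Vis)
  also have "\<dots> = (\<Sum>(R1, R2)\<in>Vis BA \<times> Vis BZ.
      smult (?t ^ face_dim UA R1) (smult (?t ^ face_dim UZ R2) (merge_product ?x (?P ^ depth R1 c) (?P ^ depth R2 c))))"
    by (rule sum.cong[OF refl]) (auto simp: fiber)
  also have "\<dots> = merge_product ?x (depth_poly UA BA c s) (depth_poly UZ BZ c s)"
    unfolding depth_poly_def unfolding bilin_sum_left bilin_smult_left
    unfolding bilin_sum_right bilin_smult_right smult_sum_distrib
    by (simp only: sum.cartesian_product)
  finally show ?thesis .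
qed

lemma gamma_spec_wedge:
  assumes "gamma_spec UA BA c \<alpha>" "gamma_spec UZ BZ c \<zeta>"
  shows "gamma_spec (UA \<union> UZ) B c (merge_product [:0, 1:] \<alpha> \<zeta>)"
  unfolding gamma_spec_def
proof (intro allI impI)
  fix s :: real assume s: "s > 1"
  have "UA \<noteq> {}" "UZ \<noteq> {}" using c_in by auto
  then have "card UA > 0" "card UZ > 0" using A.fin Z.fin by (simp_all add: card_gt_0_iff)
  then have "card (UA \<union> UZ) - 1 = (card UA - 1) + (card UZ - 1)" using card_U by linarith
  then show "depth_poly (UA \<union> UZ) B c s =
      smult (s ^ (card (UA \<union> UZ) - 1)) (map_poly (eval_nat ((s - 1) / s\<^sup>2)) (merge_product [:0, 1:] \<alpha> \<zeta>))"
    using assms s unfolding gamma_spec_def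
    by (simp add: depth_poly_wedge map_eval_nat_merge_product eval_nat_hom(5)[unfolded One_nat_def] bilin_smult_left bilin_smult_right
        power_add mult.commute)
qed

end

section \<open>Attaching a pendant root\<close>

locale pendant = A: building BA UA + G: building B "insert r UA"
  for BA :: "'a set set" and UA and B and r :: 'a +
  fixes c :: 'a
  assumes c_in: "c \<in> UA" and r_out: "r \<notin> UA"
    and subA: "BA \<subseteq> B"
    and restrA: "I \<in> B \<Longrightarrow> I \<inter> UA \<noteq> {} \<Longrightarrow> I \<inter> UA \<in> BA"
    and cross: "I \<in> B \<Longrightarrow> r \<in> I \<Longrightarrow> I \<inter> UA \<noteq> {} \<Longrightarrow> c \<in> I"
    and join: "I \<in> BA \<Longrightarrow> c \<in> I \<Longrightarrow> insert r I \<in> B"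
begin

lemma vis_A:
  assumes "u \<in> UA" "v \<in> UA"
  shows "(u, v) \<in> vis B w \<longleftrightarrow> (u, v) \<in> vis BA w"
proof
  assume "(u, v) \<in> vis B w"
  then obtain I where I: "I \<in> B" "u \<in> I" "v \<in> I" "\<forall>x\<in>I. w x \<le> w u" by (rule G.visE)
  then show "(u, v) \<in> vis BA w" using assms restrA[OF I(1)] by (intro A.visI[of "I \<inter> UA"]) auto
next
  assume "(u, v) \<in> vis BA w"
  then show "(u, v) \<in> vis B w" using subA by (auto simp: vis_def)
qed

lemma restrict_A: "vis B w \<inter> UA \<times> UA = vis BA w"
proof (rule set_eqI, clarify)
  fix u v
  show "(u, v) \<in> vis B w \<inter> UA \<times> UA \<longleftrightarrow> (u, v) \<in> vis BA w"
    using vis_A[of u v w] A.vis_dom[of u v w] by blast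
qed

lemma vis_to_r:
  assumes "v \<in> UA"
  shows "(v, r) \<in> vis B w \<longleftrightarrow> (v, c) \<in> vis BA w \<and> w r \<le> w v"
proof
  assume "(v, r) \<in> vis B w"
  then obtain I where I: "I \<in> B" "v \<in> I" "r \<in> I" "\<forall>x\<in>I. w x \<le> w v" by (rule G.visE)
  have "I \<inter> UA \<in> BA" "c \<in> I" using I assms restrA[OF I(1)] cross[OF I(1)] by blast+
  then show "(v, c) \<in> vis BA w \<and> w r \<le> w v" using I assms c_in by (auto intro: A.visI[of "I \<inter> UA"])
next
  assume a: "(v, c) \<in> vis BA w \<and> w r \<le> w v"
  then have "(v, c) \<in> vis BA w" by blast
  then obtain I where I: "I \<in> BA" "v \<in> I" "c \<in> I" "\<forall>x\<in>I. w x \<le> w v" by (rule A.visE)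
  then show "(v, r) \<in> vis B w" using join[OF I(1,3)] a by (intro G.visI[of "insert r I"]) auto
qed

lemma vis_from_r:
  assumes "v \<in> UA"
  shows "(r, v) \<in> vis B w \<longleftrightarrow> (\<exists>x. (x, c) \<in> vis BA w \<and> (x, v) \<in> vis BA w \<and> w x \<le> w r)"
proof
  assume "(r, v) \<in> vis B w"
  then obtain I where I: "I \<in> B" "r \<in> I" "v \<in> I" "\<forall>x\<in>I. w x \<le> w r" by (rule G.visE)
  have IA: "I \<inter> UA \<in> BA" and cI: "c \<in> I" using I assms restrA[OF I(1)] cross[OF I(1)] by blast+
  have fI: "finite (w ` (I \<inter> UA))" "w ` (I \<inter> UA) \<noteq> {}" using A.fin cI c_in by auto
  then have "Max (w ` (I \<inter> UA)) \<in> w ` (I \<inter> UA)" by (rule Max_in)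
  then obtain x where x: "x \<in> I" "x \<in> UA" "w x = Max (w ` (I \<inter> UA))" by auto
  have max: "w y \<le> w x" if "y \<in> I \<inter> UA" for y using that fI x(3) by simp
  have "(x, c) \<in> vis BA w" "(x, v) \<in> vis BA w"
    by (rule A.visI[OF IA]; use x I assms cI c_in max in auto)+
  then show "\<exists>x. (x, c) \<in> vis BA w \<and> (x, v) \<in> vis BA w \<and> w x \<le> w r" using I x by blast
next
  assume "\<exists>x. (x, c) \<in> vis BA w \<and> (x, v) \<in> vis BA w \<and> w x \<le> w r"
  then obtain x where x: "(x, c) \<in> vis BA w" "(x, v) \<in> vis BA w" "w x \<le> w r" by blast
  obtain J where J: "J \<in> BA" "x \<in> J" "c \<in> J" "\<forall>y\<in>J. w y \<le> w x" using x(1) by (rule A.visE)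
  obtain K where K: "K \<in> BA" "x \<in> K" "v \<in> K" "\<forall>y\<in>K. w y \<le> w x" using x(2) by (rule A.visE)
  have "J \<union> K \<in> BA" using A.un[OF J(1) K(1)] J K by blast
  then have "insert r (J \<union> K) \<in> B" using join[of "J \<union> K"] J by blast
  moreover have "w y \<le> w r" if "y \<in> insert r (J \<union> K)" for y
  proof -
    have "w y \<le> w r \<or> w y \<le> w x" using that J(4) K(4) by blast
    then show ?thesis using x(3) by linarith
  qed
  ultimately show "(r, v) \<in> vis B w" using K by (intro G.visI[of "insert r (J \<union> K)"]) auto
qed

lemma vis_eq:
  assumes "vis BA w = vis BA w'"
    and "\<And>u. (u, c) \<in> vis BA w \<Longrightarrow> (w u \<le> w r \<longleftrightarrow> w' u \<le> w' r) \<and> (w r \<le> w u \<longleftrightarrow> w' r \<le> w' u)"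
  shows "vis B w = vis B w'"
proof (rule set_eqI, clarify)
  fix u v
  have AA: "(u, v) \<in> vis B w \<longleftrightarrow> (u, v) \<in> vis B w'" if "u \<in> UA" "v \<in> UA"
    using vis_A[OF that] assms(1) by simp
  have Ar: "(u, v) \<in> vis B w \<longleftrightarrow> (u, v) \<in> vis B w'" if "u \<in> UA" "v = r"
    using vis_to_r[OF that(1)] assms that(2) by auto
  have rA: "(u, v) \<in> vis B w \<longleftrightarrow> (u, v) \<in> vis B w'" if "u = r" "v \<in> UA"
  proof -
    have "(x, c) \<in> vis BA w \<and> (x, v) \<in> vis BA w \<and> w x \<le> w r \<longleftrightarrow>
        (x, c) \<in> vis BA w' \<and> (x, v) \<in> vis BA w' \<and> w' x \<le> w' r" for x
      using assms(2)[of x] unfolding assms(1) by blast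
    then show ?thesis unfolding that(1) vis_from_r[OF that(2)] by simp
  qed
  have rr: "(u, v) \<in> vis B w \<longleftrightarrow> (u, v) \<in> vis B w'" if "u = r" "v = r"
    using that G.vis_refl by simp
  show "(u, v) \<in> vis B w \<longleftrightarrow> (u, v) \<in> vis B w'"
    using AA Ar rA rr G.vis_dom[of u v w] G.vis_dom[of u v w'] by blast
qed

lemma dominators_r: "dominators (vis B w) r = {v. (v, c) \<in> vis BA w \<and> w r < w v}"
proof (rule set_eqI)
  fix v
  show "v \<in> dominators (vis B w) r \<longleftrightarrow> v \<in> {v. (v, c) \<in> vis BA w \<and> w r < w v}"
  proof (cases "v \<in> UA")
    case True
    then show ?thesis using G.dominators_iff[of r v w] vis_to_r[of v w] by auto
  next
    case False
    have "v \<notin> dominators (vis B w) r"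
    proof
      assume v: "v \<in> dominators (vis B w) r"
      then have "v = r" using False G.dominators_subset by blast
      then show False using v by (simp add: dominators_def)
    qed
    then show ?thesis using False A.vis_dom by blast
  qed
qed

lemma classes_r:
  "card (tie_class (vis B w) ` insert r UA) =
     card (tie_class (vis BA w) ` UA) + (if \<exists>v. (v, c) \<in> vis BA w \<and> w v = w r then 0 else 1)"
proof -
  have "card (tie_class (vis B w) ` UA) = card (tie_class (vis BA w) ` UA)"
  proof (rule card_image_cong_ker)
    fix u v assume uv: "u \<in> UA" "v \<in> UA"
    then show "tie_class (vis B w) u = tie_class (vis B w) v \<longleftrightarrow> tie_class (vis BA w) u = tie_class (vis BA w) v"
      using G.tie_class_eq_iff[of u v w] A.tie_class_eq_iff[OF uv, of w] vis_A[OF uv] vis_A[OF uv(2,1)] by simp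
  qed
  moreover have "tie_class (vis B w) r \<in> tie_class (vis B w) ` UA \<longleftrightarrow> (\<exists>v. (v, c) \<in> vis BA w \<and> w v = w r)"
  proof
    assume "tie_class (vis B w) r \<in> tie_class (vis B w) ` UA"
    then obtain v where v: "v \<in> UA" "tie_class (vis B w) r = tie_class (vis B w) v" by blast
    then have "(r, v) \<in> vis B w" "(v, r) \<in> vis B w" using G.tie_class_eq_iff[of r v w] by simp_all
    then show "\<exists>v. (v, c) \<in> vis BA w \<and> w v = w r"
      using vis_to_r[OF v(1)] G.vis_le[of r v w] G.vis_le[of v r w] by (intro exI[of _ v]) auto
  next
    assume "\<exists>v. (v, c) \<in> vis BA w \<and> w v = w r"
    then obtain v where v: "(v, c) \<in> vis BA w" "w v = w r" by blast
    then have vA: "v \<in> UA" using A.vis_dom by blast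
    have "(v, r) \<in> vis B w" using vis_to_r[OF vA] v by simp
    moreover have "(r, v) \<in> vis B w" using vis_from_r[OF vA] v A.vis_refl[OF vA] by auto
    ultimately have "tie_class (vis B w) r = tie_class (vis B w) v" using G.tie_class_eq_iff[of r v w] vA by simp
    then show "tie_class (vis B w) r \<in> tie_class (vis B w) ` UA" using vA by blast
  qed
  ultimately show ?thesis using A.fin by (simp add: card_insert_if)
qed

lemma face_dim_r:
  "face_dim (insert r UA) (vis B w) = face_dim UA (vis BA w) + (if \<exists>v. (v, c) \<in> vis BA w \<and> w v = w r then 1 else 0)"
proof -
  have "card (tie_class (vis BA w) ` UA) \<le> card UA" by (rule card_image_le[OF A.fin])
  moreover have "card (insert r UA) = Suc (card UA)" using A.fin r_out by simp
  moreover define b where "b \<longleftrightarrow> (\<exists>v. (v, c) \<in> vis BA w \<and> w v = w r)"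
  ultimately show ?thesis
    unfolding face_dim_def classes_r b_def[symmetric] by (cases b) simp_all
qed

text \<open>
  The chain of vertices seeing \<open>c\<close> gets the weights \<open>0, \<dots>, p\<close>
  with \<open>p = depth R c\<close>, and \<open>r\<close> is put below exactly
  \<open>i\<close> of them: level with the next one if \<open>m\<close> holds, otherwise half
  a unit above it.
\<close>

definition place :: "('a \<times> 'a) set \<Rightarrow> bool \<Rightarrow> nat \<Rightarrow> 'a \<Rightarrow> real" where
  "place R m i = (A.rep c R {..<depth R c})(r := real (depth R c) - real i + (if m then 0 else 1 / 2))"

definition slots :: "nat \<Rightarrow> (bool \<times> nat) set" where
  "slots p = {False} \<times> {..Suc p} \<union> {True} \<times> {..p}"

lemma chain_image:
  assumes "w c = 0" "w ` dominators (vis BA w) c = levels {..<p}"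
  shows "w ` {v. (v, c) \<in> vis BA w} = real ` {..p}"
proof -
  have "{v. (v, c) \<in> vis BA w} = dominators (vis BA w) c \<union> {v. (v, c) \<in> vis BA w \<and> (c, v) \<in> vis BA w}"
    by (auto simp: dominators_def)
  moreover have "w ` {v. (v, c) \<in> vis BA w \<and> (c, v) \<in> vis BA w} = {0}"
  proof -
    have "w v = 0" if "(v, c) \<in> vis BA w" "(c, v) \<in> vis BA w" for v
      using A.vis_le[OF that(1)] A.vis_le[OF that(2)] assms(1) by simp
    moreover have "c \<in> {v. (v, c) \<in> vis BA w \<and> (c, v) \<in> vis BA w}" using A.vis_refl[OF c_in] by simp
    ultimately show ?thesis using assms(1) by (auto simp: image_iff)
  qed
  ultimately have "w ` {v. (v, c) \<in> vis BA w} = levels {..<p} \<union> {0}" using assms(2) by (simp add: image_Un)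
  also have "levels {..<p} \<union> {0} = real ` insert 0 (Suc ` {..<p})" by (auto simp: levels_def image_image)
  also have "insert 0 (Suc ` {..<p}) = {..p}" by (metis lessThan_Suc_atMost lessThan_Suc_eq_insert_0)
  finally show ?thesis .
qed

lemma place:
  assumes R: "R \<in> Vis BA" and mi: "(m, i) \<in> slots (depth R c)"
  shows "vis BA (place R m i) = R" "place R m i ` {v. (v, c) \<in> R} = real ` {..depth R c}"
    "place R m i r = real (depth R c) - real i + (if m then 0 else 1 / 2)"
    "depth (vis B (place R m i)) r = i" "face_dim (insert r UA) (vis B (place R m i)) = face_dim UA R + (if m then 1 else 0)"
    "place R m i c = 0" "place R m i ` dominators R c = levels {..<depth R c}"
proof -
  let ?w = "place R m i" and ?p = "depth R c"
  have 1: "finite {..<?p}" "card {..<?p} = depth R c" by simp_all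
  note rep = A.rep[OF c_in R 1]
  have wA: "?w u = A.rep c R {..<?p} u" if "u \<in> UA" for u using that r_out by (auto simp: place_def)
  show v: "vis BA ?w = R" using A.vis_cong[of ?w "A.rep c R {..<?p}"] wA rep by simp
  show c0: "?w c = 0" using wA[OF c_in] rep by simp
  have "dominators R c \<subseteq> UA" using A.dominators_subset[of ?w c] by (simp add: v)
  then have "?w ` dominators R c = A.rep c R {..<?p} ` dominators R c" by (intro image_cong refl wA) blast
  then show a: "?w ` dominators R c = levels {..<?p}" using rep(3) by simp
  then show ch: "?w ` {v. (v, c) \<in> R} = real ` {..?p}" using chain_image[of ?w ?p] c0 v by simp
  show wr: "?w r = real ?p - real i + (if m then 0 else 1 / 2)" by (simp add: place_def)
  have ip: "i \<le> (if m then ?p else Suc ?p)" using mi by (auto simp: slots_def)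
  have gt: "?w r < real j \<longleftrightarrow> ?p < j + i" for j
    unfolding wr by (cases m) (simp_all, linarith+)
  have "?w ` dominators (vis B ?w) r = real ` {j. j \<le> ?p \<and> ?p < j + i}"
  proof -
    have "?w ` dominators (vis B ?w) r = {y \<in> ?w ` {v. (v, c) \<in> R}. ?w r < y}" by (auto simp: dominators_r v)
    also have "\<dots> = real ` {j. j \<le> ?p \<and> ?p < j + i}" unfolding ch by (auto simp: gt)
    finally show ?thesis .
  qed
  moreover have "{j. j \<le> ?p \<and> ?p < j + i} = {Suc ?p - i..<Suc ?p}" using ip by auto
  ultimately have "?w ` dominators (vis B ?w) r = real ` {Suc ?p - i..<Suc ?p}" by simp
  then have "depth (vis B ?w) r = card (real ` {Suc ?p - i..<Suc ?p})" by (simp add: G.depth_eq)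
  also have "\<dots> = i" using ip by (simp add: card_image split: if_splits)
  finally show "depth (vis B ?w) r = i" .
  have "(\<exists>v. (v, c) \<in> R \<and> ?w v = ?w r) \<longleftrightarrow> m"
  proof -
    have "(\<exists>v. (v, c) \<in> R \<and> ?w v = ?w r) \<longleftrightarrow> ?w r \<in> ?w ` {v. (v, c) \<in> R}" by (auto simp: image_iff)
    also have "\<dots> \<longleftrightarrow> ?w r \<in> real ` {..?p}" by (simp only: ch)
    also have "\<dots> \<longleftrightarrow> m"
    proof (cases m)
      case True
      then have "?w r = real (?p - i)" using ip wr by (simp add: of_nat_diff)
      then show ?thesis using True by auto
    next
      case False
      have "real ?p - real i + 1 / 2 \<noteq> real j" for j :: nat
      proof
        assume "real ?p - real i + 1 / 2 = real j"
        then have "real (2 * ?p + 1) = real (2 * (j + i))" by simp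
        then have "2 * ?p + 1 = 2 * (j + i)" by (simp only: of_nat_eq_iff)
        then show False by presburger
      qed
      moreover have "?w r = real ?p - real i + 1 / 2" using wr False by simp
      ultimately have "?w r \<notin> real ` {..?p}" by (simp add: image_iff)
      then show ?thesis using False by blast
    qed
    finally show ?thesis .
  qed
  then show "face_dim (insert r UA) (vis B ?w) = face_dim UA R + (if m then 1 else 0)"
    using face_dim_r[of ?w] by (simp add: v)
qed

lemma slot_of_real:
  fixes \<rho> :: real
  obtains m i where "(m, i) \<in> slots p"
    "\<And>j. j \<le> p \<Longrightarrow> (real j \<le> \<rho> \<longleftrightarrow> real j \<le> real p - real i + (if m then 0 else 1 / 2)) \<and>
       (\<rho> \<le> real j \<longleftrightarrow> real p - real i + (if m then 0 else 1 / 2) \<le> real j)"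
proof (cases "\<rho> \<in> real ` {..p}")
  case True
  then obtain k where k: "k \<le> p" "\<rho> = real k" by auto
  then show thesis using that[of True "p - k"] by (simp add: slots_def)
next
  case False
  define J where "J = {j. j \<le> p \<and> \<rho> < real j}"
  \<comment> \<open>The smallest level above \<open>\<rho>\<close>, or one past the top if there is none.\<close>
  define k where "k = (if J = {} then Suc p else Min J)"
  have fJ: "finite J" by (simp add: J_def)
  have kp: "k \<le> Suc p"
  proof (cases "J = {}")
    case False
    then have "Min J \<in> J" using fJ by simp
    then show ?thesis using False by (simp add: k_def J_def)
  qed (simp add: k_def)
  have lt: "\<rho> < real j \<longleftrightarrow> k \<le> j" if "j \<le> p" for j
  proof
    assume "\<rho> < real j"
    then have "j \<in> J" using that by (simp add: J_def)
    then show "k \<le> j" using fJ by (auto simp: k_def)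
  next
    assume kj: "k \<le> j"
    then have "J \<noteq> {}" using that by (auto simp: k_def)
    then have "Min J \<in> J" "k = Min J" using fJ by (simp_all add: k_def)
    then have "\<rho> < real k" by (simp add: J_def)
    then show "\<rho> < real j" using kj by linarith
  qed
  have ne: "\<rho> \<noteq> real j" if "j \<le> p" for j using False that by auto
  show thesis
  proof (rule that[of False "Suc p - k"])
    show "(False, Suc p - k) \<in> slots p" by (simp add: slots_def)
    fix j assume j: "j \<le> p"
    have e: "real p - real (Suc p - k) + 1 / 2 = real k - 1 / 2" using kp by (simp add: of_nat_diff)
    have 1: "real j \<le> \<rho> \<longleftrightarrow> j < k" using lt[OF j] by linarith
    have 2: "\<rho> \<le> real j \<longleftrightarrow> k \<le> j" using lt[OF j] ne[OF j] by linarith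
    have 3: "real j \<le> real k - 1 / 2 \<longleftrightarrow> j < k" by linarith
    have 4: "real k - 1 / 2 \<le> real j \<longleftrightarrow> k \<le> j" by linarith
    show "(real j \<le> \<rho> \<longleftrightarrow> real j \<le> real p - real (Suc p - k) + (if False then 0 else 1 / 2)) \<and>
       (\<rho> \<le> real j \<longleftrightarrow> real p - real (Suc p - k) + (if False then 0 else 1 / 2) \<le> real j)"
      unfolding if_False e 1 2 3 4 by simp
  qed
qed

text \<open>
  Extending a relation to the new vertex amounts to choosing the position of \<open>r\<close>
  relative to the chain of vertices that see \<open>c\<close>. The position can be recovered
  from the depth of \<open>r\<close> and the dimension.
\<close>

lemma place_bij:
  assumes R: "R0 \<in> Vis BA"
  shows "bij_betw (\<lambda>(m, i). vis B (place R0 m i)) (slots (depth R0 c)) {R \<in> Vis B. R \<inter> UA \<times> UA = R0}"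
  unfolding bij_betw_def
proof
  show "inj_on (\<lambda>(m, i). vis B (place R0 m i)) (slots (depth R0 c))"
  proof (rule inj_onI, clarify)
    fix m i m' i'
    assume mi: "(m, i) \<in> slots (depth R0 c)" and mi': "(m', i') \<in> slots (depth R0 c)"
      and eq: "vis B (place R0 m i) = vis B (place R0 m' i')"
    have "i = i'" using place(4)[OF R mi] place(4)[OF R mi'] unfolding eq by (rule trans[OF sym])
    moreover have "face_dim UA R0 + (if m then 1 else 0) = face_dim UA R0 + (if m' then 1 else 0)"
      using place(5)[OF R mi] place(5)[OF R mi'] unfolding eq by (rule trans[OF sym])
    then have "m = m'" by (simp split: if_splits)
    ultimately show "m = m' \<and> i = i'" by blast
  qed
  show "(\<lambda>(m, i). vis B (place R0 m i)) ` slots (depth R0 c) = {R \<in> Vis B. R \<inter> UA \<times> UA = R0}"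
  proof (intro set_eqI iffI)
    fix R assume "R \<in> (\<lambda>(m, i). vis B (place R0 m i)) ` slots (depth R0 c)"
    then obtain m i where m: "(m, i) \<in> slots (depth R0 c)" and r: "R = vis B (place R0 m i)" by auto
    show "R \<in> {R \<in> Vis B. R \<inter> UA \<times> UA = R0}"
      using place(1)[OF R m] by (simp add: r restrict_A Vis_def)
  next
    fix R assume "R \<in> {R \<in> Vis B. R \<inter> UA \<times> UA = R0}"
    then obtain w0 where w0: "R = vis B w0" "R \<inter> UA \<times> UA = R0" by (auto simp: Vis_def)
    define p where "p = depth R0 c"
    have v0: "vis BA w0 = R0" using restrict_A[of w0] w0 by simp
    obtain g where g: "strict_mono g" "g (w0 c) = 0" "(g \<circ> w0) ` dominators (vis BA w0) c = levels {..<p}"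
    proof (rule A.normalising_map[OF c_in, of "levels {..<p}" w0])
      show "finite (levels {..<p})" by (simp add: levels_def)
      show "\<And>s. s \<in> levels {..<p} \<Longrightarrow> 0 < s" by (rule levels_pos)
      show "card (levels {..<p}) = depth (vis BA w0) c" by (simp add: p_def v0)
    qed blast
    define w where "w = g \<circ> w0"
    have w: "vis B w = R" "vis BA w = R0" "w c = 0" "w ` dominators R0 c = levels {..<p}"
      using g by (simp_all add: w_def G.vis_strict_mono A.vis_strict_mono w0(1) v0)
    obtain m i where mi: "(m, i) \<in> slots p" and cmp: "\<And>j. j \<le> p \<Longrightarrow>
        (real j \<le> w r \<longleftrightarrow> real j \<le> real p - real i + (if m then 0 else 1 / 2)) \<and>
       (w r \<le> real j \<longleftrightarrow> real p - real i + (if m then 0 else 1 / 2) \<le> real j)"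
      using slot_of_real[of p "w r"] by blast
    let ?w = "place R0 m i"
    note pl = place[OF R mi[unfolded p_def]]
    have eq_c: "w c = ?w c" by (simp only: w(3) pl(6))
    have agree: "w u = ?w u" if "(u, c) \<in> vis BA w" for u
      by (rule A.level_unique[of c w ?w u, OF c_in _ _ eq_c that]) (simp_all only: w(2,4) pl(1,7) p_def)
    have "vis B w = vis B ?w"
    proof (rule vis_eq)
      show "vis BA w = vis BA ?w" by (simp only: w(2) pl(1))
      fix u assume u: "(u, c) \<in> vis BA w"
      then have "?w u \<in> real ` {..p}" using pl(2) w(2) by (auto simp: p_def)
      then obtain j where j: "j \<le> p" "?w u = real j" by auto
      have "w u = real j" using agree[OF u] j by simp
      then show "(w u \<le> w r \<longleftrightarrow> ?w u \<le> ?w r) \<and> (w r \<le> w u \<longleftrightarrow> ?w r \<le> ?w u)"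
        using cmp[OF j(1)] unfolding pl(3) j(2) p_def by simp
    qed
    then have "R = (\<lambda>(m, i). vis B (place R0 m i)) (m, i)" using w by simp
    then show "R \<in> (\<lambda>(m, i). vis B (place R0 m i)) ` slots (depth R0 c)"
      using mi unfolding p_def by (rule image_eqI)
  qed
qed

lemma depth_poly_pendant:
  assumes "s > 0"
  shows "depth_poly (insert r UA) B r s = smult s (attach_root ((s - 1) / s\<^sup>2) (depth_poly UA BA c s))"
proof -
  let ?P = "[:1, s:]" and ?x = "(s - 1) / s\<^sup>2" and ?t = "s - 2"
  define F where "F = (\<lambda>R. smult (?t ^ face_dim (insert r UA) R) (?P ^ depth R r))"
  have fiber: "(\<Sum>R\<in>{R \<in> Vis B. R \<inter> UA \<times> UA = R0}. F R) =
      smult (?t ^ face_dim UA R0) (smult s (attach_root ?x (?P ^ depth R0 c)))"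
    if R: "R0 \<in> Vis BA" for R0
  proof -
    let ?p = "depth R0 c"
    have "(\<Sum>R\<in>{R \<in> Vis B. R \<inter> UA \<times> UA = R0}. F R) =
        (\<Sum>(m, i)\<in>slots ?p. F (vis B (place R0 m i)))"
      using sum.reindex_bij_betw[OF place_bij[OF R], of F] by (simp add: case_prod_unfold)
    also have "\<dots> = (\<Sum>(m, i)\<in>slots ?p. smult (?t ^ face_dim UA R0) (smult (?t ^ (if m then 1 else 0)) (?P ^ i)))"
    proof (rule sum.cong[OF refl], clarify)
      fix m i assume "(m, i) \<in> slots ?p"
      then show "F (vis B (place R0 m i)) = smult (?t ^ face_dim UA R0) (smult (?t ^ (if m then 1 else 0)) (?P ^ i))"
        unfolding F_def using place(4,5)[OF R] by (simp only: power_add smult_smult)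
    qed
    also have "\<dots> = smult (?t ^ face_dim UA R0) (\<Sum>(m, i)\<in>slots ?p. smult (?t ^ (if m then 1 else 0)) (?P ^ i))"
      by (simp only: smult_sum_distrib case_prod_unfold)
    also have "(\<Sum>(m, i)\<in>slots ?p. smult (?t ^ (if m then 1 else 0)) (?P ^ i)) =
        (\<Sum>i\<le>Suc ?p. ?P ^ i) + smult ?t (\<Sum>i\<le>?p. ?P ^ i)"
      unfolding slots_def
      by (subst sum.union_disjoint)
        (simp_all add: sum.cartesian_product[symmetric] smult_sum_distrib del: sum.atMost_Suc, auto)
    also have "\<dots> = smult s (attach_root ?x (?P ^ ?p))"
      using attach_root_power[of s ?x ?p] assms by simp
    finally show ?thesis .
  qed
  have "depth_poly (insert r UA) B r s = (\<Sum>R\<in>Vis B. F R)" by (simp add: depth_poly_def F_def)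
  also have "\<dots> = (\<Sum>R0\<in>Vis BA. \<Sum>R\<in>{R \<in> Vis B. R \<inter> UA \<times> UA = R0}. F R)"
  proof (rule sum.group[symmetric])
    show "(\<lambda>R. R \<inter> UA \<times> UA) ` Vis B \<subseteq> Vis BA"
      by (auto simp: Vis_def restrict_A)
  qed (simp_all add: A.finite_Vis G.finite_Vis)
  also have "\<dots> = (\<Sum>R0\<in>Vis BA. smult (?t ^ face_dim UA R0) (smult s (attach_root ?x (?P ^ depth R0 c))))"
    by (rule sum.cong[OF refl]) (rule fiber)
  also have "\<dots> = smult s (attach_root ?x (depth_poly UA BA c s))"
    unfolding depth_poly_def attach_root_sum attach_root_smult smult_sum_distrib
    by (simp only: smult_smult mult.commute)
  finally show ?thesis .
qed

lemma gamma_spec_pendant: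
  assumes "gamma_spec UA BA c \<alpha>"
  shows "gamma_spec (insert r UA) B r (attach_root [:0, 1:] \<alpha>)"
  unfolding gamma_spec_def
proof (intro allI impI)
  fix s :: real assume s: "s > 1"
  have "card UA > 0" using c_in A.fin by (auto simp: card_gt_0_iff)
  then have "card (insert r UA) - 1 = Suc (card UA - 1)" using r_out A.fin by simp
  then show "depth_poly (insert r UA) B r s =
      smult (s ^ (card (insert r UA) - 1)) (map_poly (eval_nat ((s - 1) / s\<^sup>2)) (attach_root [:0, 1:] \<alpha>))"
    using assms s unfolding gamma_spec_def
    by (simp add: depth_poly_pendant map_eval_nat_attach_root eval_nat_hom(5)[unfolded One_nat_def] attach_root_smult)
qed

end

section \<open>Faces of the nestohedron\<close>

definition top_of :: "('v \<Rightarrow> real) \<Rightarrow> 'v set \<Rightarrow> 'v set" where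
  "top_of w I = {i \<in> I. \<forall>j\<in>I. w j \<le> w i}"

lemma top_of_nonempty:
  assumes "I \<noteq> {}" "finite I"
  shows "top_of w I \<noteq> {}"
proof -
  have "Max (w ` I) \<in> w ` I" using assms by (intro Max_in) auto
  then obtain i where "i \<in> I" "w i = Max (w ` I)" by auto
  then have "i \<in> top_of w I" using assms by (simp add: top_of_def)
  then show ?thesis by blast
qed

lemma vec_axis_expansion: "x = (\<Sum>i\<in>UNIV. (x $ i) *\<^sub>R axis i (1::real))"
  by (simp add: vec_eq_iff axis_def if_distrib cong: if_cong)

lemma simplex_on_iff:
  fixes I :: "'v::finite set"
  shows "x \<in> simplex_on I \<longleftrightarrow> (\<forall>i. 0 \<le> x $ i) \<and> (\<forall>i. i \<notin> I \<longrightarrow> x $ i = 0) \<and> (\<Sum>i\<in>UNIV. x $ i) = 1"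
    (is "_ \<longleftrightarrow> ?S x")
proof
  have "simplex_on I \<subseteq> {x. ?S x}"
    unfolding simplex_on_def
  proof (rule hull_minimal)
    show "(\<lambda>i. axis i 1) ` I \<subseteq> {x. ?S x}" by (auto simp: axis_def)
    show "convex {x. ?S x}"
      by (auto simp: convex_def sum.distrib sum_distrib_left[symmetric])
  qed
  then show "x \<in> simplex_on I \<Longrightarrow> ?S x" by blast
next
  assume S: "?S x"
  have "x = (\<Sum>i\<in>UNIV. (x $ i) *\<^sub>R axis i 1)" by (rule vec_axis_expansion)
  also have "\<dots> = (\<Sum>i\<in>I. (x $ i) *\<^sub>R axis i 1)"
    by (rule sum.mono_neutral_right) (use S in auto)
  also have "\<dots> \<in> simplex_on I" unfolding simplex_on_def
  proof (rule convex_sum)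
    have "(\<Sum>i\<in>I. x $ i) = (\<Sum>i\<in>UNIV. x $ i)" by (rule sum.mono_neutral_left) (use S in auto)
    then show "(\<Sum>i\<in>I. x $ i) = 1" using S by simp
  qed (use S in \<open>auto intro: hull_inc\<close>)
  finally show "x \<in> simplex_on I" .
qed

lemma axis_in_simplex: "i \<in> I \<Longrightarrow> axis i 1 \<in> simplex_on I"
  unfolding simplex_on_def by (rule hull_inc) auto

lemma inner_weights: "(\<chi> i. w i) \<bullet> x = (\<Sum>i\<in>UNIV. w i * x $ i)" for x :: "real^'v::finite"
  by (simp add: inner_vec_def)

lemma simplex_top:
  fixes I :: "'v::finite set"
  assumes "I \<noteq> {}"
  obtains m where "\<And>x. x \<in> simplex_on I \<Longrightarrow> (\<chi> i. w i) \<bullet> x \<le> m"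
    "simplex_on (top_of w I) = {x \<in> simplex_on I. (\<chi> i. w i) \<bullet> x = m}"
proof -
  obtain i0 where i0: "i0 \<in> top_of w I" using top_of_nonempty[of I w] assms by auto
  define m where "m = w i0"
  have wm: "w i \<le> m" "i \<in> top_of w I \<longleftrightarrow> w i = m" if "i \<in> I" for i
    using i0 that by (auto simp: top_of_def m_def intro: antisym)
  have diff: "m - (\<chi> i. w i) \<bullet> x = (\<Sum>i\<in>UNIV. (m - w i) * x $ i)" if "x \<in> simplex_on I" for x
    using that by (simp add: simplex_on_iff inner_weights left_diff_distrib sum_subtractf sum_distrib_left[symmetric])
  have nn: "0 \<le> (m - w i) * x $ i" if "x \<in> simplex_on I" for x i
    using that wm(1)[of i] by (cases "i \<in> I") (auto simp: simplex_on_iff)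
  show thesis
  proof (rule that[of m])
    fix x assume x: "x \<in> simplex_on I"
    have "0 \<le> (\<Sum>i\<in>UNIV. (m - w i) * x $ i)" by (rule sum_nonneg) (rule nn[OF x])
    then show "(\<chi> i. w i) \<bullet> x \<le> m" using diff[OF x] by simp
  next
    have sub: "top_of w I \<subseteq> I" by (auto simp: top_of_def)
    show "simplex_on (top_of w I) = {x \<in> simplex_on I. (\<chi> i. w i) \<bullet> x = m}"
    proof (intro set_eqI iffI)
      fix x assume x: "x \<in> simplex_on (top_of w I)"
      then have xI: "x \<in> simplex_on I" using sub by (auto simp: simplex_on_iff)
      have "(m - w i) * x $ i = 0" for i
        using x wm(2)[of i] sub by (cases "i \<in> top_of w I") (auto simp: simplex_on_iff)
      then have "(\<Sum>i\<in>UNIV. (m - w i) * x $ i) = 0" by (intro sum.neutral ballI)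
      then have "m - (\<chi> i. w i) \<bullet> x = 0" unfolding diff[OF xI] .
      then show "x \<in> {x \<in> simplex_on I. (\<chi> i. w i) \<bullet> x = m}" using xI by simp
    next
      fix x assume "x \<in> {x \<in> simplex_on I. (\<chi> i. w i) \<bullet> x = m}"
      then have xI: "x \<in> simplex_on I" and "(\<Sum>i\<in>UNIV. (m - w i) * x $ i) = 0" using diff[of x] by auto
      then have z: "(m - w i) * x $ i = 0" for i
        using sum_nonneg_eq_0_iff[of UNIV "\<lambda>i. (m - w i) * x $ i"] nn[OF xI] by simp
      have "x $ i = 0" if "i \<notin> top_of w I" for i
        using z[of i] wm(2)[of i] that xI by (cases "i \<in> I") (auto simp: simplex_on_iff)
      then show "x \<in> simplex_on (top_of w I)" using xI by (simp add: simplex_on_iff)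
    qed
  qed
qed

text \<open>
  The bounds on the summands add up to the bound on the sum, and this bound is attained only
  if all of them are.
\<close>

lemma set_sum_face:
  fixes a :: "'a::euclidean_space"
  assumes "finite B" "\<And>I x. I \<in> B \<Longrightarrow> x \<in> K I \<Longrightarrow> a \<bullet> x \<le> m I"
  shows "(\<Sum>I\<in>B. {x \<in> K I. a \<bullet> x = m I}) = (\<Sum>I\<in>B. K I) \<inter> {x. a \<bullet> x = (\<Sum>I\<in>B. m I)}"
    and "x \<in> (\<Sum>I\<in>B. K I) \<Longrightarrow> a \<bullet> x \<le> (\<Sum>I\<in>B. m I)"
proof -
  show "a \<bullet> x \<le> (\<Sum>I\<in>B. m I)" if "x \<in> (\<Sum>I\<in>B. K I)"
  proof -
    obtain s where "x = sum s B" "\<forall>I\<in>B. s I \<in> K I" using \<open>x \<in> _\<close> by (auto simp: set_sum_alt[OF assms(1)])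
    then show ?thesis using assms(2) by (auto simp: inner_sum_right intro!: sum_mono)
  qed
  show "(\<Sum>I\<in>B. {x \<in> K I. a \<bullet> x = m I}) = (\<Sum>I\<in>B. K I) \<inter> {x. a \<bullet> x = (\<Sum>I\<in>B. m I)}"
  proof (intro set_eqI iffI)
    fix x assume "x \<in> (\<Sum>I\<in>B. {x \<in> K I. a \<bullet> x = m I})"
    then obtain s where "x = sum s B" "\<forall>I\<in>B. s I \<in> K I \<and> a \<bullet> s I = m I" by (auto simp: set_sum_alt[OF assms(1)])
    then show "x \<in> (\<Sum>I\<in>B. K I) \<inter> {x. a \<bullet> x = (\<Sum>I\<in>B. m I)}"
      by (auto simp: set_sum_alt[OF assms(1)] inner_sum_right)
  next
    fix x assume "x \<in> (\<Sum>I\<in>B. K I) \<inter> {x. a \<bullet> x = (\<Sum>I\<in>B. m I)}"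
    then obtain s where s: "x = sum s B" "\<forall>I\<in>B. s I \<in> K I" "a \<bullet> sum s B = sum m B"
      by (auto simp: set_sum_alt[OF assms(1)])
    have "a \<bullet> s I = m I" if "I \<in> B" for I
      using sum_mono_inv[of "\<lambda>I. a \<bullet> s I" B m I] s assms that by (auto simp: inner_sum_right)
    then show "x \<in> (\<Sum>I\<in>B. {x \<in> K I. a \<bullet> x = m I})"
      using s by (auto simp: set_sum_alt[OF assms(1)])
  qed
qed

definition top_face :: "'v::finite set set \<Rightarrow> ('v \<Rightarrow> real) \<Rightarrow> (real^'v) set" where
  "top_face B w = (\<Sum>I\<in>B. simplex_on (top_of w I))"

lemma top_face_supporting:
  fixes B :: "'v::finite set set"
  assumes "{} \<notin> B"
  obtains m where "\<And>x. x \<in> nestohedron B \<Longrightarrow> (\<chi> i. w i) \<bullet> x \<le> m"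
    "top_face B w = nestohedron B \<inter> {x. (\<chi> i. w i) \<bullet> x = m}"
proof -
  let ?a = "\<chi> i. w i"
  have "\<forall>I\<in>B. \<exists>m. (\<forall>x\<in>simplex_on I. ?a \<bullet> x \<le> m) \<and> simplex_on (top_of w I) = {x \<in> simplex_on I. ?a \<bullet> x = m}"
  proof
    fix I assume "I \<in> B"
    then have "I \<noteq> {}" using assms by auto
    then obtain m where "\<And>x. x \<in> simplex_on I \<Longrightarrow> ?a \<bullet> x \<le> m"
        "simplex_on (top_of w I) = {x \<in> simplex_on I. ?a \<bullet> x = m}"
      using simplex_top[of I w] by blast
    then show "\<exists>m. (\<forall>x\<in>simplex_on I. ?a \<bullet> x \<le> m) \<and> simplex_on (top_of w I) = {x \<in> simplex_on I. ?a \<bullet> x = m}" by blast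
  qed
  then obtain m where m: "\<And>I. I \<in> B \<Longrightarrow> (\<forall>x\<in>simplex_on I. ?a \<bullet> x \<le> m I) \<and> simplex_on (top_of w I) = {x \<in> simplex_on I. ?a \<bullet> x = m I}"
    by metis
  have "top_face B w = (\<Sum>I\<in>B. {x \<in> simplex_on I. ?a \<bullet> x = m I})"
    unfolding top_face_def by (rule sum.cong) (use m in auto)
  then show thesis
    using that[of "sum m B"] set_sum_face[of B simplex_on ?a m] m unfolding nestohedron_def by simp
qed

lemma polytope_nestohedron: "polytope (nestohedron B)" for B :: "'v::finite set set"
proof -
  have "finite (\<Sum>I\<in>A. (\<lambda>i. axis i (1::real)) ` I)" for A :: "'v set set"
    by (induction A rule: infinite_finite_induct) (auto simp: finite_set_plus)
  then show ?thesis
    unfolding polytope_def nestohedron_def simplex_on_def convex_hull_set_sum[symmetric] by blast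
qed

lemma top_face_nonempty:
  fixes B :: "'v::finite set set"
  assumes "\<And>I. I \<in> B \<Longrightarrow> s I \<in> top_of w I"
  shows "(\<Sum>I\<in>B. axis (s I) 1) \<in> top_face B w"
  unfolding top_face_def set_sum_alt[OF finite[of B]]
  using assms by (auto intro!: exI[of _ "\<lambda>I. axis (s I) 1"] axis_in_simplex)

text \<open>
  Every face of a polytope is exposed by some functional, and the face exposed by
  \<open>w\<close> is \<open>top_face B w\<close>.
\<close>

lemma nonempty_faces:
  fixes B :: "'v::finite set set"
  assumes "{} \<notin> B"
  shows "{A. A face_of nestohedron B \<and> A \<noteq> {}} = range (top_face B)"
proof (intro set_eqI iffI)
  fix A assume "A \<in> {A. A face_of nestohedron B \<and> A \<noteq> {}}"
  then have A: "A exposed_face_of nestohedron B" "A \<noteq> {}"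
    using exposed_face_of_polyhedron[OF polytope_imp_polyhedron[OF polytope_nestohedron[of B]]] by auto
  then obtain a b where ab: "nestohedron B \<subseteq> {x. a \<bullet> x \<le> b}" "A = nestohedron B \<inter> {x. a \<bullet> x = b}"
    unfolding exposed_face_of_def by blast
  have a: "(\<chi> i. a $ i) = a" by simp
  obtain m where m: "\<And>x. x \<in> nestohedron B \<Longrightarrow> a \<bullet> x \<le> m"
    "top_face B (\<lambda>i. a $ i) = nestohedron B \<inter> {x. a \<bullet> x = m}"
    using top_face_supporting[OF assms, of "\<lambda>i. a $ i"] unfolding a by blast
  have "\<forall>I\<in>B. \<exists>i. i \<in> top_of (\<lambda>i. a $ i) I" using top_of_nonempty assms by (metis equals0I finite)
  then obtain s where "\<And>I. I \<in> B \<Longrightarrow> s I \<in> top_of (\<lambda>i. a $ i) I" by metis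
  then have "top_face B (\<lambda>i. a $ i) \<noteq> {}" using top_face_nonempty[of B s] by blast
  then obtain y where "y \<in> nestohedron B" "a \<bullet> y = m" using m(2) by blast
  moreover obtain z where "z \<in> nestohedron B" "a \<bullet> z = b" using A(2) ab(2) by blast
  ultimately have "b = m" using m(1)[of z] ab(1) by fastforce
  then show "A \<in> range (top_face B)" using ab(2) m(2) by (intro image_eqI[of _ _ "\<lambda>i. a $ i"]) auto
next
  fix A assume "A \<in> range (top_face B)"
  then obtain w where A: "A = top_face B w" by blast
  obtain m where m: "\<And>x. x \<in> nestohedron B \<Longrightarrow> (\<chi> i. w i) \<bullet> x \<le> m"
    "top_face B w = nestohedron B \<inter> {x. (\<chi> i. w i) \<bullet> x = m}"
    using top_face_supporting[OF assms, of w] by blast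
  have "convex (nestohedron B)" using polytope_nestohedron polytope_imp_convex by blast
  then have "A face_of nestohedron B" unfolding A m(2) using m(1) by (rule face_of_Int_supporting_hyperplane_le)
  moreover have "\<forall>I\<in>B. \<exists>i. i \<in> top_of w I" using top_of_nonempty assms by (metis equals0I finite)
  then obtain s where "\<And>I. I \<in> B \<Longrightarrow> s I \<in> top_of w I" by metis
  then have "A \<noteq> {}" using top_face_nonempty[of B s] A by blast
  ultimately show "A \<in> {A. A face_of nestohedron B \<and> A \<noteq> {}}" by blast
qed

text \<open>
  The summands of a face are determined by the face: if the face of \<open>w\<close> contains
  a sum of vertices \<open>e\<^sub>s\<close>, then \<open>w\<close> is maximal on each summand
  at the chosen vertex.
\<close>

lemma top_face_eq_imp:
  fixes B :: "'v::finite set set"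
  assumes "{} \<notin> B" "top_face B w = top_face B w'" "I \<in> B"
  shows "top_of w' I \<subseteq> top_of w I"
proof
  fix i assume i: "i \<in> top_of w' I"
  let ?a = "\<chi> i. w i"
  have "\<forall>J\<in>B. \<exists>j. j \<in> top_of w' J" using top_of_nonempty assms by (metis equals0I finite)
  then obtain s0 where s0: "\<And>J. J \<in> B \<Longrightarrow> s0 J \<in> top_of w' J" by metis
  define s where "s = s0(I := i)"
  have s: "s J \<in> top_of w' J" if "J \<in> B" for J using that s0 i by (simp add: s_def)
  have "\<forall>J\<in>B. \<exists>m. (\<forall>x\<in>simplex_on J. ?a \<bullet> x \<le> m) \<and> simplex_on (top_of w J) = {x \<in> simplex_on J. ?a \<bullet> x = m}"
  proof
    fix J assume "J \<in> B"
    then have "J \<noteq> {}" using assms by auto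
    then obtain m where "\<And>x. x \<in> simplex_on J \<Longrightarrow> ?a \<bullet> x \<le> m"
        "simplex_on (top_of w J) = {x \<in> simplex_on J. ?a \<bullet> x = m}"
      using simplex_top[of J w] by blast
    then show "\<exists>m. (\<forall>x\<in>simplex_on J. ?a \<bullet> x \<le> m) \<and> simplex_on (top_of w J) = {x \<in> simplex_on J. ?a \<bullet> x = m}" by blast
  qed
  then obtain m where m: "\<And>J. J \<in> B \<Longrightarrow> (\<forall>x\<in>simplex_on J. ?a \<bullet> x \<le> m J) \<and> simplex_on (top_of w J) = {x \<in> simplex_on J. ?a \<bullet> x = m J}"
    by metis
  have "top_face B w = (\<Sum>J\<in>B. {x \<in> simplex_on J. ?a \<bullet> x = m J})"
    unfolding top_face_def by (rule sum.cong) (use m in auto)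
  then have F: "top_face B w = (\<Sum>J\<in>B. simplex_on J) \<inter> {x. ?a \<bullet> x = (\<Sum>J\<in>B. m J)}"
    using set_sum_face(1)[of B simplex_on ?a m] m by simp
  have "(\<Sum>J\<in>B. axis (s J) 1) \<in> top_face B w" unfolding assms(2) by (rule top_face_nonempty) (rule s)
  then have "(\<Sum>J\<in>B. ?a \<bullet> axis (s J) 1) = (\<Sum>J\<in>B. m J)" unfolding F by (simp add: inner_sum_right)
  moreover have ax: "axis (s J) 1 \<in> simplex_on J" if "J \<in> B" for J
    using s[OF that] by (intro axis_in_simplex) (simp add: top_of_def)
  ultimately have "?a \<bullet> axis (s I) 1 = m I"
    using m ax assms(3) by (intro sum_mono_inv[of "\<lambda>J. ?a \<bullet> axis (s J) 1" B m I]) auto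
  then have "axis (s I) 1 \<in> simplex_on (top_of w I)" using m ax assms(3) by auto
  then have "axis i (1::real) \<in> simplex_on (top_of w I)" by (simp add: s_def)
  then show "i \<in> top_of w I" unfolding simplex_on_iff by (metis axis_nth zero_neq_one)
qed

lemma simplex_difference_span:
  fixes J :: "'v::finite set"
  assumes "x \<in> simplex_on J" "y \<in> simplex_on J"
    and D: "\<And>i j. i \<in> J \<Longrightarrow> j \<in> J \<Longrightarrow> axis i (1::real) - axis j 1 \<in> span D"
  shows "x - y \<in> span D"
proof -
  have "\<exists>j. j \<in> J" using assms(1) by (auto simp: simplex_on_iff) (metis sum.neutral zero_neq_one)
  then obtain j where j: "j \<in> J" by blast
  have *: "x - axis j 1 \<in> span D" if "x \<in> simplex_on J" for x
  proof -
    have s: "(\<Sum>i\<in>UNIV. x $ i) = 1" using that by (simp add: simplex_on_iff)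
    have "x - axis j 1 = (\<Sum>i\<in>UNIV. (x $ i) *\<^sub>R axis i 1) - (\<Sum>i\<in>UNIV. x $ i) *\<^sub>R axis j 1"
      unfolding s by (simp flip: vec_axis_expansion)
    also have "\<dots> = (\<Sum>i\<in>UNIV. (x $ i) *\<^sub>R (axis i 1 - axis j 1))"
      by (simp add: scaleR_sum_left sum_subtractf scaleR_diff_right)
    also have "\<dots> \<in> span D"
    proof (rule span_sum)
      fix i
      show "(x $ i) *\<^sub>R (axis i 1 - axis j 1) \<in> span D"
        using that D[OF _ j, of i] by (cases "i \<in> J") (auto simp: simplex_on_iff span_scale span_zero)
    qed
    finally show ?thesis .
  qed
  have "x - y = (x - axis j 1) - (y - axis j 1)" by simp
  then show ?thesis using *[OF assms(1)] *[OF assms(2)] span_diff by metis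
qed

locale nested = building B "UNIV :: 'v set" for B :: "'v::finite set set" +
  assumes whole: "UNIV \<in> B"
begin

lemma top_of_vis: "I \<in> B \<Longrightarrow> top_of w I = {u \<in> I. \<forall>v\<in>I. (u, v) \<in> vis B w}"
  unfolding top_of_def using vis_le by (auto intro: visI[of I])

lemma vis_top_of: "(u, v) \<in> vis B w \<longleftrightarrow> (\<exists>I\<in>B. u \<in> top_of w I \<and> v \<in> I)"
  unfolding vis_def top_of_def by auto

lemma top_face_eq_iff: "top_face B w = top_face B w' \<longleftrightarrow> vis B w = vis B w'"
proof
  assume eq: "top_face B w = top_face B w'"
  have "top_of w I = top_of w' I" if "I \<in> B" for I
    using top_face_eq_imp[OF ne eq that] top_face_eq_imp[OF ne eq[symmetric] that] by blast
  then show "vis B w = vis B w'" by (auto simp: vis_top_of)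
next
  assume "vis B w = vis B w'"
  then show "top_face B w = top_face B w'"
    unfolding top_face_def by (intro sum.cong refl) (simp add: top_of_vis)
qed

text \<open>
  Directions of the edges of the summands; they span the direction space of the face.
\<close>

definition face_dirs :: "('v \<Rightarrow> real) \<Rightarrow> (real^'v) set" where
  "face_dirs w = {axis u 1 - axis v 1 | u v. (u, v) \<in> vis B w \<and> (v, u) \<in> vis B w}"

text \<open>
  A basis consists of the differences between each vertex and a fixed representative of its
  class.
\<close>

lemma dim_face_dirs: "dim (face_dirs w) = face_dim UNIV (vis B w)"
proof -
  let ?R = "vis B w"
  define r where "r = (\<lambda>u. SOME v. v \<in> tie_class ?R u)"
  have rcl: "r u \<in> tie_class ?R u" for u
    unfolding r_def by (rule someI[of _ u]) (simp add: tie_class_def vis_refl)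
  have r_eq: "r u = r v" if "(u, v) \<in> ?R" "(v, u) \<in> ?R" for u v
    using tie_class_eq_iff[of u v w] that by (simp add: r_def)
  have rr: "r (r u) = r u" for u using r_eq[of u "r u"] rcl[of u] by (simp add: tie_class_def)
  define N where "N = {u. r u \<noteq> u}"
  define f where "f = (\<lambda>u. axis u (1::real) - axis (r u) 1)"
  have coord: "f u $ v = (if u = v then 1 else 0)" if "v \<in> N" for u v
  proof -
    have "r u \<noteq> v" using that rr[of u] by (auto simp: N_def)
    then show ?thesis by (auto simp: f_def axis_def)
  qed
  have inj: "inj_on f N"
  proof (rule inj_onI)
    fix u v assume "u \<in> N" "v \<in> N" "f u = f v"
    then show "u = v" using coord[of v u] coord[of v v] by (auto split: if_splits)
  qed
  have ind: "independent (f ` N)"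
  proof
    assume "dependent (f ` N)"
    then obtain k where k: "\<exists>v\<in>f ` N. k v \<noteq> 0" "(\<Sum>v\<in>f ` N. k v *\<^sub>R v) = 0"
      by (auto simp: dependent_finite)
    then obtain u where u: "u \<in> N" "k (f u) \<noteq> 0" by auto
    have "0 = (\<Sum>v\<in>N. k (f v) *\<^sub>R f v) $ u" using k(2) by (simp add: sum.reindex[OF inj])
    also have "\<dots> = (\<Sum>v\<in>N. k (f v) * f v $ u)" by (simp add: sum_component)
    also have "\<dots> = (\<Sum>v\<in>N. if v = u then k (f v) else 0)"
      unfolding coord[OF u(1)] by (intro sum.cong) auto
    also have "\<dots> = k (f u)" using u by simp
    finally show False using u by simp
  qed
  have "span (f ` N) = span (face_dirs w)"
    unfolding span_eq
  proof (rule conjI)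
    show "f ` N \<subseteq> span (face_dirs w)"
    proof clarify
      fix u
      have "f u \<in> face_dirs w" unfolding f_def face_dirs_def using rcl[of u] by (auto simp: tie_class_def)
      then show "f u \<in> span (face_dirs w)" by (rule span_base)
    qed
    have fs: "f u \<in> span (f ` N)" for u
    proof (cases "u \<in> N")
      case True then show ?thesis by (auto intro: span_base)
    next
      case False then have "f u = 0" by (simp add: N_def f_def)
      then show ?thesis by (simp add: span_zero)
    qed
    show "face_dirs w \<subseteq> span (f ` N)"
    proof
      fix d assume "d \<in> face_dirs w"
      then obtain u v where uv: "d = axis u 1 - axis v 1" "(u, v) \<in> ?R" "(v, u) \<in> ?R" by (auto simp: face_dirs_def)
      have "d = f u - f v" unfolding f_def uv(1) r_eq[OF uv(2,3)] by simp
      then show "d \<in> span (f ` N)" using fs span_diff by metis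
    qed
  qed
  then have "dim (face_dirs w) = dim (f ` N)" by (metis dim_span)
  also have "\<dots> = card N" using ind inj by (simp add: dim_eq_card_independent card_image)
  also have "card N = card (UNIV :: 'v set) - card {u. r u = u}"
  proof -
    have "N = UNIV - {u. r u = u}" by (auto simp: N_def)
    then show ?thesis by (simp add: card_Diff_subset)
  qed
  also have "card {u. r u = u} = card (tie_class ?R ` UNIV)"
  proof -
    have "tie_class ?R ` UNIV = tie_class ?R ` {u. r u = u}"
    proof -
      have "tie_class ?R u = tie_class ?R (r u)" for u using tie_class_eq_iff[of u "r u" w] rcl[of u] by (simp add: tie_class_def)
      then show ?thesis using rr by blast
    qed
    moreover have "inj_on (tie_class ?R) {u. r u = u}"
    proof (rule inj_onI)
      fix u v assume uv: "u \<in> {u. r u = u}" "v \<in> {u. r u = u}" and eq: "tie_class ?R u = tie_class ?R v"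
      have "r u = r v" by (simp only: r_def eq)
      then show "u = v" using uv by simp
    qed
    ultimately show ?thesis by (simp add: card_image)
  qed
  finally show ?thesis by (simp add: face_dim_def)
qed

lemma aff_dim_top_face: "aff_dim (top_face B w) = int (face_dim UNIV (vis B w))"
proof -
  have "\<forall>I\<in>B. \<exists>i. i \<in> top_of w I" using top_of_nonempty ne by (metis equals0I finite)
  then obtain s where s: "\<And>I. I \<in> B \<Longrightarrow> s I \<in> top_of w I" by metis
  define x0 where "x0 = (\<Sum>I\<in>B. axis (s I) (1::real))"
  have x0: "x0 \<in> top_face B w" unfolding x0_def by (rule top_face_nonempty) (rule s)
  have mutual: "axis i (1::real) - axis j 1 \<in> span (face_dirs w)" if "I \<in> B" "i \<in> top_of w I" "j \<in> top_of w I" for I i j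
  proof (rule span_base)
    have "i \<in> I" "j \<in> I" using that by (auto simp: top_of_def)
    then have "(i, j) \<in> vis B w" "(j, i) \<in> vis B w" using that vis_top_of by blast+
    then show "axis i 1 - axis j 1 \<in> face_dirs w" by (auto simp: face_dirs_def)
  qed
  have "span ((+) (- x0) ` top_face B w) = span (face_dirs w)"
    unfolding span_eq
  proof (rule conjI)
    show "(+) (- x0) ` top_face B w \<subseteq> span (face_dirs w)"
    proof clarify
      fix x assume "x \<in> top_face B w"
      then obtain p where p: "x = sum p B" "\<forall>I\<in>B. p I \<in> simplex_on (top_of w I)"
        unfolding top_face_def set_sum_alt[OF finite[of B]] by blast
      have "- x0 + x = (\<Sum>I\<in>B. p I - axis (s I) 1)" by (simp add: p x0_def sum_subtractf)
      also have "\<dots> \<in> span (face_dirs w)"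
      proof (rule span_sum)
        fix I assume I: "I \<in> B"
        show "p I - axis (s I) 1 \<in> span (face_dirs w)"
        proof (rule simplex_difference_span)
          show "p I \<in> simplex_on (top_of w I)" using p(2) I by blast
          show "axis (s I) 1 \<in> simplex_on (top_of w I)" by (rule axis_in_simplex[OF s[OF I]])
        qed (rule mutual[OF I])
      qed
      finally show "- x0 + x \<in> span (face_dirs w)" .
    qed
    show "face_dirs w \<subseteq> span ((+) (- x0) ` top_face B w)"
    proof
      fix d assume "d \<in> face_dirs w"
      then obtain u v where uv: "d = axis u 1 - axis v 1" "(u, v) \<in> vis B w" "(v, u) \<in> vis B w" by (auto simp: face_dirs_def)
      obtain I where I: "I \<in> B" "u \<in> top_of w I" "v \<in> I" using uv(2) vis_top_of by blast
      have "w x \<le> w v" if "x \<in> I" for x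
      proof -
        have "w x \<le> w u" using I(2) that by (simp add: top_of_def)
        then show ?thesis using vis_le[OF uv(3)] by (rule order_trans)
      qed
      then have "v \<in> top_of w I" using I(3) by (simp add: top_of_def)
      then have st: "(s(I := z)) J \<in> top_of w J" if "z \<in> {u, v}" "J \<in> B" for z J
        using that s[of J] I(2) by auto
      have P: "(\<Sum>J\<in>B. axis ((s(I := z)) J) (1::real)) \<in> top_face B w" if "z \<in> {u, v}" for z
        by (rule top_face_nonempty) (rule st[OF that])
      have sz: "(\<Sum>J\<in>B. axis ((s(I := z)) J) (1::real)) = axis z 1 + (\<Sum>J\<in>B - {I}. axis (s J) 1)" for z
        using I(1) by (subst sum.remove[of B I]) (auto intro!: sum.cong)
      have "d = (- x0 + (\<Sum>J\<in>B. axis ((s(I := u)) J) 1)) - (- x0 + (\<Sum>J\<in>B. axis ((s(I := v)) J) 1))"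
        unfolding sz uv(1) by simp
      also have "\<dots> \<in> span ((+) (- x0) ` top_face B w)"
        by (intro span_diff span_base imageI P) auto
      finally show "d \<in> span ((+) (- x0) ` top_face B w)" .
    qed
  qed
  then have "dim ((+) (- x0) ` top_face B w) = face_dim UNIV (vis B w)"
    using dim_face_dirs by (metis dim_span)
  then show ?thesis using aff_dim_eq_dim[of x0 "top_face B w"] hull_inc[OF x0] by metis
qed

lemma face_dim_bound: "face_dim UNIV (vis B w) \<le> CARD('v) - 1"
proof -
  have "card (tie_class (vis B w) ` UNIV) > 0" by (simp add: card_gt_0_iff)
  then show ?thesis unfolding face_dim_def by linarith
qed

lemma polytope_dim_nestohedron: "polytope_dim (nestohedron B) = CARD('v) - 1"
proof -
  let ?w = "\<lambda>_::'v. 0::real"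
  have "top_of ?w I = I" for I by (simp add: top_of_def)
  then have "top_face B ?w = nestohedron B" by (simp add: top_face_def nestohedron_def)
  then have "aff_dim (nestohedron B) = int (face_dim UNIV (vis B ?w))" using aff_dim_top_face[of ?w] by simp
  moreover have "tie_class (vis B ?w) u = UNIV" for u
    unfolding tie_class_def using whole by (auto intro!: visI[of UNIV])
  then have "tie_class (vis B ?w) ` UNIV = {UNIV}" by auto
  ultimately show ?thesis by (simp add: polytope_dim_def face_dim_def)
qed

lemma face_number_nestohedron: "face_number (nestohedron B) i = card {R \<in> Vis B. face_dim UNIV R = i}"
proof -
  define g where "g = (\<lambda>R. top_face B (SOME w. vis B w = R))"
  have g: "g (vis B w) = top_face B w" for w
  proof -
    have "vis B (SOME w'. vis B w' = vis B w) = vis B w" by (rule someI[of _ w]) simp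
    then show ?thesis unfolding g_def by (simp add: top_face_eq_iff)
  qed
  have "inj_on g (Vis B)" by (rule inj_onI) (auto simp: Vis_def g top_face_eq_iff)
  then have inj: "inj_on g {R \<in> Vis B. face_dim UNIV R = i}" by (rule inj_on_subset) auto
  have "{A. A face_of nestohedron B \<and> aff_dim A = int i} = {A \<in> range (top_face B). aff_dim A = int i}"
    unfolding nonempty_faces[OF ne, symmetric] by auto
  also have "\<dots> = g ` {R \<in> Vis B. face_dim UNIV R = i}"
  proof (intro set_eqI iffI)
    fix A assume "A \<in> {A \<in> range (top_face B). aff_dim A = int i}"
    then obtain w where "A = g (vis B w)" "face_dim UNIV (vis B w) = i" by (auto simp: g aff_dim_top_face)
    then show "A \<in> g ` {R \<in> Vis B. face_dim UNIV R = i}" by (auto simp: Vis_def)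
  qed (auto simp: Vis_def g aff_dim_top_face)
  finally show ?thesis unfolding face_number_def by (simp add: card_image[OF inj])
qed

lemma f_poly_nestohedron: "f_poly (nestohedron B) = (\<Sum>R\<in>Vis B. monom 1 (face_dim UNIV R))"
proof -
  let ?d = "CARD('v) - 1"
  have "(\<Sum>R\<in>Vis B. monom (1::int) (face_dim UNIV R)) = (\<Sum>i\<le>?d. \<Sum>R\<in>{R \<in> Vis B. face_dim UNIV R = i}. monom 1 (face_dim UNIV R))"
    by (rule sum.group[symmetric]) (use face_dim_bound in \<open>auto simp: finite_Vis Vis_def\<close>)
  also have "\<dots> = (\<Sum>i\<le>?d. monom (int (card {R \<in> Vis B. face_dim UNIV R = i})) i)"
  proof (rule sum.cong[OF refl])
    fix i
    have "(\<Sum>R\<in>{R \<in> Vis B. face_dim UNIV R = i}. monom 1 (face_dim UNIV R)) = (\<Sum>R\<in>{R \<in> Vis B. face_dim UNIV R = i}. monom (1::int) i)"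
      by (rule sum.cong) auto
    also have "\<dots> = monom (int (card {R \<in> Vis B. face_dim UNIV R = i})) i"
      by (simp add: of_nat_monom mult_monom flip: monom_0)
    finally show "(\<Sum>R\<in>{R \<in> Vis B. face_dim UNIV R = i}. monom (1::int) (face_dim UNIV R)) =
        monom (int (card {R \<in> Vis B. face_dim UNIV R = i})) i" .
  qed
  finally show ?thesis by (simp add: f_poly_def polytope_dim_nestohedron face_number_nestohedron)
qed

end

section \<open>From evaluations to the gamma-polynomial\<close>

definition eval_int :: "int poly \<Rightarrow> real \<Rightarrow> real" where
  "eval_int p y = poly (map_poly real_of_int p) y"

lemma eval_int_hom: "eval_int 0 y = 0" "eval_int 1 y = 1" "eval_int (p + q) y = eval_int p y + eval_int q y" "eval_int (p * q) y = eval_int p y * eval_int q y"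
  by (simp_all add: eval_int_def map_poly_hom_add map_poly_hom_mult)

lemma eval_int_power: "eval_int (p ^ k) y = eval_int p y ^ k"
  by (induction k) (simp_all add: eval_int_hom)

lemma eval_int_sum: "eval_int (\<Sum>i\<in>A. f i) y = (\<Sum>i\<in>A. eval_int (f i) y)"
  by (induction A rule: infinite_finite_induct) (simp_all add: eval_int_hom)

lemma eval_int_monom: "eval_int (monom a i) y = real_of_int a * y ^ i"
  by (simp add: eval_int_def map_poly_monom poly_monom)

lemma eval_int_linear: "eval_int [:a, 1:] y = real_of_int a + y"
  by (simp add: eval_int_def map_poly_pCons)

lemma eval_int_bound:
  assumes "degree g \<le> n"
  shows "eval_int g y = (\<Sum>i\<le>n. real_of_int (coeff g i) * y ^ i)"
proof -
  have "g = (\<Sum>i\<le>n. monom (coeff g i) i)" using assms by (rule poly_as_sum_of_monoms'[symmetric])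
  then have "eval_int g y = eval_int (\<Sum>i\<le>n. monom (coeff g i) i) y" by simp
  then show ?thesis by (simp add: eval_int_sum eval_int_monom)
qed

text \<open>
  Identities of polynomials are derived from identities of their values, because the
  gamma-expansion is a simple substitution only after dividing by a power of \<open>s\<close>.
\<close>

lemma real_poly_eqI:
  fixes p q :: "real poly"
  assumes "infinite X" "\<And>y. y \<in> X \<Longrightarrow> poly p y = poly q y"
  shows "p = q"
proof (rule ccontr)
  assume "p \<noteq> q"
  then have "finite {y. poly (p - q) y = 0}" by (intro poly_roots_finite) simp
  moreover have "X \<subseteq> {y. poly (p - q) y = 0}" using assms(2) by auto
  ultimately show False using assms(1) finite_subset by blast
qed

lemma int_poly_eqI:
  assumes "infinite X" "\<And>y. y \<in> X \<Longrightarrow> eval_int p y = eval_int q y"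
  shows "p = q"
proof -
  have "map_poly real_of_int p = map_poly real_of_int q"
    using assms by (intro real_poly_eqI[of X]) (auto simp: eval_int_def)
  then have "coeff (map_poly real_of_int p) i = coeff (map_poly real_of_int q) i" for i by simp
  then show ?thesis by (intro poly_eqI) (simp add: coeff_map_poly)
qed

lemma infinite_gamma_points: "infinite ((\<lambda>s::real. (s - 1) / s\<^sup>2) ` {1<..<2})"
proof -
  \<comment> \<open>Equal values at \<open>a\<close> and \<open>b\<close> force \<open>a = b\<close> or \<open>1 / a + 1 / b = 1\<close>, and the latter is impossible below 2.\<close>
  have "inj_on (\<lambda>s::real. (s - 1) / s\<^sup>2) {1<..<2}"
  proof (rule inj_onI)
    fix a b :: real assume ab: "a \<in> {1<..<2}" "b \<in> {1<..<2}" "(a - 1) / a\<^sup>2 = (b - 1) / b\<^sup>2"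
    then have "(a - 1) * b\<^sup>2 = (b - 1) * a\<^sup>2" by (simp add: frac_eq_eq)
    then have "(a - b) * (a + b - a * b) = 0" by (simp add: algebra_simps power2_eq_square)
    moreover have "a + b - a * b > 0"
    proof -
      have "(a - 1) * (b - 1) < 1 * 1" using ab by (intro mult_strict_mono) auto
      then show ?thesis by (simp add: algebra_simps)
    qed
    ultimately show "a = b" by simp
  qed
  then show ?thesis by (simp add: finite_image_iff)
qed

definition gamma_expansion :: "nat \<Rightarrow> int poly \<Rightarrow> int poly" where
  "gamma_expansion d g = (\<Sum>i\<le>d div 2. monom (coeff g i) i * [:1, 1:] ^ (d - 2 * i))"

lemma eval_int_gamma_expansion:
  assumes "degree g \<le> d div 2" "s > 1"
  shows "eval_int (gamma_expansion d g) (s - 1) = s ^ d * eval_int g ((s - 1) / s\<^sup>2)"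
proof -
  have "eval_int (gamma_expansion d g) (s - 1) = (\<Sum>i\<le>d div 2. real_of_int (coeff g i) * (s - 1) ^ i * s ^ (d - 2 * i))"
    by (simp add: gamma_expansion_def eval_int_sum eval_int_hom eval_int_power eval_int_monom eval_int_linear)
  also have "\<dots> = (\<Sum>i\<le>d div 2. s ^ d * (real_of_int (coeff g i) * ((s - 1) / s\<^sup>2) ^ i))"
  proof (rule sum.cong[OF refl])
    fix i assume "i \<in> {..d div 2}"
    then have "d = (d - 2 * i) + 2 * i" by auto
    then have "s ^ d = s ^ (d - 2 * i) * (s\<^sup>2) ^ i" by (metis power_add power_mult)
    then show "real_of_int (coeff g i) * (s - 1) ^ i * s ^ (d - 2 * i) = s ^ d * (real_of_int (coeff g i) * ((s - 1) / s\<^sup>2) ^ i)"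
      using assms(2) by (simp add: power_divide)
  qed
  also have "\<dots> = s ^ d * eval_int g ((s - 1) / s\<^sup>2)"
    by (simp add: eval_int_bound[OF assms(1)] sum_distrib_left)
  finally show ?thesis .
qed

text \<open>
  If the degree \<open>D\<close> of \<open>g\<close> were too large, then \<open>s ^ (2 * D -
  d) * h (s - 1) = \<Sum>i\<le>D. g\<^sub>i * (s - 1) ^ i * s ^ (2 * (D - i))\<close> with a
  positive exponent on the left, and \<open>s = 0\<close> shows that the leading coefficient
  vanishes.
\<close>

lemma gamma_degree_bound:
  assumes "\<And>s. s > 1 \<Longrightarrow> eval_int h (s - 1) = s ^ d * eval_int g ((s - 1) / s\<^sup>2)"
  shows "degree g \<le> d div 2"
proof (rule ccontr)
  assume "\<not> degree g \<le> d div 2"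
  define D where "D = degree g"
  have D: "2 * D > d" using \<open>\<not> degree g \<le> d div 2\<close> by (simp add: D_def)
  let ?L = "pcompose (map_poly real_of_int h) [:-1, 1:] * [:0, 1:] ^ (2 * D - d)"
  let ?R = "\<Sum>i\<le>D. smult (real_of_int (coeff g i)) ([:-1, 1:] ^ i * [:0, 1:] ^ (2 * (D - i)))"
  have "?L = ?R"
  proof (rule real_poly_eqI[of "{1<..<2}"])
    fix s :: real assume "s \<in> {1<..<2}"
    then have s: "s > 1" by simp
    have "poly ?L s = eval_int h (s - 1) * s ^ (2 * D - d)"
      by (simp add: poly_pcompose eval_int_def)
    also have "\<dots> = s ^ (2 * D) * eval_int g ((s - 1) / s\<^sup>2)"
    proof -
      have "s ^ (2 * D) = s ^ d * s ^ (2 * D - d)" using D by (simp flip: power_add)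
      then show ?thesis using assms[OF s] by simp
    qed
    also have "\<dots> = (\<Sum>i\<le>D. s ^ (2 * D) * (real_of_int (coeff g i) * ((s - 1) / s\<^sup>2) ^ i))"
      by (simp add: eval_int_bound[of g D] D_def sum_distrib_left)
    also have "\<dots> = (\<Sum>i\<le>D. real_of_int (coeff g i) * ((s - 1) ^ i * s ^ (2 * (D - i))))"
    proof (rule sum.cong[OF refl])
      fix i assume "i \<in> {..D}"
      then have "2 * D = 2 * (D - i) + 2 * i" by auto
      then have "s ^ (2 * D) = s ^ (2 * (D - i)) * (s\<^sup>2) ^ i" by (metis power_add power_mult)
      then show "s ^ (2 * D) * (real_of_int (coeff g i) * ((s - 1) / s\<^sup>2) ^ i) = real_of_int (coeff g i) * ((s - 1) ^ i * s ^ (2 * (D - i)))"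
        using s by (simp add: power_divide)
    qed
    also have "\<dots> = poly ?R s" by (simp add: poly_sum)
    finally show "poly ?L s = poly ?R s" .
  qed simp
  then have "poly ?L 0 = poly ?R 0" by simp
  moreover have "poly ?L 0 = 0" using D by simp
  moreover have "poly ?R 0 = (\<Sum>i\<le>D. if i = D then real_of_int (coeff g D) * (-1) ^ D else 0)"
    unfolding poly_sum by (rule sum.cong) (auto simp: zero_power)
  ultimately have "coeff g D = 0" by simp
  then show False using D by (simp add: D_def)
qed

lemma pcompose_power_monom: "pcompose (monom 1 k) q = q ^ k" for q :: "'a::comm_ring_1 poly"
  by (induction k) (simp_all add: monom_0 monom_Suc pcompose_pCons pcompose_1 flip: one_pCons)

context nested
begin

lemma eval_int_h_poly:
  assumes "gamma_spec UNIV B c \<alpha>" "s > 1"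
  shows "eval_int (h_poly (nestohedron B)) (s - 1) = s ^ (CARD('v) - 1) * eval_int (map_poly int (coeff \<alpha> 0)) ((s - 1) / s\<^sup>2)"
proof -
  have "h_poly (nestohedron B) = (\<Sum>R\<in>Vis B. [:-1, 1:] ^ face_dim UNIV R)"
    by (simp add: h_poly_def f_poly_nestohedron pcompose_sum pcompose_power_monom)
  then have "eval_int (h_poly (nestohedron B)) (s - 1) = (\<Sum>R\<in>Vis B. (s - 2) ^ face_dim UNIV R)"
    by (simp add: eval_int_sum eval_int_power eval_int_linear)
  also have "\<dots> = coeff (depth_poly UNIV B c s) 0"
    by (simp add: depth_poly_def coeff_sum coeff_0_power)
  also have "\<dots> = s ^ (CARD('v) - 1) * eval_nat ((s - 1) / s\<^sup>2) (coeff \<alpha> 0)"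
    using assms by (simp add: gamma_spec_def coeff_map_poly eval_nat_hom)
  also have "eval_nat ((s - 1) / s\<^sup>2) (coeff \<alpha> 0) = eval_int (map_poly int (coeff \<alpha> 0)) ((s - 1) / s\<^sup>2)"
    by (simp add: eval_nat_def eval_int_def map_poly_map_poly o_def)
  finally show ?thesis .
qed

text \<open>
  Existence and uniqueness of the gamma-expansion both follow by comparing values at
  infinitely many points.
\<close>

theorem gamma_building_eq:
  assumes "gamma_spec UNIV B c \<alpha>"
  shows "gamma_building B = map_poly int (coeff \<alpha> 0)"
proof -
  let ?d = "CARD('v) - 1" and ?g = "map_poly int (coeff \<alpha> 0)" and ?h = "h_poly (nestohedron B)"
  have deg: "degree ?g \<le> ?d div 2" by (rule gamma_degree_bound) (rule eval_int_h_poly[OF assms])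
  have ex: "?h = gamma_expansion ?d ?g"
  proof (rule int_poly_eqI[of "(\<lambda>s. s - 1) ` {1<..<2}"])
    show "infinite ((\<lambda>s::real. s - 1) ` {1<..<2})" by (simp add: finite_image_iff inj_on_def)
    fix y :: real assume "y \<in> (\<lambda>s. s - 1) ` {1<..<2}"
    then show "eval_int ?h y = eval_int (gamma_expansion ?d ?g) y"
      using eval_int_h_poly[OF assms] eval_int_gamma_expansion[OF deg] by auto
  qed
  have uniq: "g = ?g" if g: "degree g \<le> ?d div 2" "?h = gamma_expansion ?d g" for g
  proof (rule int_poly_eqI[OF infinite_gamma_points])
    fix y assume "y \<in> (\<lambda>s::real. (s - 1) / s\<^sup>2) ` {1<..<2}"
    then obtain s :: real where s: "s > 1" "y = (s - 1) / s\<^sup>2" by auto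
    have "gamma_expansion ?d g = gamma_expansion ?d ?g" by (rule trans[OF g(2)[symmetric] ex])
    have "s ^ ?d * eval_int g y = eval_int (gamma_expansion ?d g) (s - 1)"
      unfolding s(2) by (rule eval_int_gamma_expansion[OF g(1) s(1), symmetric])
    also have "\<dots> = eval_int (gamma_expansion ?d ?g) (s - 1)" by (simp only: \<open>gamma_expansion ?d g = gamma_expansion ?d ?g\<close>)
    also have "\<dots> = s ^ ?d * eval_int ?g y" unfolding s(2) by (rule eval_int_gamma_expansion[OF deg s(1)])
    finally have "s ^ ?d * eval_int g y = s ^ ?d * eval_int ?g y" .
    then show "eval_int g y = eval_int ?g y" using s(1) by simp
  qed
  show ?thesis
    unfolding gamma_building_def gamma_poly_def polytope_dim_nestohedron gamma_expansion_def[symmetric]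
  proof (rule the_equality)
    show "degree ?g \<le> ?d div 2 \<and> ?h = gamma_expansion ?d ?g" by (rule conjI[OF deg ex])
    fix g assume "degree g \<le> ?d div 2 \<and> ?h = gamma_expansion ?d g"
    then show "g = ?g" by (elim conjE) (rule uniq)
  qed
qed

end

section \<open>Connected vertex sets and building sets of graphs\<close>

text \<open>
  Connectedness without paths: no proper non-empty subset is closed under adjacency. Unions
  and restrictions of connected sets are easier to treat in this form.
\<close>

definition linked :: "'a set set \<Rightarrow> 'a set \<Rightarrow> bool" where
  "linked E I \<longleftrightarrow> (\<forall>S. S \<subseteq> I \<longrightarrow> S \<noteq> {} \<longrightarrow> (\<forall>a\<in>S. \<forall>b\<in>I. {a, b} \<in> E \<longrightarrow> b \<in> S) \<longrightarrow> S = I)"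

lemma linkedD:
  assumes "linked E I" "S \<subseteq> I" "x \<in> S" "\<And>a b. a \<in> S \<Longrightarrow> b \<in> I \<Longrightarrow> {a, b} \<in> E \<Longrightarrow> b \<in> S"
  shows "S = I"
  using assms unfolding linked_def by blast

lemma linkedI:
  assumes "\<And>S x. S \<subseteq> I \<Longrightarrow> x \<in> S \<Longrightarrow> (\<And>a b. a \<in> S \<Longrightarrow> b \<in> I \<Longrightarrow> {a, b} \<in> E \<Longrightarrow> b \<in> S) \<Longrightarrow> I \<subseteq> S"
  shows "linked E I"
  unfolding linked_def
proof (intro allI impI)
  fix S assume S: "S \<subseteq> I" "S \<noteq> {}" "\<forall>a\<in>S. \<forall>b\<in>I. {a, b} \<in> E \<longrightarrow> b \<in> S"
  obtain x where "x \<in> S" using S(2) by blast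
  then have "I \<subseteq> S" using S(1,3) by (intro assms) blast+
  then show "S = I" using S(1) by blast
qed

lemma adj_iff: "adj (V, E) u v \<longleftrightarrow> {u, v} \<in> E" by (simp add: adj_def)

lemma successively_closed:
  assumes "successively (adj (V, E)) p" "p \<noteq> []" "hd p \<in> S" "set p \<subseteq> I"
    and "\<And>a b. a \<in> S \<Longrightarrow> b \<in> I \<Longrightarrow> {a, b} \<in> E \<Longrightarrow> b \<in> S"
  shows "set p \<subseteq> S"
  using assms(1-4)
proof (induction p)
  case (Cons x p)
  show ?case
  proof (cases p)
    case (Cons y q)
    then have "y \<in> S" using Cons.prems assms(5)[of x y] by (simp add: adj_iff)
    then show ?thesis using Cons.IH Cons.prems Cons by simp
  qed (use Cons.prems in simp)
qed simp

lemma graph_connectedD: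
  assumes "graph_connected (V, E)" "u \<in> V" "v \<in> V"
  shows "\<exists>p. graph_path (V, E) p \<and> hd p = u \<and> last p = v"
  using assms by (simp add: graph_connected_def)

lemma graph_connected_linked: "graph_connected (I, E) \<longleftrightarrow> linked E I"
proof
  assume gc: "graph_connected (I, E)"
  show "linked E I"
  proof (rule linkedI, rule subsetI)
    fix S x y assume S: "S \<subseteq> I" "x \<in> S" "\<And>a b. a \<in> S \<Longrightarrow> b \<in> I \<Longrightarrow> {a, b} \<in> E \<Longrightarrow> b \<in> S" "y \<in> I"
    have "x \<in> I" using S by blast
    then obtain p where p: "graph_path (I, E) p" "hd p = x" "last p = y"
      using graph_connectedD[OF gc _ S(4)] by blast
    then have "set p \<subseteq> S" using S(2,3) by (intro successively_closed[of I E p S I]) (auto simp: graph_path_def)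
    then show "y \<in> S" using p by (metis graph_path_def last_in_set subsetD)
  qed
next
  assume c: "linked E I"
  show "graph_connected (I, E)"
    unfolding graph_connected_def
  proof (intro ballI)
    fix u v assume uv: "u \<in> verts (I, E)" "v \<in> verts (I, E)"
    define S where "S = {v \<in> I. \<exists>p. graph_path (I, E) p \<and> hd p = u \<and> last p = v}"
    have "S = I"
    proof (rule linkedD[OF c])
      show "S \<subseteq> I" by (auto simp: S_def)
      show "u \<in> S" using uv by (auto simp: S_def graph_path_def intro!: exI[of _ "[u]"])
      fix a b assume a: "a \<in> S" and b: "b \<in> I" "{a, b} \<in> E"
      obtain p where p: "graph_path (I, E) p" "hd p = u" "last p = a" using a by (auto simp: S_def)
      show "b \<in> S"
      proof (cases "b \<in> set p")
        case True
        then obtain xs ys where q: "p = xs @ b # ys" by (auto dest: split_list)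
        have "graph_path (I, E) (xs @ [b])" using p(1) unfolding q by (auto simp: graph_path_def successively_append_iff)
        moreover have "hd (xs @ [b]) = u" using p(2) unfolding q by (cases xs) auto
        ultimately show ?thesis unfolding S_def using b by (intro CollectI conjI exI[of _ "xs @ [b]"]) auto
      next
        case False
        have "graph_path (I, E) (p @ [b])" using p False b
          by (auto simp: graph_path_def successively_append_iff adj_iff)
        moreover have "hd (p @ [b]) = u" using p by (auto simp: graph_path_def)
        ultimately show ?thesis unfolding S_def using b by (intro CollectI conjI exI[of _ "p @ [b]"]) auto
      qed
    qed
    then show "\<exists>p. graph_path (I, E) p \<and> hd p = u \<and> last p = v" using uv by (auto simp: S_def)
  qed
qed

lemma linked_cong: "(\<And>a b. a \<in> I \<Longrightarrow> b \<in> I \<Longrightarrow> {a, b} \<in> E \<longleftrightarrow> {a, b} \<in> E') \<Longrightarrow> linked E I \<longleftrightarrow> linked E' I"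
  unfolding linked_def by (intro all_cong1 imp_cong refl) (meson subsetD)

lemma building_set_linked: "building_set (V, E) = {I. I \<subseteq> V \<and> I \<noteq> {} \<and> linked E I}"
proof -
  have "graph_connected (induced (V, E) I) \<longleftrightarrow> linked E I" for I
    unfolding induced_def graph_connected_linked by (rule linked_cong) auto
  then show ?thesis by (simp add: building_set_def)
qed

lemma linked_single: "linked E {u}"
  by (rule linkedI) blast

lemma linked_mono: "linked E I \<Longrightarrow> E \<subseteq> E' \<Longrightarrow> linked E' I"
  by (rule linkedI) (metis linkedD order_refl subsetD)

lemma linked_Un:
  assumes "linked E I" "linked E J" "x \<in> I" "x \<in> J"
  shows "linked E (I \<union> J)"
proof (rule linkedI)
  fix S y assume S: "S \<subseteq> I \<union> J" "y \<in> S" "\<And>a b. a \<in> S \<Longrightarrow> b \<in> I \<union> J \<Longrightarrow> {a, b} \<in> E \<Longrightarrow> b \<in> S"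
  have I: "S \<inter> I = I" if "z \<in> S \<inter> I" for z
    by (rule linkedD[OF assms(1) _ that]) (use S(3) in blast)+
  have J: "S \<inter> J = J" if "z \<in> S \<inter> J" for z
    by (rule linkedD[OF assms(2) _ that]) (use S(3) in blast)+
  have "x \<in> S" using I[of y] J[of y] S(1,2) assms(3,4) by blast
  then show "I \<union> J \<subseteq> S" using I[of x] J[of x] assms(3,4) by blast
qed

lemma building_building_set:
  assumes "finite V"
  shows "building (building_set (V, E)) V"
proof
  fix I J assume "I \<in> building_set (V, E)" "J \<in> building_set (V, E)" "I \<inter> J \<noteq> {}"
  then show "I \<union> J \<in> building_set (V, E)" using linked_Un[of E I J] by (auto simp: building_set_linked)
qed (use assms in \<open>auto simp: building_set_linked linked_single\<close>)

text \<open>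
  A closed subset \<open>S\<close> of \<open>I \<inter> V1\<close> becomes closed in
  \<open>I\<close> after adding \<open>I \<inter> V2\<close> if it contains \<open>c\<close>,
  and is closed in \<open>I\<close> as it stands otherwise.
\<close>

lemma linked_wedge_restrict:
  assumes V: "V1 \<inter> V2 = {c}" and E: "\<And>e. e \<in> E1 \<Longrightarrow> e \<subseteq> V1" "\<And>e. e \<in> E2 \<Longrightarrow> e \<subseteq> V2"
    and I: "I \<subseteq> V1 \<union> V2" "linked (E1 \<union> E2) I"
  shows "linked E1 (I \<inter> V1)"
proof (rule linkedI)
  have V': "x = c" if "x \<in> V1" "x \<in> V2" for x using V that by blast
  fix S x assume S: "S \<subseteq> I \<inter> V1" "x \<in> S" "\<And>a b. a \<in> S \<Longrightarrow> b \<in> I \<inter> V1 \<Longrightarrow> {a, b} \<in> E1 \<Longrightarrow> b \<in> S"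
  show "I \<inter> V1 \<subseteq> S"
  proof (cases "c \<in> S")
    case True
    have "S \<union> (I \<inter> V2) = I"
    proof (rule linkedD[OF I(2)])
      show "S \<union> (I \<inter> V2) \<subseteq> I" using S by blast
      show "x \<in> S \<union> (I \<inter> V2)" using S by blast
      fix a b assume ab: "a \<in> S \<union> (I \<inter> V2)" "b \<in> I" "{a, b} \<in> E1 \<union> E2"
      show "b \<in> S \<union> (I \<inter> V2)"
      proof (cases "{a, b} \<in> E2")
        case True then show ?thesis using E(2)[OF True] ab by blast
      next
        case False
        then have e1: "{a, b} \<in> E1" using ab by blast
        then have "a \<in> V1" "b \<in> V1" using E(1) by blast+
        then have "a \<in> S" using ab(1) V'[of a] True by blast
        then show ?thesis using S(3)[of a b] e1 ab(2) \<open>b \<in> V1\<close> by blast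
      qed
    qed
    then show ?thesis using V' True by blast
  next
    case False
    have "S = I"
    proof (rule linkedD[OF I(2) _ S(2)])
      show "S \<subseteq> I" using S by blast
      fix a b assume ab: "a \<in> S" "b \<in> I" "{a, b} \<in> E1 \<union> E2"
      have "a \<notin> V2" using ab(1) S(1) False V'[of a] by blast
      then have "{a, b} \<in> E1" using ab(3) E(2) by blast
      then show "b \<in> S" using S(3)[of a b] ab E(1) by blast
    qed
    then show ?thesis by blast
  qed
qed

lemma linked_wedge_cross:
  assumes V: "V1 \<inter> V2 = {c}" and E: "\<And>e. e \<in> E1 \<Longrightarrow> e \<subseteq> V1" "\<And>e. e \<in> E2 \<Longrightarrow> e \<subseteq> V2"
    and I: "I \<subseteq> V1 \<union> V2" "linked (E1 \<union> E2) I" "I \<inter> V1 \<noteq> {}" "I \<inter> V2 \<noteq> {}"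
  shows "c \<in> I"
proof (rule ccontr)
  assume c: "c \<notin> I"
  obtain x where x: "x \<in> I \<inter> V1" using I(3) by blast
  have "I \<inter> V1 = I"
  proof (rule linkedD[OF I(2) _ x])
    fix a b assume ab: "a \<in> I \<inter> V1" "b \<in> I" "{a, b} \<in> E1 \<union> E2"
    have "a \<notin> V2"
    proof
      assume "a \<in> V2"
      then have "a \<in> V1 \<inter> V2" using ab(1) by blast
      then have "a = c" unfolding V by blast
      then show False using ab(1) c by blast
    qed
    then have "{a, b} \<in> E1" using ab(3) E(2)[of "{a, b}"] by blast
    then show "b \<in> I \<inter> V1" using ab(2) E(1)[of "{a, b}"] by blast
  qed blast
  then obtain z where "z \<in> V1 \<inter> V2" "z \<in> I" using I(4) by blast
  then show False unfolding V using c by blast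
qed

lemma wedge_building_set:
  assumes fin: "finite V1" "finite V2" and V: "V1 \<inter> V2 = {c}"
    and E: "\<And>e. e \<in> E1 \<Longrightarrow> e \<subseteq> V1" "\<And>e. e \<in> E2 \<Longrightarrow> e \<subseteq> V2"
  shows "wedge (building_set (V1, E1)) V1 (building_set (V2, E2)) V2 (building_set (V1 \<union> V2, E1 \<union> E2)) c"
proof -
  interpret A: building "building_set (V1, E1)" V1 by (rule building_building_set[OF fin(1)])
  interpret Z: building "building_set (V2, E2)" V2 by (rule building_building_set[OF fin(2)])
  interpret G: building "building_set (V1 \<union> V2, E1 \<union> E2)" "V1 \<union> V2"
    by (rule building_building_set) (use fin in simp)
  have V': "V2 \<inter> V1 = {c}" using V by blast
  show ?thesis
  proof
    show "V1 \<inter> V2 = {c}" by (rule V)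
    show "building_set (V1, E1) \<subseteq> building_set (V1 \<union> V2, E1 \<union> E2)"
      using linked_mono[of E1 _ "E1 \<union> E2"] by (auto simp: building_set_linked)
    show "building_set (V2, E2) \<subseteq> building_set (V1 \<union> V2, E1 \<union> E2)"
      using linked_mono[of E2 _ "E1 \<union> E2"] by (auto simp: building_set_linked)
  next
    fix I assume I: "I \<in> building_set (V1 \<union> V2, E1 \<union> E2)"
    then have IV: "I \<subseteq> V1 \<union> V2" and Ic: "linked (E1 \<union> E2) I" by (auto simp: building_set_linked)
    show "I \<inter> V1 \<in> building_set (V1, E1)" if "I \<inter> V1 \<noteq> {}"
      using linked_wedge_restrict[OF V E IV Ic] that by (simp add: building_set_linked)
    show "I \<inter> V2 \<in> building_set (V2, E2)" if "I \<inter> V2 \<noteq> {}"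
      using linked_wedge_restrict[OF V' E(2,1), where I = I] IV Ic that by (simp add: building_set_linked Un_commute)
    show "c \<in> I" if "I \<inter> V1 \<noteq> {}" "I \<inter> V2 \<noteq> {}"
      using linked_wedge_cross[OF V E IV Ic that] .
  next
    fix I J assume "I \<in> building_set (V1, E1)" "J \<in> building_set (V2, E2)" "c \<in> I" "c \<in> J"
    then show "I \<union> J \<in> building_set (V1 \<union> V2, E1 \<union> E2)"
      using linked_Un[of "E1 \<union> E2" I J c] linked_mono[of E1 I "E1 \<union> E2"] linked_mono[of E2 J "E1 \<union> E2"]
      by (auto simp: building_set_linked)
  qed
qed

lemma linked_edge: "linked {{c, r}} {c, r}"
proof (rule linkedI)
  fix S x assume S: "S \<subseteq> {c, r}" "x \<in> S" "\<And>a b. a \<in> S \<Longrightarrow> b \<in> {c, r} \<Longrightarrow> {a, b} \<in> {{c, r}} \<Longrightarrow> b \<in> S"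
  show "{c, r} \<subseteq> S" using S(3)[of c r] S(3)[of r c] S(1,2) by (auto simp: insert_commute)
qed

lemma pendant_building_set:
  assumes fin: "finite V" and c: "c \<in> V" "r \<notin> V" and E: "\<And>e. e \<in> E \<Longrightarrow> e \<subseteq> V"
  shows "pendant (building_set (V, E)) V (building_set (insert r V, insert {r, c} E)) r c"
proof -
  have eq: "V \<union> {c, r} = insert r V" "E \<union> {{c, r}} = insert {r, c} E" using c by auto
  have "wedge (building_set (V, E)) V (building_set ({c, r}, {{c, r}})) {c, r} (building_set (V \<union> {c, r}, E \<union> {{c, r}})) c"
    by (rule wedge_building_set) (use fin c E in auto)
  then interpret W: wedge "building_set (V, E)" V "building_set ({c, r}, {{c, r}})" "{c, r}"
    "building_set (insert r V, insert {r, c} E)" c unfolding eq .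
  interpret G: building "building_set (insert r V, insert {r, c} E)" "insert r V"
    by (rule building_building_set) (use fin in simp)
  show ?thesis
  proof
    show "c \<in> V" "r \<notin> V" by (rule c)+
    show "building_set (V, E) \<subseteq> building_set (insert r V, insert {r, c} E)" by (rule W.subA)
    fix I
    show "I \<inter> V \<in> building_set (V, E)" if "I \<in> building_set (insert r V, insert {r, c} E)" "I \<inter> V \<noteq> {}"
      using W.restrA that by blast
    show "c \<in> I" if "I \<in> building_set (insert r V, insert {r, c} E)" "r \<in> I" "I \<inter> V \<noteq> {}"
      using W.cross that by blast
    show "insert r I \<in> building_set (insert r V, insert {r, c} E)" if "I \<in> building_set (V, E)" "c \<in> I"
    proof -
      have "{c, r} \<in> building_set ({c, r}, {{c, r}})" by (simp add: building_set_linked linked_edge)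
      then have "I \<union> {c, r} \<in> building_set (insert r V, insert {r, c} E)" using W.join that by blast
      moreover have "I \<union> {c, r} = insert r I" using that by blast
      ultimately show ?thesis by simp
    qed
  qed
qed

section \<open>Trees built by grafting\<close>

text \<open>
  This is the recursion along which the gamma-polynomials are computed: a graft attaches a new
  root to the second tree and then glues the result to the first at the root.
\<close>

inductive rtree :: "'a \<Rightarrow> 'a set \<Rightarrow> 'a set set \<Rightarrow> bool" where
  single: "rtree c {c} {}"
| graft: "rtree c V1 E1 \<Longrightarrow> rtree f V2 E2 \<Longrightarrow> V1 \<inter> V2 = {} \<Longrightarrow> rtree c (V1 \<union> V2) (insert {c, f} (E1 \<union> E2))"

lemma rtree_root: "rtree c V E \<Longrightarrow> c \<in> V"
  by (induction rule: rtree.induct) auto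

lemma rtree_finite: "rtree c V E \<Longrightarrow> finite V"
  by (induction rule: rtree.induct) auto

lemma rtree_edges:
  assumes "rtree c V E" "e \<in> E"
  shows "e \<subseteq> V" "card e = 2"
proof -
  have "\<forall>e\<in>E. e \<subseteq> V \<and> card e = 2" using assms(1)
  proof (induction rule: rtree.induct)
    case (graft c V1 E1 f V2 E2)
    have cf: "c \<in> V1" "f \<in> V2" using graft.hyps(1,2) by (simp_all add: rtree_root)
    then have "c \<noteq> f" using graft.hyps(3) by blast
    then have "card {c, f} = 2" by simp
    then show ?case using graft.IH cf by auto
  qed simp
  then show "e \<subseteq> V" "card e = 2" using assms(2) by auto
qed

lemma rtree_linked: "rtree c V E \<Longrightarrow> linked E V"
proof (induction rule: rtree.induct)
  case (single c) show ?case by (rule linked_single)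
next
  case (graft c V1 E1 f V2 E2)
  let ?E = "insert {c, f} (E1 \<union> E2)"
  have cf: "c \<in> V1" "f \<in> V2" using graft.hyps(1,2) by (simp_all add: rtree_root)
  have "linked ?E (V1 \<union> {c, f})"
    using linked_Un[of ?E V1 "{c, f}" c] linked_mono[OF graft.IH(1), of ?E] linked_mono[OF linked_edge, of c f ?E] cf by blast
  then have "linked ?E (V1 \<union> {c, f} \<union> V2)"
    using linked_Un[of ?E "V1 \<union> {c, f}" V2 f] linked_mono[OF graft.IH(2), of ?E] cf by blast
  moreover have "V1 \<union> {c, f} \<union> V2 = V1 \<union> V2" using cf by blast
  ultimately show ?case by simp
qed

text \<open>
  The cut for an edge of one part is extended by putting the other part on the side of the
  vertex to which it is joined.
\<close>

lemma rtree_bridge: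
  assumes "rtree c V E" "{u, v} \<in> E"
  shows "\<exists>S. u \<in> S \<and> v \<notin> S \<and> (\<forall>a\<in>S \<inter> V. \<forall>b\<in>V - S. {a, b} \<in> E \<longrightarrow> a = u \<and> b = v)"
  using assms
proof (induction arbitrary: u v rule: rtree.induct)
  case (single c) then show ?case by simp
next
  case (graft c V1 E1 f V2 E2)
  have cf: "c \<in> V1" "f \<in> V2" using graft.hyps(1,2) by (simp_all add: rtree_root)
  have E1: "a \<in> V1 \<and> b \<in> V1" if "{a, b} \<in> E1" for a b using rtree_edges(1)[OF graft.hyps(1) that] by blast
  have E2: "a \<in> V2 \<and> b \<in> V2" if "{a, b} \<in> E2" for a b using rtree_edges(1)[OF graft.hyps(2) that] by blast
  consider "u = c" "v = f" | "u = f" "v = c" | "{u, v} \<in> E1" | "{u, v} \<in> E2"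
    using graft.prems by (auto simp: doubleton_eq_iff)
  then show ?case
  proof cases
    case 1
    show ?thesis by (rule exI[of _ V1]) (use 1 cf graft.hyps(3) E1 E2 in \<open>auto simp: doubleton_eq_iff\<close>)
  next
    case 2
    show ?thesis by (rule exI[of _ V2]) (use 2 cf graft.hyps(3) E1 E2 in \<open>auto simp: doubleton_eq_iff\<close>)
  next
    case 3
    obtain S where S: "u \<in> S" "v \<notin> S" "\<forall>a\<in>S \<inter> V1. \<forall>b\<in>V1 - S. {a, b} \<in> E1 \<longrightarrow> a = u \<and> b = v"
      using graft.IH(1)[OF 3] by blast
    let ?S = "S \<inter> V1 \<union> (if c \<in> S then V2 else {})"
    have d: "x \<in> V1 \<Longrightarrow> x \<notin> V2" for x using graft.hyps(3) by blast
    show ?thesis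
    proof (rule exI[of _ ?S], intro conjI ballI impI)
      show "u \<in> ?S" "v \<notin> ?S" using S(1,2) E1[OF 3] d by auto
    next
      fix a b assume "a \<in> ?S \<inter> (V1 \<union> V2)" "b \<in> V1 \<union> V2 - ?S" "{a, b} \<in> insert {c, f} (E1 \<union> E2)"
      then have "{a, b} \<in> E1 \<and> a \<in> S \<inter> V1 \<and> b \<in> V1 - S"
        using E1[of a b] E2[of a b] cf d by (auto simp: doubleton_eq_iff split: if_splits)
      then show "a = u" "b = v" using S(3) by blast+
    qed
  next
    case 4
    obtain S where S: "u \<in> S" "v \<notin> S" "\<forall>a\<in>S \<inter> V2. \<forall>b\<in>V2 - S. {a, b} \<in> E2 \<longrightarrow> a = u \<and> b = v"
      using graft.IH(2)[OF 4] by blast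
    let ?S = "S \<inter> V2 \<union> (if f \<in> S then V1 else {})"
    have d: "x \<in> V1 \<Longrightarrow> x \<notin> V2" for x using graft.hyps(3) by blast
    show ?thesis
    proof (rule exI[of _ ?S], intro conjI ballI impI)
      show "u \<in> ?S" "v \<notin> ?S" using S(1,2) E2[OF 4] d by auto
    next
      fix a b assume "a \<in> ?S \<inter> (V1 \<union> V2)" "b \<in> V1 \<union> V2 - ?S" "{a, b} \<in> insert {c, f} (E1 \<union> E2)"
      then have "{a, b} \<in> E2 \<and> a \<in> S \<inter> V2 \<and> b \<in> V2 - S"
        using E1[of a b] E2[of a b] cf d by (auto simp: doubleton_eq_iff split: if_splits)
      then show "a = u" "b = v" using S(3) by blast+
    qed
  qed
qed

lemma successively_crossing:
  assumes "successively P p" "p \<noteq> []" "hd p \<notin> S" "last p \<in> S"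
  shows "\<exists>xs a b ys. p = xs @ a # b # ys \<and> a \<notin> S \<and> b \<in> S \<and> P a b"
  using assms
proof (induction p)
  case (Cons x p)
  then obtain y q where p: "p = y # q" by (cases p) auto
  show ?case
  proof (cases "y \<in> S")
    case True
    then show ?thesis using Cons.prems p by (intro exI[of _ "[]"]) auto
  next
    case False
    then obtain xs a b ys where "p = xs @ a # b # ys" "a \<notin> S" "b \<in> S" "P a b"
      using Cons p by auto
    then show ?thesis by (intro exI[of _ "x # xs"]) auto
  qed
qed simp

text \<open>
  A cycle would cross the cut of its closing edge a second time.
\<close>

lemma rtree_imp_tree_graph:
  assumes "rtree c V E"
  shows "tree_graph (V, E)"
proof -
  have "graph_acyclic (V, E)"
    unfolding graph_acyclic_def
  proof
    assume "\<exists>p. graph_path (V, E) p \<and> 3 \<le> length p \<and> adj (V, E) (last p) (hd p)"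
    then obtain p where p: "graph_path (V, E) p" "3 \<le> length p" "{last p, hd p} \<in> E" by (auto simp: adj_iff)
    obtain S where S: "last p \<in> S" "hd p \<notin> S" "\<forall>a\<in>S \<inter> V. \<forall>b\<in>V - S. {a, b} \<in> E \<longrightarrow> a = last p \<and> b = hd p"
      using rtree_bridge[OF assms p(3)] by blast
    have pp: "p \<noteq> []" "set p \<subseteq> V" "distinct p" "successively (adj (V, E)) p" using p(1) by (auto simp: graph_path_def)
    obtain xs a b ys where q: "p = xs @ a # b # ys" "a \<notin> S" "b \<in> S" "{a, b} \<in> E"
      using successively_crossing[OF pp(4,1) S(2,1)] by (auto simp: adj_iff)
    have "a \<in> V" "b \<in> V" using pp(2) q(1) by auto
    then have ab: "b = last p" "a = hd p" using S(3) q(2-4) by (auto simp: insert_commute)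
    have "xs = []" using ab(2) pp(3) unfolding q(1) by (cases xs) auto
    moreover have "ys = []" using ab(1) pp(3) unfolding q(1) by (cases ys rule: rev_cases) auto
    ultimately show False using p(2) q(1) by simp
  qed
  moreover have "V \<noteq> {}" using rtree_root[OF assms] by blast
  moreover have "\<forall>e\<in>E. e \<subseteq> V \<and> card e = 2" using rtree_edges[OF assms] by blast
  ultimately show ?thesis
    using rtree_finite[OF assms] rtree_linked[OF assms]
    by (simp add: tree_graph_def simple_graph_def graph_connected_linked)
qed

lemma rtree_graft_anywhere:
  assumes "rtree f V2 E2" "x \<in> V2" "rtree c V1 E1" "V1 \<inter> V2 = {}"
  shows "rtree f (V2 \<union> V1) (insert {x, c} (E2 \<union> E1))"
  using assms
proof (induction rule: rtree.induct)
  case (single f)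
  then show ?case using rtree.graft[OF rtree.single single(2)] by auto
next
  case (graft f V21 E21 g V22 E22)
  show ?case
  proof (cases "x \<in> V21")
    case True
    then have "rtree f (V21 \<union> V1) (insert {x, c} (E21 \<union> E1))" using graft by auto
    then have "rtree f ((V21 \<union> V1) \<union> V22) (insert {f, g} (insert {x, c} (E21 \<union> E1) \<union> E22))"
      by (rule rtree.graft) (use graft in auto)
    moreover have "(V21 \<union> V1) \<union> V22 = V21 \<union> V22 \<union> V1"
      "insert {f, g} (insert {x, c} (E21 \<union> E1) \<union> E22) = insert {x, c} (insert {f, g} (E21 \<union> E22) \<union> E1)" by auto
    ultimately show ?thesis by simp
  next
    case False
    then have "rtree g (V22 \<union> V1) (insert {x, c} (E22 \<union> E1))" using graft by auto
    then have "rtree f (V21 \<union> (V22 \<union> V1)) (insert {f, g} (E21 \<union> insert {x, c} (E22 \<union> E1)))"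
      by (intro rtree.graft) (use graft in auto)
    moreover have "V21 \<union> (V22 \<union> V1) = V21 \<union> V22 \<union> V1"
      "insert {f, g} (E21 \<union> insert {x, c} (E22 \<union> E1)) = insert {x, c} (insert {f, g} (E21 \<union> E22) \<union> E1)" by auto
    ultimately show ?thesis by simp
  qed
qed

text \<open>
  Take a maximal vertex set containing \<open>c\<close> on which the graph is built by
  grafting. If it is not everything, an edge leads to a new vertex \<open>x\<close>; by
  acyclicity this is the only edge between \<open>x\<close> and the set, so \<open>x\<close>
  can be grafted as well.
\<close>

lemma tree_graph_imp_rtree:
  assumes T: "tree_graph (V, E)" and c: "c \<in> V"
  shows "rtree c V E"
proof -
  have fin: "finite V" and E: "\<And>e. e \<in> E \<Longrightarrow> e \<subseteq> V \<and> card e = 2" and conn: "linked E V" and ac: "graph_acyclic (V, E)"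
    using T by (auto simp: tree_graph_def simple_graph_def graph_connected_linked)
  define Q where "Q = {W. W \<subseteq> V \<and> rtree c W (E \<inter> Pow W)}"
  have "E \<inter> Pow {c} = {}"
  proof -
    have "e \<notin> Pow {c}" if "e \<in> E" for e
    proof
      assume "e \<in> Pow {c}"
      then have "e = {} \<or> e = {c}" by auto
      then show False using E[OF that] by auto
    qed
    then show ?thesis by blast
  qed
  then have "{c} \<in> Q" using c rtree.single by (auto simp: Q_def)
  moreover have "finite Q" using fin by (auto simp: Q_def intro: finite_subset[of _ "Pow V"])
  ultimately obtain W where W: "W \<in> Q" "\<And>W'. W' \<in> Q \<Longrightarrow> W \<subseteq> W' \<Longrightarrow> W = W'"
    using finite_has_maximal2[of Q "{c}"] by blast
  have WV: "W \<subseteq> V" and Wt: "rtree c W (E \<inter> Pow W)" using W(1) by (auto simp: Q_def)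
  have "W = V"
  proof (rule ccontr)
    assume "W \<noteq> V"
    obtain y x where yx: "y \<in> W" "x \<in> V" "{y, x} \<in> E" "x \<notin> W"
      using \<open>W \<noteq> V\<close> linkedD[OF conn WV rtree_root[OF Wt]] by blast
    have uniq: "y' = y" if y': "y' \<in> W" "{y', x} \<in> E" for y'
    proof (rule ccontr)
      assume "y' \<noteq> y"
      have "graph_connected (W, E \<inter> Pow W)" using rtree_linked[OF Wt] by (simp add: graph_connected_linked)
      then obtain p where p: "graph_path (W, E \<inter> Pow W) p" "hd p = y" "last p = y'"
        using graph_connectedD[OF _ yx(1) y'(1)] by blast
      have pne: "p \<noteq> []" using p(1) by (simp add: graph_path_def)
      obtain z q where zq: "p = z # q" using pne by (cases p) auto
      have "q \<noteq> []" using p(2,3) \<open>y' \<noteq> y\<close> zq by auto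
      then have len: "length (p @ [x]) \<ge> 3" using zq by (cases q) auto
      have "successively (adj (V, E)) p" using p(1) unfolding graph_path_def
        by (auto elim!: successively_mono simp: adj_iff)
      then have "graph_path (V, E) (p @ [x])"
        using p yx y' WV pne by (auto simp: graph_path_def successively_append_iff adj_iff)
      moreover have "adj (V, E) (last (p @ [x])) (hd (p @ [x]))" using p yx pne by (simp add: adj_iff insert_commute)
      ultimately show False using ac len unfolding graph_acyclic_def by blast
    qed
    have "rtree c (W \<union> {x}) (insert {y, x} ((E \<inter> Pow W) \<union> {}))"
      by (rule rtree_graft_anywhere[OF Wt yx(1) rtree.single]) (use yx in auto)
    moreover have "insert {y, x} ((E \<inter> Pow W) \<union> {}) = E \<inter> Pow (W \<union> {x})"
    proof (intro set_eqI iffI)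
      fix e assume "e \<in> insert {y, x} ((E \<inter> Pow W) \<union> {})"
      then show "e \<in> E \<inter> Pow (W \<union> {x})" using yx by auto
    next
      fix e assume e: "e \<in> E \<inter> Pow (W \<union> {x})"
      show "e \<in> insert {y, x} ((E \<inter> Pow W) \<union> {})"
      proof (cases "x \<in> e")
        case True
        have "e \<in> E" using e by blast
        then have "card e = 2" using E by blast
        then obtain a b where ab: "e = {a, b}" "a \<noteq> b" unfolding card_2_iff by blast
        then obtain z where z: "e = {z, x}" "z \<noteq> x" using True by (metis insert_commute insert_iff singletonD)
        have "z \<in> W" using e z by blast
        then have "z = y" using uniq[of z] \<open>e \<in> E\<close> z(1) by blast
        then show ?thesis using z(1) by blast
      qed (use e in auto)
    qed
    ultimately have "W \<union> {x} \<in> Q" using WV yx by (auto simp: Q_def)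
    then show False using W(2)[of "W \<union> {x}"] yx by auto
  qed
  moreover have "E \<inter> Pow V = E" using E by auto
  ultimately show ?thesis using Wt by simp
qed

lemma rtree_wedge:
  assumes "rtree c V2 E2" "rtree c V1 E1" "V1 \<inter> V2 = {c}"
  shows "rtree c (V1 \<union> V2) (E1 \<union> E2)"
  using assms
proof (induction rule: rtree.induct)
  case (single c)
  then show ?case using rtree_root[of c V1 E1] by (simp add: insert_absorb)
next
  case (graft c V21 E21 f V22 E22)
  have "c \<in> V1" "c \<in> V21" using graft.hyps(1,2) graft.prems by (simp_all add: rtree_root)
  then have "V1 \<inter> V21 = {c}" "V1 \<inter> V22 = {}" using graft.hyps(3) graft.prems(2) by blast+
  then have "rtree c ((V1 \<union> V21) \<union> V22) (insert {c, f} ((E1 \<union> E21) \<union> E22))"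
    using graft by (intro rtree.graft) auto
  then show ?case by (simp add: Un_assoc)
qed

lemma rtree_relabel:
  assumes "rtree c V E" "inj_on f V"
  shows "rtree (f c) (f ` V) ((`) f ` E)"
  using assms
proof (induction rule: rtree.induct)
  case (single c) then show ?case using rtree.single by simp
next
  case (graft c V1 E1 g V2 E2)
  have "inj_on f V1" "inj_on f V2" using graft.prems by (auto intro: inj_on_subset)
  moreover have "f ` V1 \<inter> f ` V2 = {}" using graft.hyps(3) inj_on_image_Int[OF graft.prems, of V1 V2] by auto
  ultimately have "rtree (f c) (f ` V1 \<union> f ` V2) (insert {f c, f g} ((`) f ` E1 \<union> (`) f ` E2))"
    using graft by (intro rtree.graft) auto
  then show ?case by (simp add: image_Un)
qed

text \<open>
  Grafting a tree at the root means attaching \<open>c\<close> to it as a new root and then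
  gluing at \<open>c\<close>.
\<close>

lemma gamma_spec_exists:
  "rtree c V E \<Longrightarrow> \<exists>\<alpha>. gamma_spec V (building_set (V, E)) c \<alpha>"
proof (induction rule: rtree.induct)
  case (single c)
  have "building_set ({c}, {}) = {{c}}" by (auto simp: building_set_linked linked_single)
  then show ?case using gamma_spec_point by metis
next
  case (graft c V1 E1 f V2 E2)
  obtain \<alpha> \<beta> where a: "gamma_spec V1 (building_set (V1, E1)) c \<alpha>" and b: "gamma_spec V2 (building_set (V2, E2)) f \<beta>"
    using graft.IH by blast
  have cf: "c \<in> V1" "f \<in> V2" using graft.hyps(1,2) by (simp_all add: rtree_root)
  then have cV2: "c \<notin> V2" using graft.hyps(3) by blast
  note fin = rtree_finite[OF graft.hyps(1)] rtree_finite[OF graft.hyps(2)]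
  interpret P: pendant "building_set (V2, E2)" V2 "building_set (insert c V2, insert {c, f} E2)" c f
    by (rule pendant_building_set[OF fin(2) cf(2) cV2]) (rule rtree_edges(1)[OF graft.hyps(2)])
  have "wedge (building_set (V1, E1)) V1 (building_set (insert c V2, insert {c, f} E2)) (insert c V2)
      (building_set (V1 \<union> insert c V2, E1 \<union> insert {c, f} E2)) c"
  proof (rule wedge_building_set)
    show "finite V1" "finite (insert c V2)" using fin by auto
    show "V1 \<inter> insert c V2 = {c}" using cf graft.hyps(3) by blast
    show "\<And>e. e \<in> E1 \<Longrightarrow> e \<subseteq> V1" by (rule rtree_edges(1)[OF graft.hyps(1)])
    show "\<And>e. e \<in> insert {c, f} E2 \<Longrightarrow> e \<subseteq> insert c V2" using rtree_edges(1)[OF graft.hyps(2)] cf by blast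
  qed
  moreover have "V1 \<union> insert c V2 = V1 \<union> V2" "E1 \<union> insert {c, f} E2 = insert {c, f} (E1 \<union> E2)" using cf by auto
  ultimately interpret W: wedge "building_set (V1, E1)" V1 "building_set (insert c V2, insert {c, f} E2)" "insert c V2"
      "building_set (V1 \<union> V2, insert {c, f} (E1 \<union> E2))" c by simp
  have "V1 \<union> insert c V2 = V1 \<union> V2" using cf by auto
  then show ?case using W.gamma_spec_wedge[OF a P.gamma_spec_pendant[OF b]] by metis
qed

section \<open>The structure of a tree shift\<close>

definition nbrs :: "'a set set \<Rightarrow> 'a \<Rightarrow> 'a set" where
  "nbrs E v = {u. {v, u} \<in> E}"

lemma nbrs_subset: "(\<And>e. e \<in> E \<Longrightarrow> e \<subseteq> V) \<Longrightarrow> nbrs E v \<subseteq> V"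
  by (auto simp: nbrs_def)

lemma deg_nbrs:
  assumes "\<And>e. e \<in> E \<Longrightarrow> e \<subseteq> V"
  shows "deg (V, E) v = card (nbrs E v)"
proof -
  have "{u \<in> verts (V, E). adj (V, E) v u} = nbrs E v"
    using nbrs_subset[of E V v] assms by (auto simp: nbrs_def adj_iff)
  then show ?thesis by (simp add: deg_def)
qed

fun list_edges :: "'a list \<Rightarrow> 'a set set" where
  "list_edges [] = {}"
| "list_edges [a] = {}"
| "list_edges (a # b # r) = insert {a, b} (list_edges (b # r))"

lemma list_edges_subset: "e \<in> list_edges p \<Longrightarrow> e \<subseteq> set p"
  by (induction p rule: list_edges.induct) auto

lemma list_edges_mid: "{a, b} \<in> list_edges (ys @ a # b # zs)"
proof (induction ys)
  case (Cons y ys)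
  then show ?case by (cases ys) auto
qed simp

lemma successively_mid: "successively P (ys @ a # b # zs) \<Longrightarrow> P a b"
  by (simp add: successively_append_iff)

lemma path_edges:
  "successively (adj (V, E)) p \<Longrightarrow> list_edges p \<subseteq> E"
  by (induction p rule: list_edges.induct) (simp_all add: adj_iff)

text \<open>
  An inner vertex of degree at most two on a path, or a leaf at its end, has no neighbours off
  the path.
\<close>

lemma path_nbrs:
  assumes p: "graph_path (V, E) (a0 # q)" and x: "x \<in> set q"
    and fin: "finite V" "\<And>e. e \<in> E \<Longrightarrow> e \<subseteq> V"
    and d2: "x \<noteq> last (a0 # q) \<Longrightarrow> card (nbrs E x) \<le> 2" and d1: "x = last (a0 # q) \<Longrightarrow> card (nbrs E x) = 1"
    and e: "{x, u} \<in> E"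
  shows "{x, u} \<in> list_edges (a0 # q)"
proof -
  have dist: "distinct (a0 # q)" and succ: "successively (adj (V, E)) (a0 # q)"
    using p by (simp_all add: graph_path_def)
  obtain as bs where q: "q = as @ x # bs" using x by (auto dest: split_list)
  obtain ys a where ya: "a0 # as = ys @ [a]" by (metis list.distinct(1) rev_exhaust)
  have p1: "a0 # q = ys @ a # x # bs" using ya q by (metis append.assoc append_Cons append_Nil)
  have ax: "{a, x} \<in> E" using successively_mid[of "adj (V, E)" ys a x bs] succ unfolding p1 by (simp add: adj_iff)
  have axp: "{a, x} \<in> list_edges (a0 # q)" unfolding p1 by (rule list_edges_mid)
  have a_nbrs: "a \<in> nbrs E x" using ax by (simp add: nbrs_def insert_commute)
  have fnb: "finite (nbrs E x)" using nbrs_subset[of E V, OF fin(2)] fin(1) finite_subset by metis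
  have u_nbrs: "u \<in> nbrs E x" using e by (simp add: nbrs_def)
  show ?thesis
  proof (cases bs)
    case Nil
    then have "x = last (a0 # q)" by (simp add: q)
    then have "card (nbrs E x) = 1" by (rule d1)
    then obtain z where "nbrs E x = {z}" by (rule card_1_singletonE)
    then have "u = a" using a_nbrs u_nbrs by simp
    then show ?thesis using axp by (simp add: insert_commute)
  next
    case (Cons b zs)
    have p2: "a0 # q = (ys @ [a]) @ x # b # zs" unfolding p1 Cons by simp
    have "last (a0 # q) \<in> set (b # zs)" unfolding p2 by simp
    moreover have "x \<notin> set (b # zs)" using dist unfolding p2 by simp
    ultimately have "x \<noteq> last (a0 # q)" by metis
    then have c2: "card (nbrs E x) \<le> 2" by (rule d2)
    have "{x, b} \<in> E" using successively_mid[of "adj (V, E)" "ys @ [a]" x b zs] succ unfolding p2 by (simp add: adj_iff)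
    then have b_nbrs: "b \<in> nbrs E x" by (simp add: nbrs_def)
    have "a \<noteq> b" using dist unfolding p2 by auto
    then have "card {a, b} = 2" by simp
    then have "{a, b} = nbrs E x" using card_seteq[OF fnb, of "{a, b}"] a_nbrs b_nbrs c2 by simp
    then have "u = a \<or> u = b" using u_nbrs by auto
    moreover have "{x, b} \<in> list_edges (a0 # q)" unfolding p2 by (rule list_edges_mid)
    ultimately show ?thesis using axp by (metis insert_commute)
  qed
qed

lemma gamma_spec_path:
  assumes "distinct p" "p \<noteq> []"
  shows "gamma_spec (set p) (building_set (set p, list_edges p)) (hd p) ((attach_root [:0, 1:] ^^ (length p - 1)) 1)"
  using assms
proof (induction p rule: list_edges.induct)
  case (2 a)
  have "building_set ({a}, {}) = {{a}}" by (auto simp: building_set_linked linked_single)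
  then show ?case using gamma_spec_point[of a] by simp
next
  case (3 a b r)
  interpret P: pendant "building_set (set (b # r), list_edges (b # r))" "set (b # r)"
    "building_set (insert a (set (b # r)), insert {a, b} (list_edges (b # r)))" a b
    by (rule pendant_building_set) (use 3(2) list_edges_subset[of _ "b # r"] in auto)
  have "gamma_spec (set (b # r)) (building_set (set (b # r), list_edges (b # r))) b ((attach_root [:0, 1:] ^^ length r) 1)"
    using 3 by simp
  then show ?case using P.gamma_spec_pendant by simp
qed simp

text \<open>
  Walking along a path that hangs at the root, and making each vertex the new root in turn,
  applies \<open>attach_root\<close> once per step.
\<close>

lemma gamma_spec_tail:
  assumes "gamma_spec V (building_set (V, E)) c \<alpha>" "finite V" "c \<in> V" "\<And>e. e \<in> E \<Longrightarrow> e \<subseteq> V"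
    "distinct ps" "set ps \<inter> V = {}"
  shows "gamma_spec (V \<union> set ps) (building_set (V \<union> set ps, E \<union> list_edges (c # ps))) (last (c # ps))
    ((attach_root [:0, 1:] ^^ length ps) \<alpha>)"
  using assms
proof (induction ps arbitrary: V E c \<alpha>)
  case Nil then show ?case by simp
next
  case (Cons b r)
  have bV: "b \<notin> V" using Cons.prems(6) by auto
  interpret P: pendant "building_set (V, E)" V "building_set (insert b V, insert {b, c} E)" b c
    by (rule pendant_building_set) (use Cons.prems bV in auto)
  have "gamma_spec (insert b V \<union> set r) (building_set (insert b V \<union> set r, insert {b, c} E \<union> list_edges (b # r))) (last (b # r))
    ((attach_root [:0, 1:] ^^ length r) (attach_root [:0, 1:] \<alpha>))"
  proof (rule Cons.IH)
    show "gamma_spec (insert b V) (building_set (insert b V, insert {b, c} E)) b (attach_root [:0, 1:] \<alpha>)"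
      by (rule P.gamma_spec_pendant) (rule Cons.prems)
    show "finite (insert b V)" using Cons.prems(2) by simp
    show "b \<in> insert b V" by simp
    show "e \<subseteq> insert b V" if "e \<in> insert {b, c} E" for e using that Cons.prems(3,4) by auto
    show "distinct r" "set r \<inter> insert b V = {}" using Cons.prems(5,6) by auto
  qed
  moreover have "insert b V \<union> set r = V \<union> set (b # r)" by simp
  moreover have "insert {b, c} E \<union> list_edges (b # r) = E \<union> list_edges (c # b # r)" by (simp add: insert_commute)
  moreover have "(attach_root [:0, 1:] ^^ length r) (attach_root [:0, 1:] \<alpha>) = (attach_root [:0, 1:] ^^ length (b # r)) \<alpha>"
    by (simp add: funpow_swap1)
  ultimately show ?case by simp
qed

lemma graph_dist_le:
  assumes "graph_path G p" "hd p = u" "last p = v"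
  shows "graph_dist G u v \<le> length p - 1"
proof -
  have "p \<noteq> []" using assms(1) by (simp add: graph_path_def)
  then have "length p = Suc (length p - 1)" by simp
  then show ?thesis unfolding graph_dist_def using assms by (intro Least_le exI[of _ p]) simp
qed

lemma graph_dist_attained:
  assumes "graph_path G q" "hd q = u" "last q = v"
  shows "\<exists>p. graph_path G p \<and> hd p = u \<and> last p = v \<and> length p = Suc (graph_dist G u v)"
proof -
  have "q \<noteq> []" using assms(1) by (simp add: graph_path_def)
  then have "length q = Suc (length q - 1)" by simp
  then have "\<exists>k. \<exists>p. graph_path G p \<and> hd p = u \<and> last p = v \<and> length p = Suc k" using assms by blast
  then show ?thesis unfolding graph_dist_def by (rule LeastI_ex)
qed

lemma relabel_edge:
  assumes "inj_on f V" "\<And>e. e \<in> E \<Longrightarrow> e \<subseteq> V" "a \<in> V" "b \<in> V"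
  shows "{f a, f b} \<in> (`) f ` E \<longleftrightarrow> {a, b} \<in> E"
proof
  assume "{f a, f b} \<in> (`) f ` E"
  then obtain e where e: "e \<in> E" "f ` {a, b} = f ` e" by auto
  then have "{a, b} = e" using inj_on_image_eq_iff[OF assms(1), of "{a, b}" e] assms by simp
  then show "{a, b} \<in> E" using e by simp
next
  assume "{a, b} \<in> E"
  then have "f ` {a, b} \<in> (`) f ` E" by (rule imageI)
  then show "{f a, f b} \<in> (`) f ` E" by simp
qed

lemma linked_relabel:
  assumes "inj_on f V" "I \<subseteq> V" "\<And>e. e \<in> E \<Longrightarrow> e \<subseteq> V"
  shows "linked ((`) f ` E) (f ` I) \<longleftrightarrow> linked E I"
proof -
  note edge = relabel_edge[OF assms(1,3)]
  show ?thesis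
  proof
    assume L: "linked ((`) f ` E) (f ` I)"
    show "linked E I"
    proof (rule linkedI)
      fix S x assume S: "S \<subseteq> I" "x \<in> S" "\<And>a b. a \<in> S \<Longrightarrow> b \<in> I \<Longrightarrow> {a, b} \<in> E \<Longrightarrow> b \<in> S"
      have "f ` S = f ` I"
      proof (rule linkedD[OF L])
        show "f ` S \<subseteq> f ` I" "f x \<in> f ` S" using S by auto
        fix a b assume "a \<in> f ` S" "b \<in> f ` I" and e: "{a, b} \<in> (`) f ` E"
        then obtain a' b' where ab: "a = f a'" "b = f b'" "a' \<in> S" "b' \<in> I" by blast
        have "a' \<in> V" "b' \<in> V" using ab S(1) assms(2) by blast+
        then have "{a', b'} \<in> E" using edge e ab by simp
        then have "b' \<in> S" by (rule S(3)[OF ab(3,4)])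
        then show "b \<in> f ` S" using ab by blast
      qed
      then have "S = I" using inj_on_image_eq_iff[OF assms(1), of S I] S(1) assms(2) by blast
      then show "I \<subseteq> S" by simp
    qed
  next
    assume R: "linked E I"
    show "linked ((`) f ` E) (f ` I)"
    proof (rule linkedI)
      fix S x assume S: "S \<subseteq> f ` I" "x \<in> S" "\<And>a b. a \<in> S \<Longrightarrow> b \<in> f ` I \<Longrightarrow> {a, b} \<in> (`) f ` E \<Longrightarrow> b \<in> S"
      obtain x' where x': "x = f x'" "x' \<in> I" using S by blast
      have "{y \<in> I. f y \<in> S} = I"
      proof (rule linkedD[OF R])
        show "{y \<in> I. f y \<in> S} \<subseteq> I" "x' \<in> {y \<in> I. f y \<in> S}" using x' S by auto
        fix a b assume ab: "a \<in> {y \<in> I. f y \<in> S}" "b \<in> I" "{a, b} \<in> E"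
        then have "{f a, f b} \<in> (`) f ` E" using edge assms(2) by blast
        then have "f b \<in> S" using S(3)[of "f a" "f b"] ab by blast
        then show "b \<in> {y \<in> I. f y \<in> S}" using ab by blast
      qed
      then show "f ` I \<subseteq> S" by blast
    qed
  qed
qed

lemma building_set_relabel:
  assumes "inj_on f V" "\<And>e. e \<in> E \<Longrightarrow> e \<subseteq> V"
  shows "building_set (f ` V, (`) f ` E) = (`) f ` building_set (V, E)"
proof (intro set_eqI iffI)
  fix J assume "J \<in> building_set (f ` V, (`) f ` E)"
  then have J: "J \<subseteq> f ` V" "J \<noteq> {}" "linked ((`) f ` E) J" by (simp_all add: building_set_linked)
  then obtain I where I: "I \<subseteq> V" "J = f ` I" by (metis subset_imageE)
  then have "I \<in> building_set (V, E)" using J linked_relabel[OF assms(1) I(1) assms(2)] by (simp add: building_set_linked)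
  then show "J \<in> (`) f ` building_set (V, E)" using I by blast
next
  fix J assume "J \<in> (`) f ` building_set (V, E)"
  then obtain I where I: "J = f ` I" "I \<subseteq> V" "I \<noteq> {}" "linked E I" by (auto simp: building_set_linked)
  then show "J \<in> building_set (f ` V, (`) f ` E)"
    using linked_relabel[OF assms(1) I(2) assms(2)] by (auto simp: building_set_linked)
qed

text \<open>
  The data of a tree shift of a tree. The set \<open>A\<close> introduced below consists of
  all vertices outside \<open>F\<close>, so the graph is \<open>A\<close> and \<open>insert c
  F\<close> glued at \<open>c\<close>, and the shifted graph is \<open>A\<close> and
  \<open>insert l F\<close> glued at \<open>l\<close>. Moreover \<open>A\<close> is
  \<open>V0\<close> with the path \<open>c # ps\<close> hanging at \<open>c\<close>.
\<close>

locale shift_data =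
  fixes V :: "'a set" and E c cs l F
  assumes data: "tree_shift_data (V, E) c cs l F" and tree: "tree_graph (V, E)"
begin

abbreviation "ps \<equiv> cs @ [l]"

lemma finV: "finite V" and edgeV: "e \<in> E \<Longrightarrow> e \<subseteq> V" and edge2: "e \<in> E \<Longrightarrow> card e = 2"
  using tree by (auto simp: tree_graph_def simple_graph_def)

lemma conn: "linked E V"
  using tree by (simp add: tree_graph_def graph_connected_linked)

lemma path: "graph_path (V, E) (c # ps)"
  using data by (simp add: tree_shift_data_def)

lemma path': "distinct (c # ps)" "set (c # ps) \<subseteq> V" "successively (adj (V, E)) (c # ps)"
  using path by (simp_all add: graph_path_def)

lemma deg_card: "deg (V, E) v = card (nbrs E v)"
  by (rule deg_nbrs) (rule edgeV)

lemma leaf_l: "card (nbrs E l) = 1"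
  using data by (simp add: tree_shift_data_def leaf_def deg_card)

lemma nearest: "v \<in> V \<Longrightarrow> card (nbrs E v) > 2 \<Longrightarrow> graph_dist (V, E) l c \<le> graph_dist (V, E) l v"
  using data by (simp add: tree_shift_data_def deg_card)

lemma F_sub: "F \<subseteq> V - set (c # ps)"
  using data by (simp add: tree_shift_data_def)

lemma F_adj: "{u, v} \<in> E \<Longrightarrow> v \<in> F \<Longrightarrow> u \<in> insert c F"
proof -
  assume a: "{u, v} \<in> E" "v \<in> F"
  then have "u \<in> V" using edgeV by blast
  moreover have "\<forall>u\<in>V - insert c F. \<forall>v\<in>F. \<not> adj (V, E) u v" using data by (simp add: tree_shift_data_def)
  ultimately show "u \<in> insert c F" using a by (auto simp: adj_iff)
qed

lemma rest: "V - (F \<union> set (c # ps)) \<noteq> {}"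
  using data by (simp add: tree_shift_data_def)

text \<open>
  Let \<open>x\<close> be the last vertex of degree greater than two on the path before
  \<open>l\<close>. Beyond \<open>x\<close> the path has no side branches, so a shortest path
  from \<open>l\<close> to \<open>c\<close> passes through \<open>x\<close>, and
  \<open>x\<close> would be closer to \<open>l\<close> than \<open>c\<close>.
\<close>

lemma inner_degree:
  assumes "x \<in> set cs"
  shows "card (nbrs E x) \<le> 2"
proof (rule ccontr)
  assume "\<not> card (nbrs E x) \<le> 2"
  then have "\<exists>x\<in>set cs. card (nbrs E x) > 2" using assms by (intro bexI[of _ x]) auto
  then obtain xs x zs where cs: "cs = xs @ x # zs" and big: "card (nbrs E x) > 2" and small: "\<forall>z\<in>set zs. \<not> card (nbrs E z) > 2"
    by (rule split_list_last_propE)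
  let ?q = "zs @ [l]"
  have full: "c # ps = (c # xs) @ x # ?q" by (simp add: cs)
  have sub: "graph_path (V, E) (x # ?q)"
    using path unfolding full graph_path_def successively_append_iff by simp
  have closed: "u \<in> set (x # ?q)" if "d \<in> set ?q" "{d, u} \<in> E" for d u
  proof -
    have "{d, u} \<in> list_edges (x # ?q)"
    proof (rule path_nbrs[OF sub that(1) finV edgeV _ _ that(2)])
      show "card (nbrs E d) \<le> 2" if "d \<noteq> last (x # ?q)" using small that \<open>d \<in> set ?q\<close> by auto
      show "card (nbrs E d) = 1" if "d = last (x # ?q)" using leaf_l that by simp
    qed
    then show ?thesis using list_edges_subset by fast
  qed
  have "graph_path (V, E) (rev (c # ps))" 
    using path unfolding graph_path_def by (simp only: set_rev distinct_rev rev_is_Nil_conv successively_rev) (simp add: adj_def insert_commute)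
  moreover have "hd (rev (c # ps)) = l" "last (rev (c # ps)) = c" by simp_all
  ultimately obtain p where p: "graph_path (V, E) p" "hd p = l" "last p = c" "length p = Suc (graph_dist (V, E) l c)"
    using graph_dist_attained by metis
  have pp: "p \<noteq> []" "set p \<subseteq> V" "distinct p" "successively (adj (V, E)) p" using p(1) by (simp_all add: graph_path_def)
  have cx: "c \<notin> set (x # ?q)" using path'(1) unfolding full by auto
  have "hd p \<notin> - set ?q" "last p \<in> - set ?q" using p cx by auto
  then obtain as a b bs where ab: "p = as @ a # b # bs" "a \<in> set ?q" "b \<notin> set ?q" "{a, b} \<in> E"
    using successively_crossing[OF pp(4,1), of "- set ?q"] by (auto simp: adj_iff)
  have bx: "b = x" using closed[OF ab(2,4)] ab(3) by simp
  have "bs \<noteq> []"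
  proof
    assume "bs = []"
    then have "c = x" using p(3) ab(1) bx by simp
    then show False using cx by simp
  qed
  have p1: "p = (as @ [a, b]) @ bs" using ab(1) by simp
  have "graph_path (V, E) (as @ [a, b])"
    using p(1) unfolding p1 graph_path_def successively_append_iff by simp
  moreover have "hd (as @ [a, b]) = l" using p(2) unfolding p1 by (cases as) auto
  moreover have "last (as @ [a, b]) = x" using bx by simp
  ultimately have "graph_dist (V, E) l x \<le> length (as @ [a, b]) - 1" by (rule graph_dist_le)
  moreover have "length (as @ [a, b]) < length p" using \<open>bs \<noteq> []\<close> unfolding p1 by simp
  ultimately have "graph_dist (V, E) l x < graph_dist (V, E) l c" using p(4) by simp
  moreover have "x \<in> V" using path'(2) unfolding full by auto
  ultimately show False using nearest[OF _ big] by simp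
qed

lemma tail_edges:
  assumes "x \<in> set ps" "{x, u} \<in> E"
  shows "{x, u} \<in> list_edges (c # ps)"
proof (rule path_nbrs[OF path assms(1) finV edgeV _ _ assms(2)])
  show "card (nbrs E x) \<le> 2" if "x \<noteq> last (c # ps)" using inner_degree assms(1) that by auto
  show "card (nbrs E x) = 1" if "x = last (c # ps)" using leaf_l that by simp
qed

definition "V0 = V - F - set ps"
definition "E0 = {e \<in> E. e \<subseteq> V0}"
definition "EF = {e \<in> E. e \<subseteq> insert c F}"
definition "A = V0 \<union> set ps"
definition "EA = E0 \<union> list_edges (c # ps)"

lemma c_V0: "c \<in> V0"
  using path'(1,2) F_sub by (auto simp: V0_def)

lemma A_eq: "A = V - F"
  using path'(2) F_sub by (auto simp: A_def V0_def)

lemma V_eq: "A \<union> insert c F = V"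
  using F_sub c_V0 unfolding A_eq by (auto simp: V0_def)

lemma A_F: "A \<inter> insert c F = {c}"
  using c_V0 path' F_sub by (auto simp: A_eq V0_def)

lemma E_eq: "E = EA \<union> EF"
proof (intro set_eqI iffI)
  fix e assume e: "e \<in> E"
  then obtain u v where uv: "e = {u, v}" using edge2 by (metis card_2_iff)
  have uvV: "u \<in> V" "v \<in> V" using edgeV[OF e] uv by auto
  consider "u \<in> set ps" | "v \<in> set ps" | "u \<in> F" | "v \<in> F" | "u \<in> V0" "v \<in> V0"
    using uvV by (auto simp: V0_def)
  then show "e \<in> EA \<union> EF"
  proof cases
    case 1 then show ?thesis using tail_edges[of u v] e uv by (simp add: EA_def)
  next
    case 2 then show ?thesis using tail_edges[of v u] e uv by (simp add: EA_def insert_commute)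
  next
    case 3 then have "v \<in> insert c F" using F_adj[of v u] e uv by (simp add: insert_commute)
    then show ?thesis using 3 e uv by (simp add: EF_def)
  next
    case 4 then have "u \<in> insert c F" using F_adj[of u v] e uv by simp
    then show ?thesis using 4 e uv by (simp add: EF_def)
  next
    case 5 then show ?thesis using e uv by (simp add: EA_def E0_def)
  qed
next
  fix e assume "e \<in> EA \<union> EF"
  then show "e \<in> E" using path_edges[OF path'(3)] by (auto simp: EA_def E0_def EF_def)
qed

lemma EA_sub: "e \<in> EA \<Longrightarrow> e \<subseteq> A"
  using list_edges_subset[of e "c # ps"] c_V0 by (auto simp: EA_def E0_def A_def)

lemma EF_sub: "e \<in> EF \<Longrightarrow> e \<subseteq> insert c F"
  by (simp add: EF_def)

lemma cF: "c \<notin> F" using F_sub by auto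

lemma l_facts: "l \<in> A" "l \<noteq> c" "l \<notin> F"
  using path'(1) F_sub by (auto simp: A_def)

lemma rtree_F: "rtree c (insert c F) EF"
proof (rule tree_graph_imp_rtree)
  show "tree_graph (insert c F, EF)" using data by (simp add: tree_shift_data_def induced_def EF_def)
qed simp

lemma finF: "finite F" using finV F_sub finite_subset by fast

lemma sub_tree:
  assumes "W \<subseteq> V" "linked {e \<in> E. e \<subseteq> W} W" "x \<in> W"
  shows "rtree x W {e \<in> E. e \<subseteq> W}"
proof (rule tree_graph_imp_rtree[OF _ assms(3)])
  have "graph_acyclic (W, {e \<in> E. e \<subseteq> W})"
    unfolding graph_acyclic_def
  proof
    assume "\<exists>p. graph_path (W, {e \<in> E. e \<subseteq> W}) p \<and> 3 \<le> length p \<and> adj (W, {e \<in> E. e \<subseteq> W}) (last p) (hd p)"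
    then obtain p where p: "graph_path (W, {e \<in> E. e \<subseteq> W}) p" "3 \<le> length p" "adj (W, {e \<in> E. e \<subseteq> W}) (last p) (hd p)" by blast
    have "successively (adj (V, E)) p" using p(1) unfolding graph_path_def
      by (auto elim!: successively_mono simp: adj_iff)
    then have "graph_path (V, E) p" using p(1) assms(1) by (auto simp: graph_path_def)
    moreover have "adj (V, E) (last p) (hd p)" using p(3) by (simp add: adj_iff)
    ultimately show False using tree p(2) unfolding tree_graph_def graph_acyclic_def by blast
  qed
  then show "tree_graph (W, {e \<in> E. e \<subseteq> W})"
    using assms finite_subset[OF assms(1) finV] edge2
    by (auto simp: tree_graph_def simple_graph_def graph_connected_linked)
qed

lemma EA_eq: "EA = {e \<in> E. e \<subseteq> A}"
proof (intro set_eqI iffI)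
  fix e assume "e \<in> {e \<in> E. e \<subseteq> A}"
  then have e: "e \<in> E" "e \<subseteq> A" by auto
  show "e \<in> EA"
  proof (rule ccontr)
    assume "e \<notin> EA"
    then have "e \<subseteq> insert c F" using e E_eq EF_sub by blast
    then have "e \<subseteq> {c}" using e(2) A_F by blast
    then have "card e \<le> 1" by (metis card.empty card_mono finite.simps is_singletonI is_singleton_altdef)
    then show False using edge2[OF e(1)] by simp
  qed
qed (use E_eq EA_sub in blast)

lemma rtree_A: "x \<in> A \<Longrightarrow> rtree x A EA"
  unfolding EA_eq
proof (rule sub_tree)
  show "A \<subseteq> V" by (auto simp: A_eq)
  have "linked EA (V \<inter> A)"
    by (rule linked_wedge_restrict[OF A_F EA_sub EF_sub]) (use V_eq E_eq conn in auto)
  moreover have "V \<inter> A = A" by (auto simp: A_eq)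
  ultimately show "linked {e \<in> E. e \<subseteq> A} A" by (simp add: EA_eq)
qed

lemma rtree_V0: "rtree c V0 E0"
  unfolding E0_def
proof (rule sub_tree[OF _ _ c_V0])
  show "V0 \<subseteq> V" by (auto simp: V0_def)
  have eq: "V0 \<inter> (insert c (F \<union> set ps)) = {c}" using c_V0 by (auto simp: V0_def)
  have "linked E0 (V \<inter> V0)"
  proof (rule linked_wedge_restrict[OF eq])
    show "e \<subseteq> V0" if "e \<in> E0" for e using that by (simp add: E0_def)
    show "e \<subseteq> insert c (F \<union> set ps)" if "e \<in> list_edges (c # ps) \<union> EF" for e
      using that list_edges_subset[of e "c # ps"] EF_sub by auto
    show "V \<subseteq> V0 \<union> insert c (F \<union> set ps)" by (auto simp: V0_def)
    show "linked (E0 \<union> (list_edges (c # ps) \<union> EF)) V" using conn E_eq by (simp add: EA_def Un_assoc)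
  qed
  moreover have "V \<inter> V0 = V0" by (auto simp: V0_def)
  ultimately show "linked {e \<in> E. e \<subseteq> V0} V0" by (simp add: E0_def)
qed

definition "\<sigma> x = (if x = c then l else x)"
definition "EF' = (`) \<sigma> ` EF"
definition "E' = EA \<union> EF'"

lemma sigma_image: "\<sigma> ` insert c F = insert l F"
  using cF by (auto simp: \<sigma>_def)

lemma sigma_inj: "inj_on \<sigma> (insert c F)"
  using l_facts cF by (auto simp: inj_on_def \<sigma>_def)

lemma rtree_F': "rtree l (insert l F) EF'"
  using rtree_relabel[OF rtree_F sigma_inj] unfolding sigma_image EF'_def by (simp add: \<sigma>_def)

lemma EF'_sub: "e \<in> EF' \<Longrightarrow> e \<subseteq> insert l F"
  by (rule rtree_edges(1)[OF rtree_F'])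

lemma A_F': "A \<inter> insert l F = {l}"
  using l_facts by (auto simp: A_eq)

lemma V_eq': "A \<union> insert l F = V"
  using V_eq l_facts c_V0 by (auto simp: A_def)

lemma tree': "tree_graph (V, E')"
  using rtree_imp_tree_graph[OF rtree_wedge[OF rtree_F' rtree_A[OF l_facts(1)] A_F']] unfolding V_eq' E'_def .

lemma shift_eq: "shift_graph (V, E) c l F = (V, E')"
proof -
  have "(E - {{v, c} | v. v \<in> F}) \<union> {{v, l} | v. v \<in> F \<and> {v, c} \<in> E} = E'"
  proof (intro set_eqI iffI)
    fix e assume "e \<in> (E - {{v, c} | v. v \<in> F}) \<union> {{v, l} | v. v \<in> F \<and> {v, c} \<in> E}"
    then consider "e \<in> E" "e \<notin> {{v, c} | v. v \<in> F}" | v where "e = {v, l}" "v \<in> F" "{v, c} \<in> E" by auto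
    then show "e \<in> E'"
    proof cases
      case 1
      show ?thesis
      proof (cases "e \<in> EA")
        case False
        then have eF: "e \<in> EF" using 1 E_eq by blast
        have "c \<notin> e"
        proof
          assume "c \<in> e"
          obtain u v where uv: "e = {u, v}" "u \<noteq> v" using edge2[OF 1(1)] by (auto simp: card_2_iff)
          then obtain w where "e = {w, c}" "w \<noteq> c" using \<open>c \<in> e\<close> by auto
          then show False using EF_sub[OF eF] 1(2) by auto
        qed
        then have "\<sigma> ` e = e" by (auto simp: \<sigma>_def image_iff)
        then have "e \<in> EF'" unfolding EF'_def using eF by (metis imageI)
        then show ?thesis by (simp add: E'_def)
      qed (simp add: E'_def)
    next
      case 2
      then have "{v, c} \<in> EF" by (simp add: EF_def)
      then have "\<sigma> ` {v, c} \<in> EF'" unfolding EF'_def by (rule imageI)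
      moreover have "\<sigma> ` {v, c} = e" using 2 cF by (auto simp: \<sigma>_def)
      ultimately show ?thesis by (simp add: E'_def)
    qed
  next
    fix e assume "e \<in> E'"
    then consider "e \<in> EA" | e0 where "e0 \<in> EF" "e = \<sigma> ` e0" by (auto simp: E'_def EF'_def)
    then show "e \<in> (E - {{v, c} | v. v \<in> F}) \<union> {{v, l} | v. v \<in> F \<and> {v, c} \<in> E}"
    proof cases
      case 1
      then have "e \<subseteq> A" "e \<in> E" using EA_sub E_eq by auto
      then show ?thesis by (auto simp: A_eq)
    next
      case 2
      have e0: "e0 \<in> E" "e0 \<subseteq> insert c F" using 2(1) by (auto simp: EF_def)
      obtain u v where uv: "e0 = {u, v}" "u \<noteq> v" using edge2[OF e0(1)] by (auto simp: card_2_iff)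
      show ?thesis
      proof (cases "c \<in> e0")
        case True
        then obtain w where w: "e0 = {w, c}" "w \<noteq> c" using uv by auto
        then have "w \<in> F" using e0(2) by auto
        moreover have "e = {w, l}" using w 2(2) by (auto simp: \<sigma>_def)
        ultimately show ?thesis using e0(1) w(1) by auto
      next
        case False
        then have "e = e0" using 2(2) by (auto simp: \<sigma>_def image_iff)
        then show ?thesis using e0(1) False by auto
      qed
    qed
  qed
  then show ?thesis by (simp add: shift_graph_def adj_iff)
qed

text \<open>
  Root \<open>A\<close> at \<open>c\<close> before the shift and at \<open>l\<close> after it,
  and compare the two with \<open>merge_product_path_ge\<close>; the part \<open>F\<close>
  contributes the same factor \<open>\<zeta>\<close> to both.
\<close>

lemma gamma_shift:
  "\<exists>\<alpha> \<alpha>' d. gamma_spec V (building_set (V, E)) c \<alpha> \<and> gamma_spec V (building_set (V, E')) l \<alpha>' \<and> \<alpha> = \<alpha>' + d"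
proof -
  let ?x = "[:0, 1:] :: nat poly"
  obtain \<epsilon> where eps: "gamma_spec V0 (building_set (V0, E0)) c \<epsilon>" using gamma_spec_exists[OF rtree_V0] by blast
  obtain \<zeta> where zeta: "gamma_spec (insert c F) (building_set (insert c F, EF)) c \<zeta>" using gamma_spec_exists[OF rtree_F] by blast
  have E0_sub: "e \<subseteq> V0" if "e \<in> E0" for e using that by (simp add: E0_def)
  have finV0: "finite V0" using finV by (simp add: V0_def)
  have disj: "set ps \<inter> V0 = {}" "distinct ps" using path'(1) by (auto simp: V0_def)
  let ?m = "length ps"
  have tail: "gamma_spec A (building_set (A, EA)) l ((attach_root ?x ^^ ?m) \<epsilon>)"
    using gamma_spec_tail[OF eps finV0 c_V0 E0_sub disj(2,1)] unfolding A_def EA_def by simp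
  have head: "gamma_spec A (building_set (A, EA)) c (merge_product ?x \<epsilon> ((attach_root ?x ^^ ?m) 1))"
  proof -
    have "wedge (building_set (V0, E0)) V0 (building_set (set (c # ps), list_edges (c # ps))) (set (c # ps))
        (building_set (V0 \<union> set (c # ps), E0 \<union> list_edges (c # ps))) c"
    proof (rule wedge_building_set[OF finV0 _ _ E0_sub list_edges_subset])
      show "V0 \<inter> set (c # ps) = {c}" using disj c_V0 by auto
    qed auto
    moreover have "V0 \<union> set (c # ps) = A" using c_V0 by (auto simp: A_def)
    ultimately interpret W: wedge "building_set (V0, E0)" V0 "building_set (set (c # ps), list_edges (c # ps))" "set (c # ps)"
        "building_set (A, EA)" c by (simp add: EA_def)
    have "gamma_spec (set (c # ps)) (building_set (set (c # ps), list_edges (c # ps))) c ((attach_root ?x ^^ ?m) 1)"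
      using gamma_spec_path[OF path'(1)] by simp
    then show ?thesis using W.gamma_spec_wedge[OF eps] \<open>V0 \<union> set (c # ps) = A\<close> by simp
  qed
  obtain d where d: "merge_product ?x \<epsilon> ((attach_root ?x ^^ ?m) 1) = (attach_root ?x ^^ ?m) \<epsilon> + d" using merge_product_path_ge by blast
  have finA: "finite A" using finV by (simp add: A_eq)
  have "wedge (building_set (A, EA)) A (building_set (insert c F, EF)) (insert c F) (building_set (A \<union> insert c F, EA \<union> EF)) c"
    by (rule wedge_building_set[OF finA _ A_F EA_sub EF_sub]) (use finF in auto)
  then interpret G: wedge "building_set (A, EA)" A "building_set (insert c F, EF)" "insert c F" "building_set (V, E)" c
    by (simp only: V_eq E_eq[symmetric])
  have "wedge (building_set (A, EA)) A (building_set (insert l F, EF')) (insert l F) (building_set (A \<union> insert l F, EA \<union> EF')) l"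
    by (rule wedge_building_set[OF finA _ A_F' EA_sub EF'_sub]) (use finF in auto)
  then interpret G': wedge "building_set (A, EA)" A "building_set (insert l F, EF')" "insert l F" "building_set (V, E')" l
    by (simp only: V_eq' E'_def[symmetric])
  have "building_set (insert l F, EF') = (`) \<sigma> ` building_set (insert c F, EF)"
    unfolding sigma_image[symmetric] EF'_def by (rule building_set_relabel[OF sigma_inj EF_sub])
  moreover have "gamma_spec (insert l F) ((`) \<sigma> ` building_set (insert c F, EF)) l \<zeta>"
    using gamma_spec_relabel[OF building_building_set sigma_inj _ zeta] finF unfolding sigma_image by (simp add: \<sigma>_def)
  ultimately have zeta': "gamma_spec (insert l F) (building_set (insert l F, EF')) l \<zeta>" by simp
  have g: "gamma_spec V (building_set (V, E)) c (merge_product ?x (merge_product ?x \<epsilon> ((attach_root ?x ^^ ?m) 1)) \<zeta>)"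
    using G.gamma_spec_wedge[OF head zeta] unfolding V_eq .
  have g': "gamma_spec V (building_set (V, E')) l (merge_product ?x ((attach_root ?x ^^ ?m) \<epsilon>) \<zeta>)"
    using G'.gamma_spec_wedge[OF tail zeta'] unfolding V_eq' .
  show ?thesis
    using g g' unfolding d bilin_add_left by blast
qed

end

section \<open>Leaves and single shifts\<close>

definition leaf_count :: "'a set \<Rightarrow> 'a set set \<Rightarrow> nat" where
  "leaf_count V E = card {v \<in> V. card (nbrs E v) = 1}"

lemma nbrs_relabel:
  assumes "inj_on f V" "\<And>e. e \<in> E \<Longrightarrow> e \<subseteq> V" "v \<in> V"
  shows "nbrs ((`) f ` E) (f v) = f ` nbrs E v"
proof (intro set_eqI iffI)
  fix y assume "y \<in> nbrs ((`) f ` E) (f v)"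
  then have y: "{f v, y} \<in> (`) f ` E" by (simp add: nbrs_def)
  then obtain e where "e \<in> E" "{f v, y} = f ` e" by blast
  then have "y \<in> f ` V" using assms(2)[of e] by blast
  then obtain u where u: "u \<in> V" "y = f u" by blast
  then have "{v, u} \<in> E" using y relabel_edge[OF assms(1,2) assms(3) u(1)] by simp
  then show "y \<in> f ` nbrs E v" using u by (simp add: nbrs_def)
next
  fix y assume "y \<in> f ` nbrs E v"
  then obtain u where u: "y = f u" "{v, u} \<in> E" by (auto simp: nbrs_def)
  then have "u \<in> V" using assms(2) by blast
  then show "y \<in> nbrs ((`) f ` E) (f v)" using relabel_edge[OF assms(1,2) assms(3)] u by (simp add: nbrs_def)
qed

lemma rtree_nbr:
  assumes "rtree c V E" "V \<noteq> {c}"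
  shows "\<exists>u\<in>V. u \<noteq> c \<and> {c, u} \<in> E"
proof (rule ccontr)
  assume n: "\<not> (\<exists>u\<in>V. u \<noteq> c \<and> {c, u} \<in> E)"
  have "{c} = V"
    by (rule linkedD[OF rtree_linked[OF assms(1)], of "{c}" c]) (use n rtree_root[OF assms(1)] in auto)
  then show False using assms(2) by simp
qed

lemma card_ge_2: "finite X \<Longrightarrow> a \<in> X \<Longrightarrow> b \<in> X \<Longrightarrow> a \<noteq> b \<Longrightarrow> card X \<ge> 2"
proof -
  assume "finite X" "a \<in> X" "b \<in> X" "a \<noteq> b"
  then have "card {a, b} \<le> card X" by (intro card_mono) auto
  then show ?thesis using \<open>a \<noteq> b\<close> by simp
qed

lemma rtree_finite_nbrs: "rtree c V E \<Longrightarrow> finite (nbrs E v)"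
  by (rule finite_subset[OF nbrs_subset rtree_finite]) (rule rtree_edges(1))

context shift_data
begin

lemma no_F: "F = {} \<Longrightarrow> E' = E"
proof -
  assume "F = {}"
  have "EF = {}"
  proof (rule ccontr)
    assume "EF \<noteq> {}"
    then obtain e where e: "e \<in> EF" by blast
    have "e \<subseteq> {c}" using EF_sub[OF e] \<open>F = {}\<close> by simp
    then have "card e \<le> card {c}" by (intro card_mono) auto
    then show False using rtree_edges(2)[OF rtree_F e] by simp
  qed
  then show "E' = E" using E_eq by (simp add: E'_def EF'_def)
qed

lemma nbrs_E: "nbrs E v = nbrs EA v \<union> nbrs EF v" unfolding nbrs_def using E_eq by blast
lemma nbrs_E': "nbrs E' v = nbrs EA v \<union> nbrs EF' v" by (auto simp: nbrs_def E'_def)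

lemma finite_nbrs': "finite (nbrs E' v)"
  unfolding nbrs_E' using rtree_finite_nbrs[OF rtree_A[OF l_facts(1)]] rtree_finite_nbrs[OF rtree_F'] by simp

text \<open>
  The vertex \<open>l\<close> gains a neighbour in \<open>F\<close> besides its neighbour on
  the path. The vertex \<open>c\<close> keeps its neighbour on the path and one in
  \<open>V0\<close>. All other degrees are unchanged.
\<close>

lemma leaves_shift:
  assumes "F \<noteq> {}"
  shows "leaf_count V E' < leaf_count V E"
  unfolding leaf_count_def
proof (rule psubset_card_mono)
  show "finite {v \<in> V. card (nbrs E v) = 1}" using finV by simp
  have lV: "l \<in> V" using l_facts by (simp add: A_eq)
  have l2: "card (nbrs E' l) \<ge> 2"
  proof -
    have "A \<noteq> {l}" using c_V0 l_facts by (auto simp: A_def)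
    then obtain u where u: "u \<in> A" "{l, u} \<in> EA" using rtree_nbr[OF rtree_A[OF l_facts(1)]] by blast
    have "insert l F \<noteq> {l}" using assms l_facts by auto
    then obtain w where w: "w \<in> F" "{l, w} \<in> EF'" using rtree_nbr[OF rtree_F'] by auto
    have "u \<in> nbrs E' l" "w \<in> nbrs E' l" unfolding nbrs_E' using u(2) w(2) by (simp_all add: nbrs_def)
    moreover have "u \<noteq> w" using u(1) w(1) by (auto simp: A_eq)
    ultimately show ?thesis by (rule card_ge_2[OF finite_nbrs'])
  qed
  have c2: "card (nbrs E' c) \<ge> 2"
  proof -
    obtain z where "z \<in> V - (F \<union> set (c # ps))" using rest by blast
    then have "z \<in> V0" "z \<noteq> c" by (simp_all add: V0_def)
    then have "V0 \<noteq> {c}" by blast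
    then obtain u where u: "u \<in> V0" "{c, u} \<in> E0" using rtree_nbr[OF rtree_V0] by blast
    have "{c, hd ps} \<in> list_edges (c # ps)" by (cases cs) auto
    then have "hd ps \<in> nbrs E' c" "u \<in> nbrs E' c" unfolding nbrs_E' EA_def using u(2) by (simp_all add: nbrs_def)
    moreover have "hd ps \<in> set ps" by (cases cs) auto
    then have "hd ps \<noteq> u" using u(1) by (auto simp: V0_def)
    ultimately show ?thesis by (rule card_ge_2[OF finite_nbrs'])
  qed
  have sub: "card (nbrs E v) = 1" if v: "v \<in> V" "card (nbrs E' v) = 1" for v
  proof (cases "v \<in> F")
    case True
    have "{v, u} \<notin> EA" for u using EA_sub[of "{v, u}"] True by (auto simp: A_eq)
    then have "nbrs EA v = {}" by (simp add: nbrs_def)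
    moreover have "nbrs EF' v = \<sigma> ` nbrs EF v"
    proof -
      have "\<sigma> v = v" using True cF by (auto simp: \<sigma>_def)
      then show ?thesis using nbrs_relabel[OF sigma_inj EF_sub, where v = v] True by (simp add: EF'_def)
    qed
    moreover have "inj_on \<sigma> (nbrs EF v)" by (rule inj_on_subset[OF sigma_inj nbrs_subset]) (rule EF_sub)
    ultimately show ?thesis using v(2) by (simp add: nbrs_E nbrs_E' card_image)
  next
    case False
    have vl: "v \<noteq> l" "v \<noteq> c" using v(2) l2 c2 by auto
    have "{v, u} \<notin> EF" "{v, u} \<notin> EF'" for u using EF_sub[of "{v, u}"] EF'_sub[of "{v, u}"] False vl by auto
    then have "nbrs EF v = {}" "nbrs EF' v = {}" by (simp_all add: nbrs_def)
    then show ?thesis using v(2) by (simp add: nbrs_E nbrs_E')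
  qed
  have "l \<in> {v \<in> V. card (nbrs E v) = 1}" using lV leaf_l by simp
  moreover have "l \<notin> {v \<in> V. card (nbrs E' v) = 1}" using l2 by simp
  moreover have "{v \<in> V. card (nbrs E' v) = 1} \<subseteq> {v \<in> V. card (nbrs E v) = 1}" using sub by blast
  ultimately show "{v \<in> V. card (nbrs E' v) = 1} \<subset> {v \<in> V. card (nbrs E v) = 1}" by blast
qed

end

definition gamma_le :: "'v::finite set set \<Rightarrow> 'v set set \<Rightarrow> bool" where
  "gamma_le E' E \<longleftrightarrow>
    (\<forall>i. coeff (gamma_building (building_set (UNIV, E'))) i \<le> coeff (gamma_building (building_set (UNIV, E))) i)"

lemma nested_building_set:
  fixes E :: "'v::finite set set"
  assumes "tree_graph (UNIV, E)"
  shows "nested (building_set (UNIV, E))"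
proof -
  interpret building "building_set (UNIV, E)" "UNIV :: 'v set" by (rule building_building_set) simp
  show ?thesis
    by unfold_locales (use assms in \<open>auto simp: building_set_linked tree_graph_def graph_connected_linked\<close>)
qed

lemma tree_shift_step:
  fixes E :: "'v::finite set set"
  assumes "tree_graph (UNIV, E)" "tree_shift (UNIV, E) G'"
  shows "\<exists>E'. G' = (UNIV, E') \<and> tree_graph (UNIV, E') \<and> (E' = E \<or> leaf_count UNIV E' < leaf_count UNIV E) \<and> gamma_le E' E"
proof -
  obtain c cs l F where d: "tree_shift_data (UNIV, E) c cs l F" "G' = shift_graph (UNIV, E) c l F"
    using assms(2) by (auto simp: tree_shift_def)
  interpret shift_data UNIV E c cs l F using d(1) assms(1) by unfold_locales
  obtain \<alpha> \<alpha>' \<delta> where g: "gamma_spec UNIV (building_set (UNIV, E)) c \<alpha>" "gamma_spec UNIV (building_set (UNIV, E')) l \<alpha>'" "\<alpha> = \<alpha>' + \<delta>"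
    using gamma_shift by blast
  have "gamma_building (building_set (UNIV, E)) = map_poly int (coeff \<alpha> 0)"
    by (rule nested.gamma_building_eq[OF nested_building_set[OF assms(1)] g(1)])
  moreover have "gamma_building (building_set (UNIV, E')) = map_poly int (coeff \<alpha>' 0)"
    by (rule nested.gamma_building_eq[OF nested_building_set[OF tree'] g(2)])
  ultimately have "gamma_le E' E" by (simp add: gamma_le_def g(3) coeff_map_poly)
  moreover have "E' = E \<or> leaf_count UNIV E' < leaf_count UNIV E" using no_F leaves_shift by blast
  ultimately show ?thesis using d(2) shift_eq tree' by blast
qed

lemma tree_shifts:
  fixes E :: "'v::finite set set"
  assumes "tree_shift\<^sup>*\<^sup>* (UNIV, E) G'" "tree_graph (UNIV, E)"
  shows "\<exists>E'. G' = (UNIV, E') \<and> tree_graph (UNIV, E') \<and> (E' = E \<or> leaf_count UNIV E' < leaf_count UNIV E) \<and> gamma_le E' E"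
  using assms(1)
proof (induction rule: rtranclp_induct)
  case base
  show ?case using assms(2) by (auto simp: gamma_le_def)
next
  case (step G' G'')
  then obtain E' where E': "G' = (UNIV, E')" "tree_graph (UNIV, E')" "E' = E \<or> leaf_count UNIV E' < leaf_count UNIV E" "gamma_le E' E"
    by blast
  obtain E'' where E'': "G'' = (UNIV, E'')" "tree_graph (UNIV, E'')" "E'' = E' \<or> leaf_count UNIV E'' < leaf_count UNIV E'" "gamma_le E'' E'"
    using tree_shift_step[OF E'(2)] step(2) E'(1) by blast
  have "gamma_le E'' E" using E'(4) E''(4) unfolding gamma_le_def by (meson order_trans)
  moreover have "E'' = E \<or> leaf_count UNIV E'' < leaf_count UNIV E" using E'(3) E''(3) by auto
  ultimately show ?case using E'' by blast
qed

section \<open>Relabelling\<close>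

definition relabel :: "('a \<Rightarrow> 'b) \<Rightarrow> 'a ugraph \<Rightarrow> 'b ugraph" where
  "relabel f G = (f ` verts G, (`) f ` edges G)"

lemma verts_relabel [simp]: "verts (relabel f G) = f ` verts G" by (simp add: relabel_def)

lemma adj_relabel: "inj f \<Longrightarrow> adj (relabel f G) (f a) (f b) \<longleftrightarrow> adj G a b"
  unfolding adj_def relabel_def using relabel_edge[of f UNIV "edges G" a b] by simp

lemma graph_path_relabel: "inj f \<Longrightarrow> graph_path (relabel f G) (map f p) \<longleftrightarrow> graph_path G p"
  unfolding graph_path_def
  by (simp add: successively_map adj_relabel distinct_map inj_image_subset_iff inj_on_subset[of f UNIV])

lemma deg_relabel: "inj f \<Longrightarrow> deg (relabel f G) (f v) = deg G v"
proof -
  assume f: "inj f"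
  have "{u \<in> verts (relabel f G). adj (relabel f G) (f v) u} = f ` {u \<in> verts G. adj G v u}"
    using adj_relabel[OF f, of G] by auto
  then show ?thesis by (simp add: deg_def card_image inj_on_subset[OF f])
qed

lemma graph_dist_relabel:
  assumes "bij f"
  shows "graph_dist (relabel f G) (f u) (f v) = graph_dist G u v"
proof -
  have f: "inj f" using assms by (rule bij_is_inj)
  have "(\<exists>p. graph_path (relabel f G) p \<and> hd p = f u \<and> last p = f v \<and> length p = Suc k) \<longleftrightarrow>
      (\<exists>p. graph_path G p \<and> hd p = u \<and> last p = v \<and> length p = Suc k)" for k
  proof
    assume "\<exists>p. graph_path (relabel f G) p \<and> hd p = f u \<and> last p = f v \<and> length p = Suc k"
    then obtain p where p: "graph_path (relabel f G) p" "hd p = f u" "last p = f v" "length p = Suc k" by blast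
    define q where "q = map (inv f) p"
    have pq: "p = map f q" using assms by (simp add: q_def surj_iff[symmetric] bij_is_surj surj_f_inv_f map_idI)
    then have "q \<noteq> []" using p(4) by auto
    then have "f (hd q) = f u" "f (last q) = f v" using p(2,3) by (simp_all add: pq hd_map last_map)
    then show "\<exists>p. graph_path G p \<and> hd p = u \<and> last p = v \<and> length p = Suc k"
      using p(1,4) f graph_path_relabel[OF f, of G q] pq by (intro exI[of _ q]) (auto dest: injD)
  next
    assume "\<exists>p. graph_path G p \<and> hd p = u \<and> last p = v \<and> length p = Suc k"
    then obtain p where p: "graph_path G p" "hd p = u" "last p = v" "length p = Suc k" by blast
    then have "p \<noteq> []" by auto
    then show "\<exists>p. graph_path (relabel f G) p \<and> hd p = f u \<and> last p = f v \<and> length p = Suc k"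
      using p graph_path_relabel[OF f, of G p] by (intro exI[of _ "map f p"]) (simp add: hd_map last_map)
  qed
  then show ?thesis by (simp add: graph_dist_def)
qed

lemma simple_graph_relabel: "inj f \<Longrightarrow> simple_graph G \<Longrightarrow> simple_graph (relabel f G)"
  by (auto simp: simple_graph_def relabel_def card_image inj_on_subset[of f UNIV])

lemma graph_connected_relabel:
  assumes "inj f" "simple_graph G" "graph_connected G"
  shows "graph_connected (relabel f G)"
proof -
  obtain V E where G: "G = (V, E)" by force
  have "\<And>e. e \<in> E \<Longrightarrow> e \<subseteq> V" using assms(2) by (simp add: simple_graph_def G)
  then show ?thesis
    using assms(3) linked_relabel[of f V V E] inj_on_subset[OF assms(1)] by (simp add: G relabel_def graph_connected_linked)
qed

lemma tree_graph_relabel: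
  assumes "inj f" "tree_graph G"
  shows "tree_graph (relabel f G)"
proof -
  obtain V E where G: "G = (V, E)" by force
  then have "V \<noteq> {}" using assms(2) by (simp add: tree_graph_def)
  then obtain c where "c \<in> V" by blast
  then have "rtree c V E" using tree_graph_imp_rtree assms(2) G by metis
  then have "rtree (f c) (f ` V) ((`) f ` E)" by (rule rtree_relabel) (rule inj_on_subset[OF assms(1)], simp)
  then show ?thesis using rtree_imp_tree_graph by (simp add: G relabel_def)
qed

lemma induced_relabel:
  assumes "inj f"
  shows "induced (relabel f G) (f ` I) = relabel f (induced G I)"
  unfolding induced_def relabel_def using inj_image_subset_iff[OF assms] by auto

lemma tree_shift_data_relabel:
  assumes f: "bij f" and d: "tree_shift_data G c cs l F"
  shows "tree_shift_data (relabel f G) (f c) (map f cs) (f l) (f ` F)"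
proof -
  have i: "inj f" using f by (rule bij_is_inj)
  have s: "set (f c # map f cs @ [f l]) = f ` set (c # cs @ [l])" by simp
  show ?thesis
    unfolding tree_shift_data_def
  proof (intro conjI)
    show "simple_graph (relabel f G)" "graph_connected (relabel f G)"
      using d simple_graph_relabel[OF i] graph_connected_relabel[OF i] by (simp_all add: tree_shift_data_def)
    show "leaf (relabel f G) (f l)" using d deg_relabel[OF i] by (simp add: tree_shift_data_def leaf_def)
    show "f c \<in> verts (relabel f G)" "2 < deg (relabel f G) (f c)" using d deg_relabel[OF i] by (simp_all add: tree_shift_data_def)
    show "\<forall>v\<in>verts (relabel f G). 2 < deg (relabel f G) v \<longrightarrow> graph_dist (relabel f G) (f l) (f c) \<le> graph_dist (relabel f G) (f l) v"
      using d by (simp add: tree_shift_data_def deg_relabel[OF i] graph_dist_relabel[OF f])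
    have "graph_path (relabel f G) (map f (c # cs @ [l]))" using d graph_path_relabel[OF i] unfolding tree_shift_data_def by blast
    then show "graph_path (relabel f G) (f c # map f cs @ [f l])" by simp
    have "F \<subseteq> verts G - set (c # cs @ [l])" using d unfolding tree_shift_data_def by blast
    then have "f ` F \<subseteq> f ` (verts G - set (c # cs @ [l]))" by (rule image_mono)
    then show "f ` F \<subseteq> verts (relabel f G) - set (f c # map f cs @ [f l])" unfolding s verts_relabel image_set_diff[OF i] .
    have "tree_graph (relabel f (induced G (insert c F)))" using d tree_graph_relabel[OF i] unfolding tree_shift_data_def by blast
    then show "tree_graph (induced (relabel f G) (insert (f c) (f ` F)))" using induced_relabel[OF i, of G "insert c F"] by simp
    show "\<forall>u\<in>verts (relabel f G) - insert (f c) (f ` F). \<forall>v\<in>f ` F. \<not> adj (relabel f G) u v"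
    proof (intro ballI)
      fix u v assume "u \<in> verts (relabel f G) - insert (f c) (f ` F)" "v \<in> f ` F"
      then obtain u' v' where uv: "u = f u'" "v = f v'" "u' \<in> verts G - insert c F" "v' \<in> F" by auto
      then have "\<not> adj G u' v'" using d unfolding tree_shift_data_def by blast
      then show "\<not> adj (relabel f G) u v" using adj_relabel[OF i, of G] uv by simp
    qed
    have "f ` (verts G - (F \<union> set (c # cs @ [l]))) \<noteq> {}" using d unfolding tree_shift_data_def by blast
    then show "verts (relabel f G) - (f ` F \<union> set (f c # map f cs @ [f l])) \<noteq> {}"
      unfolding s verts_relabel image_set_diff[OF i] image_Un .
  qed
qed

lemma shift_graph_relabel:
  assumes i: "inj f"
  shows "shift_graph (relabel f G) (f c) (f l) (f ` F) = relabel f (shift_graph G c l F)"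
proof -
  have 1: "{{v, f c} | v. v \<in> f ` F} = (`) f ` {{v, c} | v. v \<in> F}"
  proof (intro set_eqI iffI)
    fix e assume "e \<in> {{v, f c} | v. v \<in> f ` F}"
    then obtain v where "v \<in> F" "e = f ` {v, c}" by auto
    then show "e \<in> (`) f ` {{v, c} | v. v \<in> F}" by blast
  qed auto
  have 2: "{{v, f l} | v. v \<in> f ` F \<and> adj (relabel f G) v (f c)} = (`) f ` {{v, l} | v. v \<in> F \<and> adj G v c}"
  proof (intro set_eqI iffI)
    fix e assume "e \<in> {{v, f l} | v. v \<in> f ` F \<and> adj (relabel f G) v (f c)}"
    then obtain v where "v \<in> F" "adj G v c" "e = f ` {v, l}" using adj_relabel[OF i, of G] by auto
    then show "e \<in> (`) f ` {{v, l} | v. v \<in> F \<and> adj G v c}" by blast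
  next
    fix e assume "e \<in> (`) f ` {{v, l} | v. v \<in> F \<and> adj G v c}"
    then obtain v where "v \<in> F" "adj G v c" "e = f ` {v, l}" by blast
    then show "e \<in> {{v, f l} | v. v \<in> f ` F \<and> adj (relabel f G) v (f c)}" using adj_relabel[OF i, of G] by auto
  qed
  have inj: "inj ((`) f)" using i by (simp add: inj_image_eq_iff inj_def)
  show ?thesis
    unfolding shift_graph_def 1 2 by (simp add: relabel_def image_Un image_set_diff[OF inj])
qed

lemma tree_shifts_relabel:
  assumes "bij f" "tree_shift\<^sup>*\<^sup>* G G'"
  shows "tree_shift\<^sup>*\<^sup>* (relabel f G) (relabel f G')"
  using assms(2)
proof (induction rule: rtranclp_induct)
  case (step G' G'')
  then obtain c cs l F where "tree_shift_data G' c cs l F" "G'' = shift_graph G' c l F" by (auto simp: tree_shift_def)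
  then have "tree_shift (relabel f G') (relabel f G'')"
    using tree_shift_data_relabel[OF assms(1)] shift_graph_relabel[OF bij_is_inj[OF assms(1)]] unfolding tree_shift_def by metis
  then show ?case using step.IH by (rule rtranclp.rtrancl_into_rtrancl[rotated])
qed simp

lemma graph_iso_refl: "graph_iso G G"
  unfolding graph_iso_def by (intro exI[of _ id]) simp

lemma graph_iso_trans:
  assumes "graph_iso G H" "graph_iso H K"
  shows "graph_iso G K"
proof -
  obtain f where f: "bij_betw f (verts G) (verts H)" "\<forall>u\<in>verts G. \<forall>v\<in>verts G. adj G u v \<longleftrightarrow> adj H (f u) (f v)"
    using assms(1) by (auto simp: graph_iso_def)
  obtain g where g: "bij_betw g (verts H) (verts K)" "\<forall>u\<in>verts H. \<forall>v\<in>verts H. adj H u v \<longleftrightarrow> adj K (g u) (g v)"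
    using assms(2) by (auto simp: graph_iso_def)
  have "f u \<in> verts H" if "u \<in> verts G" for u using f(1) that by (auto simp: bij_betw_def)
  then show ?thesis unfolding graph_iso_def
    using f g bij_betw_trans[OF f(1) g(1)] by (intro exI[of _ "g \<circ> f"]) simp
qed

lemma graph_iso_sym:
  assumes "graph_iso G H"
  shows "graph_iso H G"
proof -
  obtain f where f: "bij_betw f (verts G) (verts H)" "\<forall>u\<in>verts G. \<forall>v\<in>verts G. adj G u v \<longleftrightarrow> adj H (f u) (f v)"
    using assms by (auto simp: graph_iso_def)
  let ?g = "inv_into (verts G) f"
  have g: "bij_betw ?g (verts H) (verts G)" by (rule bij_betw_inv_into[OF f(1)])
  have "adj H u v \<longleftrightarrow> adj G (?g u) (?g v)" if "u \<in> verts H" "v \<in> verts H" for u v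
  proof -
    have "?g u \<in> verts G" "?g v \<in> verts G" using g that by (auto simp: bij_betw_def)
    moreover have "f (?g u) = u" "f (?g v) = v" using f(1) that by (auto simp: bij_betw_def f_inv_into_f)
    ultimately show ?thesis using f(2) by metis
  qed
  then show ?thesis unfolding graph_iso_def using g by blast
qed

lemma iso_class_eq: "graph_iso G H \<Longrightarrow> iso_class G = iso_class H"
proof -
  assume "graph_iso G H"
  then have "graph_iso G K \<longleftrightarrow> graph_iso H K" for K :: "'c ugraph"
    using graph_iso_trans[of G H K] graph_iso_trans[of H G K] graph_iso_sym[of G H] by blast
  then show ?thesis by (simp add: iso_class_def)
qed

lemma graph_iso_UNIV:
  fixes G H :: "'v::finite ugraph"
  assumes "graph_iso G H" "simple_graph G" "simple_graph H" "verts G = UNIV" "verts H = UNIV"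
  shows "\<exists>f. bij f \<and> H = relabel f G"
proof -
  obtain f where f: "bij f" "\<forall>u v. adj G u v \<longleftrightarrow> adj H (f u) (f v)"
    using assms(1,4,5) by (auto simp: graph_iso_def)
  have "edges H = (`) f ` edges G"
  proof (intro set_eqI iffI)
    fix e assume e: "e \<in> edges H"
    then have "card e = 2" using assms(3) by (simp add: simple_graph_def)
    then obtain x y where xy: "e = {x, y}" by (metis card_2_iff)
    obtain u v where uv: "x = f u" "y = f v" using f(1) by (metis bij_pointE)
    then have "{u, v} \<in> edges G" using f(2) e xy by (simp add: adj_def)
    moreover have "e = f ` {u, v}" using xy uv by simp
    ultimately show "e \<in> (`) f ` edges G" by blast
  next
    fix e assume "e \<in> (`) f ` edges G"
    then obtain e0 where e0: "e0 \<in> edges G" "e = f ` e0" by blast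
    then have "card e0 = 2" using assms(2) by (simp add: simple_graph_def)
    then obtain x y where "e0 = {x, y}" by (metis card_2_iff)
    then show "e \<in> edges H" using e0 f(2) by (simp add: adj_def)
  qed
  then have "H = relabel f G" using assms(4,5) bij_is_surj[OF f(1)] by (simp add: relabel_def prod_eq_iff)
  then show ?thesis using f(1) by blast
qed

lemma tree_class_member:
  fixes T :: "'v::finite ugraph set"
  assumes "T \<in> tree_classes" "H \<in> T"
  shows "tree_graph H" "verts H = UNIV" "T = iso_class H"
proof -
  obtain G :: "'v ugraph" where G: "T = iso_class G" "tree_graph G" "verts G = UNIV"
    using assms(1) by (auto simp: tree_classes_def)
  have H: "simple_graph H" "verts H = UNIV" "graph_iso G H" using assms(2) G(1) by (auto simp: iso_class_def)
  then obtain f where "bij f" "H = relabel f G" using graph_iso_UNIV[OF H(3)] G by (auto simp: tree_graph_def)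
  then show "tree_graph H" using tree_graph_relabel[OF bij_is_inj] G(2) by metis
  show "verts H = UNIV" by (rule H)
  show "T = iso_class H" using iso_class_eq[OF H(3)] G(1) by simp
qed

lemma tree_in_class:
  fixes G :: "'v::finite ugraph"
  assumes "tree_graph G" "verts G = UNIV"
  shows "iso_class G \<in> (tree_classes :: 'v ugraph set set)" "G \<in> iso_class G"
  unfolding tree_classes_def using assms graph_iso_refl[of G]
  by (blast, simp add: iso_class_def tree_graph_def)

lemma class_members_relabel:
  fixes T :: "'v::finite ugraph set"
  assumes "T \<in> tree_classes" "G \<in> T" "H \<in> T"
  shows "\<exists>f. bij f \<and> H = relabel f G"
proof -
  have "H \<in> iso_class G" using tree_class_member(3)[OF assms(1,2)] assms(3) by simp
  then have "graph_iso G H" by (simp add: iso_class_def)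
  moreover have "simple_graph G" "simple_graph H" "verts G = UNIV" "verts H = UNIV"
    using tree_class_member[OF assms(1,2)] tree_class_member[OF assms(1,3)] by (simp_all add: tree_graph_def)
  ultimately show ?thesis by (rule graph_iso_UNIV)
qed

lemma gamma_building_relabel:
  fixes G :: "'v::finite ugraph"
  assumes "bij f" "tree_graph G" "verts G = UNIV"
  shows "gamma_building (building_set (relabel f G)) = gamma_building (building_set G)"
proof -
  define E where "E = edges G"
  have G: "G = (UNIV, E)" using assms(3) by (simp add: E_def prod_eq_iff)
  have E: "e \<subseteq> UNIV" for e :: "'v set" by simp
  define c where "c = (undefined :: 'v)"
  have rt: "rtree c UNIV E" using tree_graph_imp_rtree[of UNIV E c] assms(2) G by simp
  obtain \<alpha> where a: "gamma_spec UNIV (building_set (UNIV, E)) c \<alpha>"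
    using gamma_spec_exists[OF rt] by blast
  have i: "inj f" using assms(1) by (rule bij_is_inj)
  have fU: "f ` UNIV = UNIV" using assms(1) by (rule bij_is_surj)
  have relabelled: "relabel f G = (UNIV, (`) f ` E)" by (simp add: relabel_def G fU)
  have "building_set (UNIV, (`) f ` E) = (`) f ` building_set (UNIV, E)"
    using building_set_relabel[OF i E, of E] by (simp add: fU)
  then have "gamma_spec UNIV (building_set (UNIV, (`) f ` E)) (f c) \<alpha>"
    using gamma_spec_relabel[OF building_building_set i _ a] by (simp add: fU)
  moreover have "tree_graph (UNIV, (`) f ` E)" using tree_graph_relabel[OF i assms(2)] relabelled by simp
  ultimately have "gamma_building (building_set (relabel f G)) = map_poly int (coeff \<alpha> 0)"
    unfolding relabelled by (intro nested.gamma_building_eq nested_building_set)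
  moreover have "gamma_building (building_set G) = map_poly int (coeff \<alpha> 0)"
    using a assms(2) unfolding G by (intro nested.gamma_building_eq nested_building_set)
  ultimately show ?thesis by simp
qed

section \<open>Shifting down to paths and up to stars\<close>

lemma rtree_split:
  assumes "rtree c V E" "{c, f} \<in> E"
  shows "\<exists>V1 V2 E1 E2. V = V1 \<union> V2 \<and> V1 \<inter> V2 = {} \<and> E = insert {c, f} (E1 \<union> E2) \<and> rtree c V1 E1 \<and> rtree f V2 E2"
  using assms
proof (induction rule: rtree.induct)
  case (single c) then show ?case by simp
next
  case (graft c V1 E1 g V2 E2)
  have c: "c \<in> V1" by (rule rtree_root[OF graft.hyps(1)])
  then have "c \<notin> V2" using graft.hyps(3) by blast
  then have n2: "{c, f} \<notin> E2" using rtree_edges(1)[OF graft.hyps(2)] by blast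
  show ?case
  proof (cases "f = g")
    case True
    then show ?thesis using graft.hyps by blast
  next
    case False
    then have "{c, f} \<in> E1" using graft.prems n2 by (auto simp: doubleton_eq_iff)
    then obtain V11 V12 E11 E12 where s: "V1 = V11 \<union> V12" "V11 \<inter> V12 = {}" "E1 = insert {c, f} (E11 \<union> E12)"
      "rtree c V11 E11" "rtree f V12 E12" using graft.IH(1) by blast
    have "rtree c (V11 \<union> V2) (insert {c, g} (E11 \<union> E2))"
      by (rule rtree.graft[OF s(4) graft.hyps(2)]) (use s graft.hyps(3) in blast)
    moreover have "V1 \<union> V2 = (V11 \<union> V2) \<union> V12" using s by blast
    moreover have "(V11 \<union> V2) \<inter> V12 = {}" using s graft.hyps(3) by blast
    moreover have "insert {c, g} (E1 \<union> E2) = insert {c, f} (insert {c, g} (E11 \<union> E2) \<union> E12)" using s by auto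
    ultimately show ?thesis using s(5) by blast
  qed
qed

lemma rtree_singleton_edges: "rtree c {c} E \<Longrightarrow> E = {}"
proof (rule ccontr)
  assume r: "rtree c {c} E" and "E \<noteq> {}"
  then obtain e where e: "e \<in> E" by blast
  have "card e \<le> card {c}" by (rule card_mono) (use rtree_edges(1)[OF r e] in auto)
  then show False using rtree_edges(2)[OF r e] by simp
qed

lemma nbrs_graft:
  assumes "rtree c V1 E1" "rtree f V2 E2" "V1 \<inter> V2 = {}"
  shows "nbrs (insert {c, f} (E1 \<union> E2)) c = insert f (nbrs E1 c)"
    and "v \<in> V1 \<Longrightarrow> v \<noteq> c \<Longrightarrow> nbrs (insert {c, f} (E1 \<union> E2)) v = nbrs E1 v"
    and "nbrs (insert {c, f} (E1 \<union> E2)) f = insert c (nbrs E2 f)"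
    and "v \<in> V2 \<Longrightarrow> v \<noteq> f \<Longrightarrow> nbrs (insert {c, f} (E1 \<union> E2)) v = nbrs E2 v"
proof -
  have c: "c \<in> V1" "c \<notin> V2" and f: "f \<in> V2" "f \<notin> V1"
    using rtree_root[OF assms(1)] rtree_root[OF assms(2)] assms(3) by auto
  have 1: "{v, u} \<notin> E2" if "v \<in> V1" for v u using rtree_edges(1)[OF assms(2), of "{v, u}"] that assms(3) by auto
  have 2: "{v, u} \<notin> E1" if "v \<in> V2" for v u using rtree_edges(1)[OF assms(1), of "{v, u}"] that assms(3) by auto
  show "nbrs (insert {c, f} (E1 \<union> E2)) c = insert f (nbrs E1 c)"
    using 1[OF c(1)] c f by (auto simp: nbrs_def doubleton_eq_iff)
  show "nbrs (insert {c, f} (E1 \<union> E2)) f = insert c (nbrs E2 f)"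
    using 2[OF f(1)] c f by (auto simp: nbrs_def doubleton_eq_iff)
  show "nbrs (insert {c, f} (E1 \<union> E2)) v = nbrs E1 v" if "v \<in> V1" "v \<noteq> c"
    using 1[OF that(1)] that f by (auto simp: nbrs_def doubleton_eq_iff)
  show "nbrs (insert {c, f} (E1 \<union> E2)) v = nbrs E2 v" if "v \<in> V2" "v \<noteq> f"
    using 2[OF that(1)] that c by (auto simp: nbrs_def doubleton_eq_iff)
qed

lemma rtree_leaf:
  assumes "rtree c V E" "V \<noteq> {c}"
  shows "\<exists>l\<in>V. l \<noteq> c \<and> card (nbrs E l) = 1"
  using assms
proof (induction rule: rtree.induct)
  case (single c) then show ?case by simp
next
  case (graft c V1 E1 f V2 E2)
  have f: "f \<in> V2" and c: "c \<in> V1" using rtree_root graft.hyps by metis+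
  have V2c: "x \<in> V2 \<Longrightarrow> x \<noteq> c" for x using c graft.hyps(3) by blast
  show ?case
  proof (cases "V2 = {f}")
    case True
    then have "E2 = {}" using rtree_singleton_edges[of f E2] graft.hyps(2) by simp
    then have "nbrs (insert {c, f} (E1 \<union> E2)) f = {c}" unfolding nbrs_graft(3)[OF graft.hyps] by (simp add: nbrs_def)
    then show ?thesis using f V2c[OF f] by (intro bexI[of _ f]) auto
  next
    case False
    then obtain l where l: "l \<in> V2" "l \<noteq> f" "card (nbrs E2 l) = 1" using graft.IH(2) by blast
    then have "card (nbrs (insert {c, f} (E1 \<union> E2)) l) = 1" using nbrs_graft(4)[OF graft.hyps l(1,2)] by simp
    then show ?thesis using l V2c[OF l(1)] by blast
  qed
qed

lemma path_stays:
  assumes "successively (adj (V, E)) q" "q \<noteq> []" "hd q \<in> S" "c \<notin> set q"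
    and "\<And>a b. a \<in> S \<Longrightarrow> a \<noteq> c \<Longrightarrow> {a, b} \<in> E \<Longrightarrow> b \<in> S"
  shows "set q \<subseteq> S"
  using assms(1-4)
proof (induction q)
  case (Cons x q)
  show ?case
  proof (cases q)
    case (Cons y r)
    then have "y \<in> S" using Cons.prems assms(5)[of x y] by (auto simp: adj_iff)
    then show ?thesis using Cons.IH Cons.prems Cons by simp
  qed (use Cons.prems in simp)
qed simp

text \<open>
  Choose a leaf \<open>l\<close>, the nearest vertex \<open>c\<close> of degree greater than
  two, and a path between them. Of two further neighbours \<open>e\<close>, \<open>f\<close>
  of \<open>c\<close>, the branch at \<open>f\<close> serves as \<open>F\<close>, and
  \<open>e\<close> remains outside \<open>F\<close> and the path.
\<close>

lemma exists_proper_shift: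
  assumes T: "tree_graph (V, E)" and v: "v \<in> V" "card (nbrs E v) > 2"
  shows "\<exists>E'. tree_shift (V, E) (V, E') \<and> tree_graph (V, E') \<and> leaf_count V E' < leaf_count V E"
proof -
  have edges: "\<And>e. e \<in> E \<Longrightarrow> e \<subseteq> V" and fin: "finite V" and simple: "simple_graph (V, E)" and conn: "graph_connected (V, E)"
    and acyc: "graph_acyclic (V, E)"
    using T by (auto simp: tree_graph_def simple_graph_def)
  have rv: "rtree v V E" by (rule tree_graph_imp_rtree[OF T v(1)])
  have "V \<noteq> {v}"
  proof
    assume V: "V = {v}"
    have "nbrs E v \<subseteq> {v}" using nbrs_subset[of E V v] edges V by simp
    then have "card (nbrs E v) \<le> card {v}" by (intro card_mono) auto
    then show False using v(2) by simp
  qed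
  then obtain l where l: "l \<in> V" "card (nbrs E l) = 1" using rtree_leaf[OF rv] by blast
  have dg: "deg (V, E) u = card (nbrs E u)" for u by (rule deg_nbrs) (rule edges)
  let ?big = "\<lambda>u. u \<in> V \<and> card (nbrs E u) > 2"
  obtain c where c: "?big c" "\<And>u. ?big u \<Longrightarrow> graph_dist (V, E) l c \<le> graph_dist (V, E) l u"
    using ex_has_least_nat[of ?big v "graph_dist (V, E) l"] v by blast
  have lc: "l \<noteq> c" using c(1) l(2) by auto
  obtain p where p: "graph_path (V, E) p" "hd p = c" "last p = l" using graph_connectedD[OF conn _ l(1)] c(1) by blast
  have pne: "p \<noteq> []" using p(1) by (simp add: graph_path_def)
  obtain r where r: "p = c # r" using pne p(2) by (cases p) auto
  have rne: "r \<noteq> []" using p(3) lc r by auto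
  obtain cs where cs: "r = cs @ [l]" using rne p(3) r by (metis append_butlast_last_id last_ConsR)
  have pc: "graph_path (V, E) (c # cs @ [l])" using p(1) r cs by simp
  have dist: "distinct (c # r)" "set (c # r) \<subseteq> V" "successively (adj (V, E)) (c # r)"
    using p(1) unfolding r graph_path_def by simp_all
  obtain c1 r' where c1: "r = c1 # r'" using rne by (cases r) auto
  have c1E: "{c, c1} \<in> E" using dist(3) c1 by (simp add: adj_iff)
  have fnb: "finite (nbrs E c)" by (rule finite_subset[OF nbrs_subset fin]) (rule edges)
  have "c1 \<in> nbrs E c" using c1E by (simp add: nbrs_def)
  then have "card (nbrs E c - {c1}) = card (nbrs E c) - 1" by (rule card_Diff_singleton)
  then have "card (nbrs E c - {c1}) \<ge> 2" using c(1) by linarith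
  then obtain f where f: "f \<in> nbrs E c - {c1}" by (metis all_not_in_conv card.empty not_numeral_le_zero)
  have "card (nbrs E c - {c1} - {f}) \<ge> 1" using \<open>card (nbrs E c - {c1}) \<ge> 2\<close> f fnb by simp
  then obtain e where e: "e \<in> nbrs E c - {c1} - {f}" by (metis all_not_in_conv card.empty not_one_le_zero)
  have fE: "{c, f} \<in> E" and eE: "{c, e} \<in> E" using f e by (simp_all add: nbrs_def)
  have rc: "rtree c V E" using tree_graph_imp_rtree[OF T] c(1) by blast
  obtain V1 F E1 E2 where s: "V = V1 \<union> F" "V1 \<inter> F = {}" "E = insert {c, f} (E1 \<union> E2)" "rtree c V1 E1" "rtree f F E2"
    using rtree_split[OF rc fE] by blast
  have cV1: "c \<in> V1" "c \<notin> F" and fF: "f \<in> F" using rtree_root[OF s(4)] rtree_root[OF s(5)] s(2) by auto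
  have E1: "{a, b} \<in> E1 \<Longrightarrow> a \<in> V1 \<and> b \<in> V1" for a b using rtree_edges(1)[OF s(4), of "{a, b}"] by simp
  have E2: "{a, b} \<in> E2 \<Longrightarrow> a \<in> F \<and> b \<in> F" for a b using rtree_edges(1)[OF s(5), of "{a, b}"] by simp
  have dj: "a \<in> V1 \<Longrightarrow> a \<notin> F" for a using s(2) by blast
  have cross: "b \<in> V1" if "a \<in> V1" "a \<noteq> c" "{a, b} \<in> E" for a b
    using that E1[of a b] E2[of a b] dj[of a] fF by (auto simp: s(3) doubleton_eq_iff)
  have nbr: "b \<in> V1" if "{c, b} \<in> E" "b \<noteq> f" for b
    using that E1[of c b] E2[of c b] cV1 by (auto simp: s(3) doubleton_eq_iff)
  have "set r \<subseteq> V1"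
  proof (rule path_stays[OF _ rne])
    show "successively (adj (V, E)) r" using dist(3) c1 by simp
    show "hd r \<in> V1" using nbr[OF c1E] f c1 by auto
    show "c \<notin> set r" using dist(1) by simp
  qed (rule cross)
  then have pV1: "set (c # cs @ [l]) \<subseteq> V1" using cV1 cs by simp
  have eV1: "e \<in> V1" using nbr[OF eE] e by simp
  have enp: "e \<notin> set (c # cs @ [l])"
  proof
    assume "e \<in> set (c # cs @ [l])"
    then have er: "e \<in> set (c # r)" by (simp add: cs)
    have "e \<noteq> c"
    proof
      assume "e = c"
      then have "{c} \<in> E" using eE by simp
      then show False using simple by (auto simp: simple_graph_def)
    qed
    then have "e \<in> set r'" using e er by (auto simp: c1)
    then obtain ys zs where yz: "r' = ys @ e # zs" by (auto dest: split_list)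
    have full: "c # r = (c # c1 # ys @ [e]) @ zs" using c1 yz by simp
    have "graph_path (V, E) (c # c1 # ys @ [e])"
      using p(1) unfolding r full graph_path_def successively_append_iff by simp
    moreover have "adj (V, E) (last (c # c1 # ys @ [e])) (hd (c # c1 # ys @ [e]))" using eE by (simp add: adj_iff insert_commute)
    moreover have "3 \<le> length (c # c1 # ys @ [e])" by simp
    ultimately show False using acyc unfolding graph_acyclic_def by blast
  qed
  have dat: "tree_shift_data (V, E) c cs l F"
    unfolding tree_shift_data_def
  proof (intro conjI)
    show "leaf (V, E) l" using l by (simp add: leaf_def dg)
    show "c \<in> verts (V, E)" "2 < deg (V, E) c" using c(1) by (simp_all add: dg)
    show "\<forall>v\<in>verts (V, E). 2 < deg (V, E) v \<longrightarrow> graph_dist (V, E) l c \<le> graph_dist (V, E) l v" using c(2) by (simp add: dg)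
    show "F \<subseteq> verts (V, E) - set (c # cs @ [l])" using pV1 dj s(1) by auto
    show "verts (V, E) - (F \<union> set (c # cs @ [l])) \<noteq> {}" using eV1 enp dj[OF eV1] s(1) by auto
    have "rtree c ({c} \<union> F) (insert {c, f} ({} \<union> E2))" by (rule rtree.graft[OF rtree.single s(5)]) (use cV1 in auto)
    moreover have "{x \<in> E. x \<subseteq> insert c F} = insert {c, f} E2"
    proof (intro set_eqI iffI)
      fix x assume x: "x \<in> {x \<in> E. x \<subseteq> insert c F}"
      have "x \<notin> E1"
      proof
        assume x1: "x \<in> E1"
        have "x \<subseteq> {c}" using rtree_edges(1)[OF s(4) x1] x dj by auto
        then have "card x \<le> card {c}" by (intro card_mono) auto
        then show False using rtree_edges(2)[OF s(4) x1] by simp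
      qed
      then show "x \<in> insert {c, f} E2" using x by (auto simp: s(3))
    next
      fix x assume "x \<in> insert {c, f} E2"
      then show "x \<in> {x \<in> E. x \<subseteq> insert c F}" using rtree_edges(1)[OF s(5), of x] fF by (auto simp: s(3))
    qed
    ultimately show "tree_graph (induced (V, E) (insert c F))"
      using rtree_imp_tree_graph by (simp add: induced_def)
    show "\<forall>u\<in>verts (V, E) - insert c F. \<forall>v\<in>F. \<not> adj (V, E) u v"
    proof (intro ballI notI)
      fix u w assume uw: "u \<in> verts (V, E) - insert c F" "w \<in> F" "adj (V, E) u w"
      then have "u \<in> V1" "u \<noteq> c" "{u, w} \<in> E" using s(1) by (auto simp: adj_iff)
      then show False using cross[of u w] uw(2) dj by blast
    qed
  qed (use simple conn pc in auto)
  interpret shift_data V E c cs l F using dat T by unfold_locales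
  have "tree_shift (V, E) (V, E')" unfolding tree_shift_def using dat shift_eq by metis
  moreover have "leaf_count V E' < leaf_count V E" using leaves_shift fF by blast
  ultimately show ?thesis using tree' by blast
qed

lemma reach_small_degrees:
  assumes "tree_graph (V, E)"
  shows "\<exists>E'. tree_shift\<^sup>*\<^sup>* (V, E) (V, E') \<and> tree_graph (V, E') \<and> (\<forall>v\<in>V. card (nbrs E' v) \<le> 2)"
  using assms
proof (induction "leaf_count V E" arbitrary: E rule: less_induct)
  case less
  show ?case
  proof (cases "\<forall>v\<in>V. card (nbrs E v) \<le> 2")
    case True then show ?thesis using less.prems by blast
  next
    case False
    then obtain v where "v \<in> V" "card (nbrs E v) > 2" by force
    then obtain E1 where E1: "tree_shift (V, E) (V, E1)" "tree_graph (V, E1)" "leaf_count V E1 < leaf_count V E"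
      using exists_proper_shift[OF less.prems] by blast
    obtain E' where "tree_shift\<^sup>*\<^sup>* (V, E1) (V, E')" "tree_graph (V, E') \<and> (\<forall>v\<in>V. card (nbrs E' v) \<le> 2)"
      using less.hyps[OF E1(3,2)] by blast
    then show ?thesis using E1(1) by (meson converse_rtranclp_into_rtranclp)
  qed
qed

text \<open>
  A root of degree one leaves no room for further branches, so the tree is the root followed
  by a path with a root of degree at most one.
\<close>

lemma small_degrees_path:
  assumes "rtree c V E" "\<forall>v\<in>V. card (nbrs E v) \<le> 2" "card (nbrs E c) \<le> 1"
  shows "\<exists>p. p \<noteq> [] \<and> distinct p \<and> hd p = c \<and> set p = V \<and> E = list_edges p"
  using assms
proof (induction rule: rtree.induct)
  case (single c)
  show ?case by (rule exI[of _ "[c]"]) simp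
next
  case (graft c V1 E1 f V2 E2)
  let ?E = "insert {c, f} (E1 \<union> E2)"
  have f: "f \<in> V2" and c: "c \<in> V1" by (rule rtree_root[OF graft.hyps(2)], rule rtree_root[OF graft.hyps(1)])
  have f1: "f \<notin> V1" and c2: "c \<notin> V2" using f c graft.hyps(3) by auto
  have fin: "finite (nbrs ?E v)" for v by (rule rtree_finite_nbrs[OF rtree.graft[OF graft.hyps]])
  have V1: "V1 = {c}"
  proof (rule ccontr)
    assume "V1 \<noteq> {c}"
    then obtain u where u: "u \<in> V1" "{c, u} \<in> E1" using rtree_nbr[OF graft.hyps(1)] by blast
    have "2 \<le> card (nbrs ?E c)"
    proof (rule card_ge_2[OF fin])
      show "u \<in> nbrs ?E c" "f \<in> nbrs ?E c" using u by (simp_all add: nbrs_def)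
      show "u \<noteq> f" using u f1 by blast
    qed
    then show False using graft.prems(2) by simp
  qed
  then have E1: "E1 = {}" using rtree_singleton_edges[of c E1] graft.hyps(1) by simp
  have "nbrs ?E f = insert c (nbrs E2 f)" by (rule nbrs_graft(3)[OF graft.hyps])
  moreover have "c \<notin> nbrs E2 f" using nbrs_subset[of E2 V2 f] rtree_edges(1)[OF graft.hyps(2)] c2 by blast
  moreover have "finite (nbrs E2 f)" by (rule rtree_finite_nbrs[OF graft.hyps(2)])
  moreover have "card (nbrs ?E f) \<le> 2" using graft.prems(1) f by blast
  ultimately have df: "card (nbrs E2 f) \<le> 1" by simp
  have "card (nbrs E2 v) \<le> 2" if "v \<in> V2" for v
  proof (cases "v = f")
    case False
    then show ?thesis using nbrs_graft(4)[OF graft.hyps that] graft.prems(1) that by (metis UnI2)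
  qed (use df in simp)
  then obtain p where p: "p \<noteq> []" "distinct p" "hd p = f" "set p = V2" "E2 = list_edges p" using graft.IH(2) df by blast
  obtain q where q: "p = f # q" using p(1,3) by (cases p) auto
  show ?case
    by (rule exI[of _ "c # p"]) (use p q V1 E1 c2 in auto)
qed

lemma list_edges_index: "list_edges p = {{p ! k, p ! Suc k} | k. Suc k < length p}"
proof (induction p rule: list_edges.induct)
  case (3 a b r)
  show ?case
  proof (intro set_eqI iffI)
    fix e assume "e \<in> list_edges (a # b # r)"
    then consider "e = {a, b}" | k where "e = {(b # r) ! k, (b # r) ! Suc k}" "Suc k < length (b # r)" using 3 by auto
    then show "e \<in> {{(a # b # r) ! k, (a # b # r) ! Suc k} | k. Suc k < length (a # b # r)}"
    proof cases
      case 1 then show ?thesis by (intro CollectI exI[of _ 0]) simp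
    next
      case 2 then show ?thesis by (intro CollectI exI[of _ "Suc k"]) simp
    qed
  next
    fix e assume "e \<in> {{(a # b # r) ! k, (a # b # r) ! Suc k} | k. Suc k < length (a # b # r)}"
    then obtain k where k: "e = {(a # b # r) ! k, (a # b # r) ! Suc k}" "Suc k < length (a # b # r)" by blast
    show "e \<in> list_edges (a # b # r)"
    proof (cases k)
      case 0 then show ?thesis using k by simp
    next
      case (Suc j)
      then have "e \<in> list_edges (b # r)" unfolding 3 using k by (intro CollectI exI[of _ j]) simp
      then show ?thesis by simp
    qed
  qed
qed simp_all

lemma path_graph_iso:
  assumes "distinct p" "set p = V" "n = length p"
  shows "graph_iso (path_graph n) (V, list_edges p)"
proof -
  define f where "f = (\<lambda>i. p ! (i - 1))"
  have bij: "bij_betw f {1..n} V"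
  proof -
    have "bij_betw ((!) p) {..<n} (set p)" by (rule bij_betw_nth) (use assms in auto)
    moreover have "bij_betw (\<lambda>i. i - 1) {1..n} {..<n}"
      by (rule bij_betwI[where g = Suc]) auto
    ultimately have "bij_betw ((!) p \<circ> (\<lambda>i. i - 1)) {1..n} (set p)" by (rule bij_betw_trans[rotated])
    then show ?thesis using assms(2) by (simp add: f_def o_def)
  qed
  have "adj (path_graph n) i j \<longleftrightarrow> adj (V, list_edges p) (f i) (f j)" if ij: "i \<in> {1..n}" "j \<in> {1..n}" for i j
  proof -
    have L: "adj (path_graph n) i j \<longleftrightarrow> j = Suc i \<or> i = Suc j"
    proof -
      have "adj (path_graph n) i j \<longleftrightarrow> (\<exists>k. {i, j} = {k, Suc k} \<and> 1 \<le> k \<and> k < n)" by (auto simp: adj_def path_graph_def)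
      then show ?thesis using ij by (auto simp: doubleton_eq_iff)
    qed
    have ne: "p ! a = p ! b \<longleftrightarrow> a = b" if "a < n" "b < n" for a b using nth_eq_iff_index_eq[OF assms(1)] that assms(3) by simp
    have "adj (V, list_edges p) (f i) (f j) \<longleftrightarrow> (\<exists>k. {p ! (i - 1), p ! (j - 1)} = {p ! k, p ! Suc k} \<and> Suc k < n)"
      unfolding adj_iff list_edges_index f_def assms(3) by blast
    also have "\<dots> \<longleftrightarrow> (\<exists>k. (i - 1 = k \<and> j - 1 = Suc k \<or> i - 1 = Suc k \<and> j - 1 = k) \<and> Suc k < n)"
    proof (rule ex_cong1)
      fix k
      have "{p ! (i - 1), p ! (j - 1)} = {p ! k, p ! Suc k} \<longleftrightarrow> (i - 1 = k \<and> j - 1 = Suc k \<or> i - 1 = Suc k \<and> j - 1 = k)"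
        if k: "Suc k < n"
      proof -
        have "i - 1 < n" "j - 1 < n" "k < n" using ij k by auto
        then show ?thesis unfolding doubleton_eq_iff using ne k by simp
      qed
      then show "{p ! (i - 1), p ! (j - 1)} = {p ! k, p ! Suc k} \<and> Suc k < n \<longleftrightarrow>
          (i - 1 = k \<and> j - 1 = Suc k \<or> i - 1 = Suc k \<and> j - 1 = k) \<and> Suc k < n" by blast
    qed
    also have "\<dots> \<longleftrightarrow> j = Suc i \<or> i = Suc j"
    proof
      assume "j = Suc i \<or> i = Suc j"
      then show "\<exists>k. (i - 1 = k \<and> j - 1 = Suc k \<or> i - 1 = Suc k \<and> j - 1 = k) \<and> Suc k < n"
      proof
        assume "j = Suc i"
        then show ?thesis using ij by (intro exI[of _ "i - 1"]) auto
      next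
        assume "i = Suc j"
        then show ?thesis using ij by (intro exI[of _ "j - 1"]) auto
      qed
    qed (use ij in auto)
    finally show ?thesis using L by simp
  qed
  then show ?thesis unfolding graph_iso_def using bij by (intro exI[of _ f]) (simp add: path_graph_def)
qed

lemma small_degrees_path_iso:
  assumes "tree_graph (V, E)" "\<forall>v\<in>V. card (nbrs E v) \<le> 2"
  shows "graph_iso (path_graph (card V)) (V, E)"
proof -
  have "V \<noteq> {}" using assms(1) by (simp add: tree_graph_def)
  then obtain v where v: "v \<in> V" by blast
  have rv: "rtree v V E" by (rule tree_graph_imp_rtree[OF assms(1) v])
  have "\<exists>c\<in>V. card (nbrs E c) \<le> 1"
  proof (cases "V = {v}")
    case True
    then have "E = {}" using rtree_singleton_edges[of v E] rv by simp
    then show ?thesis using v by (intro bexI[of _ v]) (simp_all add: nbrs_def)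
  next
    case False
    then show ?thesis using rtree_leaf[OF rv] by force
  qed
  then obtain c where c: "c \<in> V" "card (nbrs E c) \<le> 1" by blast
  have "rtree c V E" by (rule tree_graph_imp_rtree[OF assms(1) c(1)])
  then obtain p where p: "distinct p" "set p = V" "E = list_edges p" using small_degrees_path[OF _ assms(2) c(2)] by blast
  then have "card V = length p" using distinct_card by metis
  then show ?thesis using path_graph_iso[OF p(1,2)] p(3) by simp
qed

text \<open>
  Move all branches at \<open>l\<close>, except the one containing \<open>c\<close>, over to
  \<open>c\<close>. This makes \<open>l\<close> a leaf next to \<open>c\<close>, the degree of
  \<open>c\<close> becomes at least three, and shifting the branches back recovers the tree.
  As \<open>l\<close> is adjacent to \<open>c\<close>, no vertex of degree greater than two
  can be closer.
\<close>

lemma exists_unshift: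
  fixes V :: "'a set"
  assumes T: "tree_graph (V, E)" and cl: "{c, l} \<in> E" and c2: "card (nbrs E c) \<ge> 2" and l2: "card (nbrs E l) \<ge> 2"
  shows "\<exists>E0. tree_shift (V, E0) (V, E) \<and> tree_graph (V, E0) \<and> leaf_count V E < leaf_count V E0"
proof -
  have cV: "c \<in> V" "l \<in> V" using T cl by (auto simp: tree_graph_def simple_graph_def)
  have rc: "rtree c V E" by (rule tree_graph_imp_rtree[OF T cV(1)])
  obtain V1 V2 E1 E2 where s: "V = V1 \<union> V2" "V1 \<inter> V2 = {}" "E = insert {c, l} (E1 \<union> E2)" "rtree c V1 E1" "rtree l V2 E2"
    using rtree_split[OF rc cl] by blast
  have cV1: "c \<in> V1" "c \<notin> V2" and lV2: "l \<in> V2" "l \<notin> V1" using rtree_root[OF s(4)] rtree_root[OF s(5)] s(2) by auto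
  have lc: "l \<noteq> c" using cV1 lV2 by blast
  define F where "F = V2 - {l}"
  define \<tau> where "\<tau> = (\<lambda>x. if x = l then c else x)"
  define EF0 where "EF0 = (`) \<tau> ` E2"
  define E0 where "E0 = insert {c, l} E1 \<union> EF0"
  have t_im: "\<tau> ` V2 = insert c F" using lV2 by (auto simp: \<tau>_def F_def)
  have t_inj: "inj_on \<tau> V2" using cV1 by (auto simp: inj_on_def \<tau>_def)
  have rF: "rtree c (insert c F) EF0"
    using rtree_relabel[OF s(5) t_inj] unfolding t_im EF0_def by (simp add: \<tau>_def)
  have rA: "rtree c (V1 \<union> {l}) (insert {c, l} (E1 \<union> {}))"
    by (rule rtree.graft[OF s(4) rtree.single]) (use lV2 in auto)
  have int: "(V1 \<union> {l}) \<inter> insert c F = {c}" using cV1 s(2) by (auto simp: F_def)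
  have "rtree c ((V1 \<union> {l}) \<union> insert c F) (insert {c, l} (E1 \<union> {}) \<union> EF0)" by (rule rtree_wedge[OF rF rA int])
  moreover have "(V1 \<union> {l}) \<union> insert c F = V" using cV1 lV2 by (auto simp: F_def s(1))
  ultimately have r0: "rtree c V E0" by (simp add: E0_def)
  have T0: "tree_graph (V, E0)" by (rule rtree_imp_tree_graph[OF r0])
  have edges0: "\<And>e. e \<in> E0 \<Longrightarrow> e \<subseteq> V" by (rule rtree_edges(1)[OF r0])
  have dg: "deg (V, E0) u = card (nbrs E0 u)" for u by (rule deg_nbrs) (rule edges0)
  have Ed1: "{a, b} \<in> E1 \<Longrightarrow> a \<in> V1 \<and> b \<in> V1" for a b using rtree_edges(1)[OF s(4), of "{a, b}"] by simp
  have EdF: "{a, b} \<in> EF0 \<Longrightarrow> a \<in> insert c F \<and> b \<in> insert c F" for a b using rtree_edges(1)[OF rF, of "{a, b}"] by simp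
  have lF: "l \<notin> F" "l \<notin> insert c F" using lc by (auto simp: F_def)
  have "nbrs E0 l = {c}"
    using Ed1[of l] EdF[of l] lV2 lF lc by (auto simp: nbrs_def E0_def doubleton_eq_iff)
  then have leaf_l: "card (nbrs E0 l) = 1" by simp
  have "nbrs E c = insert l (nbrs E1 c)" "nbrs E l = insert c (nbrs E2 l)"
    using nbrs_graft(1,3)[OF s(4,5,2)] by (simp_all add: s(3))
  then have "nbrs E1 c \<noteq> {}" "nbrs E2 l \<noteq> {}" using c2 l2 by auto
  then obtain e f where e: "{c, e} \<in> E1" and f: "{l, f} \<in> E2" by (auto simp: nbrs_def)
  have eV: "e \<in> V1" "e \<noteq> c" using Ed1[OF e] rtree_edges(2)[OF s(4) e] by auto
  have fV: "f \<in> V2" "f \<noteq> l" using rtree_edges[OF s(5) f] by auto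
  have fF: "f \<in> F" using fV by (simp add: F_def)
  have "\<tau> ` {l, f} \<in> EF0" unfolding EF0_def using f by (rule imageI)
  then have cf: "{c, f} \<in> EF0" using fV by (simp add: \<tau>_def insert_commute)
  have fin0: "finite (nbrs E0 c)" by (rule rtree_finite_nbrs[OF r0])
  have big: "card (nbrs E0 c) > 2"
  proof -
    have "{l, e, f} \<subseteq> nbrs E0 c" using e cf by (auto simp: nbrs_def E0_def)
    moreover have "l \<noteq> e" "l \<noteq> f" "e \<noteq> f" using eV fV lV2 s(2) by auto
    then have "card {l, e, f} = 3" by simp
    ultimately show ?thesis using card_mono[OF fin0, of "{l, e, f}"] by simp
  qed
  have simple0: "simple_graph (V, E0)" and conn0: "graph_connected (V, E0)" using T0 by (simp_all add: tree_graph_def)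
  have EFset: "{x \<in> E0. x \<subseteq> insert c F} = EF0"
  proof (intro set_eqI iffI)
    fix x assume x: "x \<in> {x \<in> E0. x \<subseteq> insert c F}"
    show "x \<in> EF0"
    proof (rule ccontr)
      assume "x \<notin> EF0"
      then have xA: "x \<in> insert {c, l} (E1 \<union> {})" using x by (auto simp: E0_def)
      have "x \<subseteq> {c}" using rtree_edges(1)[OF rA xA] x int by auto
      then have "card x \<le> card {c}" by (intro card_mono) auto
      then show False using rtree_edges(2)[OF rA xA] by simp
    qed
  next
    fix x assume "x \<in> EF0"
    then show "x \<in> {x \<in> E0. x \<subseteq> insert c F}" using rtree_edges(1)[OF rF, of x] by (simp add: E0_def)
  qed
  have dat: "tree_shift_data (V, E0) c [] l F"
    unfolding tree_shift_data_def
  proof (intro conjI)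
    show "leaf (V, E0) l" using cV leaf_l by (simp add: leaf_def dg)
    show "2 < deg (V, E0) c" using big by (simp add: dg)
    show "c \<in> verts (V, E0)" using cV by simp
    have clE: "{c, l} \<in> E0" by (simp add: E0_def)
    show "graph_path (V, E0) (c # [] @ [l])" using cV lc clE by (simp add: graph_path_def adj_iff)
    show "\<forall>v\<in>verts (V, E0). 2 < deg (V, E0) v \<longrightarrow> graph_dist (V, E0) l c \<le> graph_dist (V, E0) l v"
    proof (intro ballI impI)
      fix v assume v: "v \<in> verts (V, E0)" "2 < deg (V, E0) v"
      have "graph_path (V, E0) [l, c]" using cV lc clE by (simp add: graph_path_def adj_iff insert_commute)
      then have 1: "graph_dist (V, E0) l c \<le> 1" using graph_dist_le[of "(V, E0)" "[l, c]" l c] by simp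
      have vl: "v \<noteq> l" using v(2) leaf_l by (auto simp: dg)
      have vV: "v \<in> V" using v(1) by simp
      obtain q where "graph_path (V, E0) q" "hd q = l" "last q = v" using graph_connectedD[OF conn0 cV(2) vV] by blast
      then obtain p where p: "hd p = l" "last p = v" "length p = Suc (graph_dist (V, E0) l v)" using graph_dist_attained by metis
      have "graph_dist (V, E0) l v \<noteq> 0"
      proof
        assume "graph_dist (V, E0) l v = 0"
        then obtain x where "p = [x]" using p(3) by (auto simp: length_Suc_conv)
        then show False using p(1,2) vl by simp
      qed
      then show "graph_dist (V, E0) l c \<le> graph_dist (V, E0) l v" using 1 by simp
    qed
    show "F \<subseteq> verts (V, E0) - set (c # [] @ [l])" using cV1 by (auto simp: F_def s(1))
    show "tree_graph (induced (V, E0) (insert c F))"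
      using rtree_imp_tree_graph[OF rF] EFset by (simp add: induced_def)
    show "\<forall>u\<in>verts (V, E0) - insert c F. \<forall>v\<in>F. \<not> adj (V, E0) u v"
    proof (intro ballI notI)
      fix u w assume u: "u \<in> verts (V, E0) - insert c F" and w: "w \<in> F" and a: "adj (V, E0) u w"
      have "w \<notin> V1" "w \<noteq> l" "w \<noteq> c" using w s(2) cV1 by (auto simp: F_def)
      then have "{u, w} \<in> EF0" using a Ed1[of u w] by (auto simp: adj_iff E0_def doubleton_eq_iff)
      then show False using EdF[of u w] u by blast
    qed
    have "e \<noteq> l" using eV lV2 by blast
    then show "verts (V, E0) - (F \<union> set (c # [] @ [l])) \<noteq> {}" using eV s(2) by (auto simp: F_def s(1))
  qed (use simple0 conn0 in auto)
  define cs where "cs = ([] :: 'a list)"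
  interpret D: shift_data V E0 c cs l F
    using dat T0 unfolding cs_def[symmetric] by unfold_locales
  have restore: "(`) D.\<sigma> ` EF0 = E2"
  proof -
    have "D.\<sigma> (\<tau> x) = x" if "x \<in> V2" for x using that cV1 lc by (auto simp: D.\<sigma>_def \<tau>_def)
    then have "D.\<sigma> ` \<tau> ` x = x" if "x \<in> E2" for x
      using rtree_edges(1)[OF s(5) that] by (force simp: image_image image_iff subset_iff)
    then show ?thesis by (auto simp: EF0_def image_image image_iff)
  qed
  have EFeq: "D.EF = EF0" unfolding D.EF_def by (rule EFset)
  have EAeq: "D.EA = insert {c, l} E1"
  proof (intro set_eqI iffI)
    fix x assume x: "x \<in> D.EA"
    show "x \<in> insert {c, l} E1"
    proof (rule ccontr)
      assume "x \<notin> insert {c, l} E1"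
      have "x \<in> E0" using x D.E_eq by blast
      then have xF: "x \<in> EF0" using \<open>x \<notin> insert {c, l} E1\<close> by (simp add: E0_def)
      have "x \<subseteq> {c}" using rtree_edges(1)[OF rF xF] D.EA_sub[OF x] D.A_F by blast
      then have "card x \<le> card {c}" by (intro card_mono) auto
      then show False using rtree_edges(2)[OF rF xF] by simp
    qed
  next
    fix x assume x: "x \<in> insert {c, l} E1"
    then have "x \<subseteq> V1 \<union> {l}" using rtree_edges(1)[OF rA, of x] by auto
    also have "V1 \<union> {l} \<subseteq> D.A" unfolding D.A_eq using s(2) lV2 by (auto simp: F_def s(1))
    finally have "x \<subseteq> D.A" .
    moreover have "x \<in> E0" using x by (auto simp: E0_def)
    ultimately show "x \<in> D.EA" unfolding D.EA_eq by blast
  qed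
  have "D.E' = E" unfolding D.E'_def D.EF'_def EFeq restore EAeq by (auto simp: s(3))
  then have "tree_shift (V, E0) (V, E)" unfolding tree_shift_def using D.data D.shift_eq by metis
  moreover have "leaf_count V E < leaf_count V E0" using D.leaves_shift fF \<open>D.E' = E\<close> by auto
  ultimately show ?thesis using T0 by blast
qed

lemma leaf_count_le: "finite V \<Longrightarrow> leaf_count V E \<le> card V"
  unfolding leaf_count_def by (rule card_mono) auto

text \<open>
  Terminates because the number of leaves grows and is bounded by the number of vertices.
\<close>

lemma reach_from_star:
  assumes "tree_graph (V, E)"
  shows "\<exists>E0. tree_shift\<^sup>*\<^sup>* (V, E0) (V, E) \<and> tree_graph (V, E0) \<and>
    (\<forall>c l. {c, l} \<in> E0 \<longrightarrow> card (nbrs E0 c) < 2 \<or> card (nbrs E0 l) < 2)"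
  using assms
proof (induction "card V - leaf_count V E" arbitrary: E rule: less_induct)
  case less
  show ?case
  proof (cases "\<forall>c l. {c, l} \<in> E \<longrightarrow> card (nbrs E c) < 2 \<or> card (nbrs E l) < 2")
    case True then show ?thesis using less.prems by blast
  next
    case False
    then obtain c l where cl: "{c, l} \<in> E" "card (nbrs E c) \<ge> 2" "card (nbrs E l) \<ge> 2" by (auto simp: not_less)
    obtain E1 where E1: "tree_shift (V, E1) (V, E)" "tree_graph (V, E1)" "leaf_count V E < leaf_count V E1"
      using exists_unshift[OF less.prems cl] by blast
    have "finite V" using less.prems by (simp add: tree_graph_def simple_graph_def)
    then have "card V - leaf_count V E1 < card V - leaf_count V E" using leaf_count_le[of V E1] E1(3) by simp
    then obtain E0 where "tree_shift\<^sup>*\<^sup>* (V, E0) (V, E1)"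
      "tree_graph (V, E0) \<and> (\<forall>c l. {c, l} \<in> E0 \<longrightarrow> card (nbrs E0 c) < 2 \<or> card (nbrs E0 l) < 2)"
      using less.hyps E1(2) by blast
    then show ?thesis using E1(1) by (meson rtranclp.rtrancl_into_rtrancl)
  qed
qed

lemma star_graph_iso:
  assumes "finite V" "c \<in> V" "n = card V"
  shows "graph_iso (star_graph n) (V, {{c, v} | v. v \<in> V - {c}})"
proof -
  have "card {2..n} = card (V - {c})" using assms by simp
  then obtain h where h: "bij_betw h {2..n} (V - {c})" using finite_same_card_bij[of "{2..n}" "V - {c}"] assms(1) by blast
  define f where "f = (\<lambda>i. if i = 1 then c else h i)"
  have n: "n \<ge> 1" using assms by (metis One_nat_def Suc_leI card_gt_0_iff empty_iff)
  have split: "{1..n} = insert 1 {2..n}" using n by auto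
  have h_in: "h i \<in> V - {c}" if "i \<in> {2..n}" for i using h that by (auto simp: bij_betw_def)
  have bij: "bij_betw f {1..n} V"
    unfolding bij_betw_def
  proof
    show "inj_on f {1..n}"
    proof (rule inj_onI)
      fix i j assume ij: "i \<in> {1..n}" "j \<in> {1..n}" "f i = f j"
      have ih: "inj_on h {2..n}" using h by (simp add: bij_betw_def)
      show "i = j"
      proof (cases "i = 1"; cases "j = 1")
        assume "i \<noteq> 1" "j \<noteq> 1"
        then show ?thesis using ij ih by (auto simp: f_def dest: inj_onD)
      next
        assume "i = 1" "j \<noteq> 1"
        then show ?thesis using ij h_in[of j] by (auto simp: f_def)
      next
        assume "i \<noteq> 1" "j = 1"
        then show ?thesis using ij h_in[of i] by (auto simp: f_def)
      qed simp
    qed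
    have "f ` {2..n} = h ` {2..n}" by (rule image_cong) (auto simp: f_def)
    then have "f ` {2..n} = V - {c}" using h by (simp add: bij_betw_def)
    moreover have "f 1 = c" by (simp add: f_def)
    ultimately have "f ` {1..n} = insert c (V - {c})" unfolding split image_insert by simp
    then show "f ` {1..n} = V" using assms(2) by auto
  qed
  have fc: "f i = c \<longleftrightarrow> i = 1" if "i \<in> {1..n}" for i using that h_in[of i] by (auto simp: f_def)
  have fV: "f i \<in> V" if "i \<in> {1..n}" for i using bij that by (auto simp: bij_betw_def)
  have "adj (star_graph n) i j \<longleftrightarrow> adj (V, {{c, v} | v. v \<in> V - {c}}) (f i) (f j)" if ij: "i \<in> {1..n}" "j \<in> {1..n}" for i j
  proof -
    have "adj (star_graph n) i j \<longleftrightarrow> (\<exists>k. {i, j} = {1, k} \<and> 2 \<le> k \<and> k \<le> n)" by (auto simp: adj_def star_graph_def)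
    also have "\<dots> \<longleftrightarrow> i = 1 \<and> j \<noteq> 1 \<or> j = 1 \<and> i \<noteq> 1" using ij by (auto simp: doubleton_eq_iff)
    also have "\<dots> \<longleftrightarrow> f i = c \<and> f j \<noteq> c \<or> f j = c \<and> f i \<noteq> c" using fc ij by simp
    also have "\<dots> \<longleftrightarrow> (\<exists>v. {f i, f j} = {c, v} \<and> v \<in> V - {c})" using fV ij by (auto simp: doubleton_eq_iff)
    also have "\<dots> \<longleftrightarrow> adj (V, {{c, v} | v. v \<in> V - {c}}) (f i) (f j)" by (auto simp: adj_iff)
    finally show ?thesis .
  qed
  then show ?thesis unfolding graph_iso_def using bij by (intro exI[of _ f]) (simp add: star_graph_def)
qed

text \<open>
  Choose \<open>c\<close> of degree at least two if there is such a vertex, and arbitrarily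
  otherwise. Then all neighbours of \<open>c\<close> are leaves, so \<open>c\<close> and its
  neighbours form a closed set.
\<close>

lemma star_shape:
  assumes T: "tree_graph (V, E)" and leafy: "\<forall>c l. {c, l} \<in> E \<longrightarrow> card (nbrs E c) < 2 \<or> card (nbrs E l) < 2"
  shows "\<exists>c\<in>V. E = {{c, v} | v. v \<in> V - {c}}"
proof -
  have edges: "\<And>e. e \<in> E \<Longrightarrow> e \<subseteq> V \<and> card e = 2" and fin: "finite V" and conn: "linked E V"
    using T by (auto simp: tree_graph_def simple_graph_def graph_connected_linked)
  have fnb: "finite (nbrs E v)" for v by (rule finite_subset[OF nbrs_subset fin]) (use edges in blast)
  obtain v0 where v0: "v0 \<in> V" using T by (auto simp: tree_graph_def)
  obtain c where c: "c \<in> V" "\<And>a. {c, a} \<in> E \<Longrightarrow> card (nbrs E a) < 2"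
  proof (cases "\<exists>c\<in>V. card (nbrs E c) \<ge> 2")
    case True
    then obtain c where "c \<in> V" "card (nbrs E c) \<ge> 2" by blast
    then show ?thesis using leafy that[of c] by (meson not_less)
  next
    case False
    then show ?thesis using v0 that[of v0] edges by (meson insert_subset not_less)
  qed
  have nbrs_a: "b = c" if "{c, a} \<in> E" "{a, b} \<in> E" for a b
  proof (rule ccontr)
    assume "b \<noteq> c"
    moreover have "b \<in> nbrs E a" "c \<in> nbrs E a" using that by (simp_all add: nbrs_def insert_commute)
    ultimately have "2 \<le> card (nbrs E a)" using card_ge_2[OF fnb] by metis
    then show False using c(2)[OF that(1)] by simp
  qed
  have "insert c (nbrs E c) = V"
  proof (rule linkedD[OF conn, of _ c])
    show "insert c (nbrs E c) \<subseteq> V" using c(1) edges by (auto simp: nbrs_def)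
    fix a b assume "a \<in> insert c (nbrs E c)" "{a, b} \<in> E"
    then show "b \<in> insert c (nbrs E c)" using nbrs_a[of a b] by (auto simp: nbrs_def)
  qed simp
  then have adjc: "{c, v} \<in> E" if "v \<in> V - {c}" for v using that by (auto simp: nbrs_def)
  have "e \<in> {{c, v} | v. v \<in> V - {c}}" if e: "e \<in> E" for e
  proof -
    have "e \<subseteq> V" "card e = 2" using edges[OF e] by auto
    then obtain a b where ab: "e = {a, b}" "a \<noteq> b" "a \<in> V" "b \<in> V" by (auto simp: card_2_iff)
    show ?thesis
    proof (cases "a = c")
      case True then show ?thesis using ab by auto
    next
      case False
      then have "b = c" using nbrs_a[of a b] adjc[of a] ab e by simp
      then show ?thesis using ab False by (auto simp: insert_commute)
    qed
  qed
  then have "E = {{c, v} | v. v \<in> V - {c}}" using adjc by blast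
  then show ?thesis using c(1) by blast
qed

section \<open>The order on isomorphism classes\<close>

lemma tree_below:
  fixes T :: "'v::finite ugraph set"
  assumes "T \<in> tree_classes"
  shows "iso_class (path_graph CARD('v)) \<in> (tree_classes :: 'v ugraph set set)"
    "(iso_class (path_graph CARD('v)), T) \<in> tree_shift_order"
proof -
  obtain G :: "'v ugraph" where G: "T = iso_class G" "tree_graph G" "verts G = UNIV"
    using assms by (auto simp: tree_classes_def)
  define E where "E = edges G"
  have GE: "G = (UNIV, E)" using G(3) by (simp add: E_def prod_eq_iff)
  have TE: "tree_graph (UNIV, E)" using G(2) GE by simp
  obtain E' where E': "tree_shift\<^sup>*\<^sup>* (UNIV, E) (UNIV, E')" "tree_graph (UNIV, E')" "\<forall>v\<in>UNIV. card (nbrs E' v) \<le> 2"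
    using reach_small_degrees[OF TE] by blast
  have "graph_iso (path_graph CARD('v)) (UNIV, E')" by (rule small_degrees_path_iso[OF E'(2,3)])
  then have eq: "iso_class (path_graph CARD('v)) = (iso_class (UNIV, E') :: 'v ugraph set)" by (rule iso_class_eq)
  show cl: "iso_class (path_graph CARD('v)) \<in> (tree_classes :: 'v ugraph set set)"
    unfolding eq by (rule tree_in_class(1)[OF E'(2)]) simp
  have "(UNIV, E') \<in> iso_class (UNIV, E')" by (rule tree_in_class(2)[OF E'(2)]) simp
  moreover have "G \<in> T" unfolding G(1) by (rule tree_in_class(2)[OF G(2,3)])
  ultimately show "(iso_class (path_graph CARD('v)), T) \<in> tree_shift_order"
    unfolding tree_shift_order_def using cl assms E'(1) GE eq by blast
qed

lemma tree_above:
  fixes T :: "'v::finite ugraph set"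
  assumes "T \<in> tree_classes"
  shows "iso_class (star_graph CARD('v)) \<in> (tree_classes :: 'v ugraph set set)"
    "(T, iso_class (star_graph CARD('v))) \<in> tree_shift_order"
proof -
  obtain G :: "'v ugraph" where G: "T = iso_class G" "tree_graph G" "verts G = UNIV"
    using assms by (auto simp: tree_classes_def)
  define E where "E = edges G"
  have GE: "G = (UNIV, E)" using G(3) by (simp add: E_def prod_eq_iff)
  have TE: "tree_graph (UNIV, E)" using G(2) GE by simp
  obtain E0 where E0: "tree_shift\<^sup>*\<^sup>* (UNIV, E0) (UNIV, E)" "tree_graph (UNIV, E0)"
    "\<forall>c l. {c, l} \<in> E0 \<longrightarrow> card (nbrs E0 c) < 2 \<or> card (nbrs E0 l) < 2"
    using reach_from_star[OF TE] by blast
  obtain c where c: "E0 = {{c, v} | v. v \<in> UNIV - {c}}" using star_shape[OF E0(2,3)] by blast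
  have "graph_iso (star_graph CARD('v)) (UNIV, E0)" unfolding c by (rule star_graph_iso) simp_all
  then have eq: "iso_class (star_graph CARD('v)) = (iso_class (UNIV, E0) :: 'v ugraph set)" by (rule iso_class_eq)
  show cl: "iso_class (star_graph CARD('v)) \<in> (tree_classes :: 'v ugraph set set)"
    unfolding eq by (rule tree_in_class(1)[OF E0(2)]) simp
  have "(UNIV, E0) \<in> iso_class (UNIV, E0)" by (rule tree_in_class(2)[OF E0(2)]) simp
  moreover have "G \<in> T" unfolding G(1) by (rule tree_in_class(2)[OF G(2,3)])
  ultimately show "(T, iso_class (star_graph CARD('v))) \<in> tree_shift_order"
    unfolding tree_shift_order_def using cl assms E0(1) GE eq by blast
qed

lemma orderD:
  fixes T T' :: "'v::finite ugraph set"
  assumes "(T', T) \<in> tree_shift_order"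
  obtains E E' where "T \<in> tree_classes" "T' \<in> tree_classes" "(UNIV, E) \<in> T" "(UNIV, E') \<in> T'"
    "tree_graph (UNIV, E)" "tree_graph (UNIV, E')" "tree_shift\<^sup>*\<^sup>* (UNIV, E) (UNIV, E')"
    "E' = E \<or> leaf_count UNIV E' < leaf_count UNIV E" "gamma_le E' E"
proof -
  obtain G G' where G: "T \<in> tree_classes" "T' \<in> tree_classes" "G \<in> T" "G' \<in> T'" "tree_shift\<^sup>*\<^sup>* G G'"
    using assms unfolding tree_shift_order_def by blast
  define E where "E = edges G"
  have GE: "G = (UNIV, E)" using tree_class_member(2)[OF G(1,3)] by (simp add: E_def prod_eq_iff)
  have t: "tree_graph (UNIV, E)" using tree_class_member(1)[OF G(1,3)] GE by simp
  obtain E' where E': "G' = (UNIV, E')" "tree_graph (UNIV, E')" "E' = E \<or> leaf_count UNIV E' < leaf_count UNIV E" "gamma_le E' E"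
    using tree_shifts[OF G(5)[unfolded GE] t] by blast
  show thesis by (rule that[OF G(1,2) _ _ t E'(2) _ E'(3,4)]) (use G GE E'(1) in auto)
qed

lemma leaf_count_relabel:
  assumes "bij f"
  shows "leaf_count UNIV ((`) f ` E) = leaf_count UNIV E"
proof -
  have i: "inj f" using assms by (rule bij_is_inj)
  have "card (nbrs ((`) f ` E) (f v)) = card (nbrs E v)" for v
    using nbrs_relabel[OF i, of E v] by (simp add: card_image inj_on_subset[OF i])
  then have "{v \<in> UNIV. card (nbrs ((`) f ` E) v) = 1} = f ` {v \<in> UNIV. card (nbrs E v) = 1}"
    using bij_is_surj[OF assms] by (auto simp: image_iff) (metis surjD)
  then show ?thesis unfolding leaf_count_def by (simp add: card_image inj_on_subset[OF i])
qed

text \<open>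
  Going down and up again cannot lose a leaf, so the chain of shifts is constant.
\<close>

lemma tree_shift_order_antisym:
  fixes T T' :: "'v::finite ugraph set"
  assumes "(T', T) \<in> tree_shift_order" "(T, T') \<in> tree_shift_order"
  shows "T' = T"
proof -
  obtain E E' where 1: "T \<in> tree_classes" "T' \<in> tree_classes" "(UNIV, E) \<in> T" "(UNIV, E') \<in> T'"
    "E' = E \<or> leaf_count UNIV E' < leaf_count UNIV E" using assms(1) by (rule orderD)
  obtain D' D where 2: "(UNIV, D') \<in> T'" "(UNIV, D) \<in> T" "D = D' \<or> leaf_count UNIV D < leaf_count UNIV D'"
    using assms(2) by (rule orderD)
  have same: "leaf_count UNIV A = leaf_count UNIV B" if C: "C \<in> tree_classes" "(UNIV, A) \<in> C" "(UNIV, B) \<in> C"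
    for A B and C :: "'v ugraph set"
  proof -
    obtain f where "bij f" "(UNIV, B) = relabel f (UNIV, A)" using class_members_relabel[OF C] by blast
    then show ?thesis using leaf_count_relabel[of f A] by (simp add: relabel_def)
  qed
  have "\<not> leaf_count UNIV E' < leaf_count UNIV E"
    using same[OF 1(2,4) 2(1)] same[OF 1(1,3) 2(2)] 2(3) by auto
  then have "E' = E" using 1(5) by blast
  then show ?thesis using tree_class_member(3)[OF 1(1,3)] tree_class_member(3)[OF 1(2,4)] by simp
qed

text \<open>
  The two chains of shifts end and start in different labellings of the same tree; relabel the
  second chain.
\<close>

lemma tree_shift_order_trans:
  fixes T T' T'' :: "'v::finite ugraph set"
  assumes "(T'', T') \<in> tree_shift_order" "(T', T) \<in> tree_shift_order"
  shows "(T'', T) \<in> tree_shift_order"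
proof -
  obtain E E' where 1: "T \<in> tree_classes" "T' \<in> tree_classes" "(UNIV, E) \<in> T" "(UNIV, E') \<in> T'"
    "tree_shift\<^sup>*\<^sup>* (UNIV, E) (UNIV, E')" using assms(2) by (rule orderD)
  obtain D' D where 2: "T'' \<in> tree_classes" "(UNIV, D') \<in> T'" "(UNIV, D) \<in> T''" "tree_graph (UNIV, D)"
    "tree_shift\<^sup>*\<^sup>* (UNIV, D') (UNIV, D)" using assms(1) by (rule orderD)
  obtain f where f: "bij f" "(UNIV, E') = relabel f (UNIV, D')" using class_members_relabel[OF 1(2) 2(2) 1(4)] by blast
  have "tree_shift\<^sup>*\<^sup>* (UNIV, E') (relabel f (UNIV, D))" using tree_shifts_relabel[OF f(1) 2(5)] f(2) by simp
  then have "tree_shift\<^sup>*\<^sup>* (UNIV, E) (relabel f (UNIV, D))" using 1(5) by (rule rtranclp_trans[rotated])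
  moreover have "relabel f (UNIV, D) \<in> T''"
  proof -
    have "graph_iso (UNIV, D) (relabel f (UNIV, D))"
      unfolding graph_iso_def
      by (rule exI[of _ f]) (use f(1) adj_relabel[OF bij_is_inj[OF f(1)], of "(UNIV, D)"] in \<open>simp add: bij_betw_def bij_is_inj\<close>)
    moreover have "tree_graph (relabel f (UNIV, D))" by (rule tree_graph_relabel[OF bij_is_inj[OF f(1)] 2(4)])
    ultimately have "relabel f (UNIV, D) \<in> iso_class (UNIV, D)"
      using bij_is_surj[OF f(1)] by (simp add: iso_class_def tree_graph_def)
    then show ?thesis using tree_class_member(3)[OF 2(1,3)] by simp
  qed
  ultimately show ?thesis unfolding tree_shift_order_def using 1(1,3) 2(1) by blast
qed

lemma tree_shift_order_refl:
  fixes T :: "'v::finite ugraph set"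
  assumes "T \<in> tree_classes"
  shows "(T, T) \<in> tree_shift_order"
proof -
  obtain G :: "'v ugraph" where "T = iso_class G" "tree_graph G" "verts G = UNIV"
    using assms by (auto simp: tree_classes_def)
  then have "G \<in> T" using tree_in_class(2) by blast
  then show ?thesis unfolding tree_shift_order_def using assms by blast
qed

lemma tree_shift_order_gamma:
  fixes T T' :: "'v::finite ugraph set"
  assumes "(T', T) \<in> tree_shift_order" "G' \<in> T'" "G \<in> T"
  shows "coeff (gamma_building (building_set G')) i \<le> coeff (gamma_building (building_set G)) i"
proof -
  obtain E E' where 1: "T \<in> tree_classes" "T' \<in> tree_classes" "(UNIV, E) \<in> T" "(UNIV, E') \<in> T'"
    "tree_graph (UNIV, E)" "tree_graph (UNIV, E')" "gamma_le E' E" using assms(1) by (rule orderD)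
  obtain f where f: "bij f" "G = relabel f (UNIV, E)" using class_members_relabel[OF 1(1,3) assms(3)] by blast
  obtain f' where f': "bij f'" "G' = relabel f' (UNIV, E')" using class_members_relabel[OF 1(2,4) assms(2)] by blast
  show ?thesis
    using 1(7) gamma_building_relabel[OF f(1) 1(5)] gamma_building_relabel[OF f'(1) 1(6)]
    by (simp add: f(2) f'(2) gamma_le_def)
qed

theorem theorem4p2:
  fixes n :: nat
  assumes "CARD('v::finite) = n"
  shows "partial_order_on (tree_classes :: 'v ugraph set set) tree_shift_order
    \<and> (iso_class (path_graph n) \<in> (tree_classes :: 'v ugraph set set) \<and>
       (\<forall>M \<in> (tree_classes :: 'v ugraph set set).
          (\<forall>T \<in> tree_classes. (M, T) \<in> tree_shift_order) \<longleftrightarrow> M = iso_class (path_graph n)))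
    \<and> (iso_class (star_graph n) \<in> (tree_classes :: 'v ugraph set set) \<and>
       (\<forall>M \<in> (tree_classes :: 'v ugraph set set).
          (\<forall>T \<in> tree_classes. (T, M) \<in> tree_shift_order) \<longleftrightarrow> M = iso_class (star_graph n)))
    \<and> (\<forall>T' T :: 'v ugraph set. (T', T) \<in> tree_shift_order \<longrightarrow>
         (\<forall>G' \<in> T'. \<forall>G \<in> T. \<forall>i.
            coeff (gamma_building (building_set G')) i \<le> coeff (gamma_building (building_set G)) i))"
proof -
  define c where "c = (undefined :: 'v)"
  have "\<exists>T. T \<in> (tree_classes :: 'v ugraph set set)"
  proof -
    have "finite X \<Longrightarrow> \<exists>E. rtree c (insert c X) E" for X
    proof (induction X rule: finite_induct)
      case empty
      show ?case by (rule exI[of _ "{}"]) (simp add: rtree.single)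
    next
      case (insert x X)
      then obtain E where E: "rtree c (insert c X) E" by blast
      show ?case
      proof (cases "x = c")
        case True then show ?thesis using E by auto
      next
        case False
        then have "rtree c (insert c X \<union> {x}) (insert {c, x} (E \<union> {}))"
          using insert.hyps by (intro rtree.graft[OF E rtree.single]) auto
        moreover have "insert c X \<union> {x} = insert c (insert x X)" by auto
        ultimately show ?thesis by metis
      qed
    qed
    from this[of UNIV] obtain E where "rtree c UNIV E" by auto
    then have "tree_graph (UNIV, E)" by (rule rtree_imp_tree_graph)
    then show ?thesis using tree_in_class(1)[of "(UNIV, E)"] by auto
  qed
  then obtain T0 where T0: "T0 \<in> (tree_classes :: 'v ugraph set set)" by blast
  have po: "partial_order_on (tree_classes :: 'v ugraph set set) tree_shift_order"
    unfolding partial_order_on_def preorder_on_def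
  proof (intro conjI)
    show "(tree_shift_order :: ('v ugraph set \<times> 'v ugraph set) set) \<subseteq> tree_classes \<times> tree_classes"
      unfolding tree_shift_order_def by blast
    show "refl_on (tree_classes :: 'v ugraph set set) tree_shift_order"
      unfolding refl_on_def using tree_shift_order_refl by blast
    show "trans (tree_shift_order :: ('v ugraph set \<times> 'v ugraph set) set)"
      by (rule transI) (rule tree_shift_order_trans)
    show "antisym (tree_shift_order :: ('v ugraph set \<times> 'v ugraph set) set)"
      by (rule antisymI) (rule tree_shift_order_antisym)
  qed
  have path: "iso_class (path_graph n) \<in> (tree_classes :: 'v ugraph set set)"
    using tree_below(1)[OF T0] by (simp only: assms)
  have below: "(iso_class (path_graph n), T) \<in> tree_shift_order" if "T \<in> (tree_classes :: 'v ugraph set set)" for T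
    using tree_below(2)[OF that] by (simp only: assms)
  have star: "iso_class (star_graph n) \<in> (tree_classes :: 'v ugraph set set)"
    using tree_above(1)[OF T0] by (simp only: assms)
  have above: "(T, iso_class (star_graph n)) \<in> tree_shift_order" if "T \<in> (tree_classes :: 'v ugraph set set)" for T
    using tree_above(2)[OF that] by (simp only: assms)
  have min: "(\<forall>T \<in> tree_classes. (M, T) \<in> tree_shift_order) \<longleftrightarrow> M = iso_class (path_graph n)"
    if "M \<in> (tree_classes :: 'v ugraph set set)" for M
  proof
    assume "\<forall>T \<in> tree_classes. (M, T) \<in> tree_shift_order"
    then have "(M, iso_class (path_graph n)) \<in> tree_shift_order" using path by (rule bspec)
    then show "M = iso_class (path_graph n)" using below[OF that] by (rule tree_shift_order_antisym)
  qed (use below in simp)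
  have max: "(\<forall>T \<in> tree_classes. (T, M) \<in> tree_shift_order) \<longleftrightarrow> M = iso_class (star_graph n)"
    if "M \<in> (tree_classes :: 'v ugraph set set)" for M
  proof
    assume "\<forall>T \<in> tree_classes. (T, M) \<in> tree_shift_order"
    then have "(iso_class (star_graph n), M) \<in> tree_shift_order" using star by (rule bspec)
    with above[OF that] show "M = iso_class (star_graph n)" by (rule tree_shift_order_antisym)
  qed (use above in simp)
  show ?thesis
    by (intro conjI ballI allI impI po path min star max) (assumption | rule tree_shift_order_gamma)+
qed

end
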